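(* For every integer $n\ge1$, let $d_n:=\mathbb{E}\,D(\lambda)$, where $\lambda$ is a random partition of $n$ distributed according to the $n$th Plancherel measure and $D(\lambda):=\max\{i:\lambda_i\ge i\}$ is the side length of the Durfee square of $\lambda$. Then, as $n\to\infty$, $$d_n=\frac{2}{\pi}\sqrt{n}+\left(\frac{3}{16\pi}-\frac{e^2}{8\pi}\sin\left(4\sqrt{n}\right)\right)\frac{1}{\sqrt{n}}+O\left(n^{-1}\right).$$
   Context: A partition $\lambda=(\lambda_1,\ldots,\lambda_k)$ of $n$ (written $\lambda\vdash n$) with $\lambda_1\ge\cdots\ge\lambda_k\ge 1$ and $\lambda_1+\cdots+\lambda_k=n$ is identified with its Young diagram, the set of boxes $(i,j)$ (row $i$, column $j$) with $1\le i\le k$, $1\le j\le\lambda_i$. The Durfee square of $\lambda$ is the largest square fitting in the upper left corner of its Young diagram; in the definition of $D(\lambda)$ the index $i$ ranges over $1\le i\le k$. The $n$th Plancherel measure is the probability measure on partitions of $n$ giving $\lambda$ the probability $f_\lambda^2/n!$, where $f_\lambda$ is the number of standard Young tableaux of shape $\lambda$ (fillings of $\lambda$ with $1,\ldots,n$, each used once, increasing along rows and columns). Equivalently, the probability of $\lambda$ is $n!/\prod_{u\in\lambda}h_u^2$, where the hook length $h_u$ of a box $u$ is one more than the number of boxes to the right of $u$ in its row plus the number of boxes below $u$ in its column. *)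

theory Defs
  imports "HOL-Probability.Probability" "HOL-Library.Landau_Symbols"
begin

text \<open>
  A partition \<open>\<lambda> = (\<lambda>\<^sub>1, \<dots>, \<lambda>\<^sub>k)\<close> is the list of its parts, so that
  \<open>\<lambda>\<^sub>i\<close> is \<open>l ! (i - 1)\<close> for \<open>1 \<le> i \<le> k = length l\<close>.
\<close>

definition partitions :: "nat \<Rightarrow> nat list set" where
  "partitions n = {l. sorted_wrt (\<ge>) l \<and> (\<forall>x\<in>set l. 1 \<le> x) \<and> sum_list l = n}"

definition part :: "nat list \<Rightarrow> nat \<Rightarrow> nat" where
  "part l i = l ! (i - 1)"

definition young_diagram :: "nat list \<Rightarrow> (nat \<times> nat) set" where
  "young_diagram l = {(i, j). 1 \<le> i \<and> i \<le> length l \<and> 1 \<le> j \<and> j \<le> part l i}"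

text \<open>
  Fillings are extensional, i.e. equal to \<^const>\<open>undefined\<close> outside the diagram, so that
  each standard Young tableau is represented by exactly one function.
\<close>

definition standard_young_tableaux :: "nat list \<Rightarrow> (nat \<times> nat \<Rightarrow> nat) set" where
  "standard_young_tableaux l =
     {T \<in> extensional (young_diagram l).
        bij_betw T (young_diagram l) {1..sum_list l} \<and>
        (\<forall>i j j'. (i, j) \<in> young_diagram l \<longrightarrow> (i, j') \<in> young_diagram l \<longrightarrow>
           j < j' \<longrightarrow> T (i, j) < T (i, j')) \<and>
        (\<forall>i i' j. (i, j) \<in> young_diagram l \<longrightarrow> (i', j) \<in> young_diagram l \<longrightarrow>
           i < i' \<longrightarrow> T (i, j) < T (i', j))}"

definition num_syt :: "nat list \<Rightarrow> nat" where
  "num_syt l = card (standard_young_tableaux l)"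

definition plancherel_measure :: "nat \<Rightarrow> nat list measure" where
  "plancherel_measure n =
     point_measure (partitions n) (\<lambda>l. ennreal ((real (num_syt l))\<^sup>2 / fact n))"

text \<open>
  The set below contains 1 for every nonempty partition; for the empty partition (\<open>n = 0\<close>)
  the value of \<^const>\<open>Max\<close> is unspecified.
\<close>

definition durfee :: "nat list \<Rightarrow> nat" where
  "durfee l = Max {i. 1 \<le> i \<and> i \<le> length l \<and> i \<le> part l i}"

definition expected_durfee :: "nat \<Rightarrow> real" where
  "expected_durfee n = (LINT l|plancherel_measure n. real (durfee l))"

end

theory Submission
  imports Defs "HOL-Complex_Analysis.Complex_Analysis" "HOL-Real_Asymp.Real_Asymp"
begin

text \<open>
  The Durfee size is the number of boxes of content 0. For a function \<open>g\<close> of the content, adding a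
  box to a random diagram changes the mean of \<open>\<Sum>\<^sub>u g(c\<^sub>u)\<close> by a quantity that is governed, through the
  commutation of adding and removing boxes, by the same mean for the second difference of \<open>g\<close>.
  Central factorials are stable under second differences, which makes their means explicit, and
  expanding the indicator of content 0 in central factorials gives
  \<open>d\<^sub>n = \<Sum>\<^sub>k (-1)\<^sup>k (2k choose k) (n choose k+1) / (k+1)!\<close>.

  As \<open>(2k choose k)\<close> is the \<open>k\<close>-th moment of \<open>x = 4 sin\<^sup>2 t\<close>, \<open>t\<close> uniform in \<open>[0, \<pi>/2]\<close>, this is the mean of
  \<open>(1 - L\<^sub>n(x)) / x\<close> with the Laguerre polynomial \<open>L\<^sub>n\<close>. With \<open>N = n + 1/2\<close> one has
  \<open>L\<^sub>n(x) \<approx> e\<^bsup>x/2\<^esup> J\<^sub>0(2 sqrt (N x))\<close> plus a \<open>J\<^sub>1\<close> correction whose contribution is \<open>O(1/N)\<close>. The mean of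
  \<open>(1 - J\<^sub>0) / x\<close> is an explicit quadratic expression in \<open>J\<^sub>0, J\<^sub>1\<close> at \<open>2 sqrt N\<close>; in the remaining
  term \<open>(1 - e\<^bsup>x/2\<^esup>) / x \<sqdot> J\<^sub>0\<close> only the values of the amplitude at \<open>x = 0\<close> and \<open>x = 4\<close> matter, and the
  value \<open>(1 - e\<^sup>2) / 4\<close> at \<open>x = 4\<close> produces the factor \<open>e\<^sup>2\<close>.
\<close>

section \<open>Young diagrams\<close>

text \<open>The wanted second term has size \<open>1 / sqrt n\<close>, so after the division by
  \<open>x\<close> every approximation must be accurate to \<open>O(1 / n)\<close> uniformly down to
  \<open>x = 0\<close>. Plain \<open>J0\<close> leaves the residual \<open>x / 4 * J0\<close> in the
  equation of \<open>exp (- x / 2) * L_n(x)\<close>, and an energy estimate then gives only an error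
  of order \<open>x / sqrt N\<close>, which is too large. The \<open>J1\<close> correction turns the
  residual into a multiple of \<open>bessel' (N * x)\<close>, which is at most
  \<open>1 / sqrt (N * x)\<close>, and the error becomes \<open>O(x / N)\<close>. The shift
  \<open>N = n + 1 / 2\<close> comes from the factor \<open>exp (- x / 2)\<close>, which removes the
  term \<open>- x * L'\<close> from Laguerre's equation at the cost of \<open>1 / 2\<close> in the
  constant coefficient.

  A second obstacle: the differential equation of \<open>J0\<close> determines its behaviour at
  infinity only up to amplitude and phase. These are pinned down by the limit of
  \<open>z * J0(z)^2\<close>, for which the difference of squares and the product of the two Fresnel
  integrals suffice.\<close>

definition young :: "(nat \<times> nat) set \<Rightarrow> bool" where
  "young D \<longleftrightarrow> finite D \<and> (\<forall>i j. (i, j) \<in> D \<longrightarrow> 1 \<le> i \<and> 1 \<le> j) \<and>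
     (\<forall>i j i' j'. (i, j) \<in> D \<longrightarrow> 1 \<le> i' \<longrightarrow> i' \<le> i \<longrightarrow> 1 \<le> j' \<longrightarrow> j' \<le> j \<longrightarrow> (i', j') \<in> D)"

definition diagrams :: "nat \<Rightarrow> (nat \<times> nat) set set" where
  "diagrams n = {D. young D \<and> card D = n}"

definition addable :: "(nat \<times> nat) set \<Rightarrow> (nat \<times> nat) set" where
  "addable D = {b. b \<notin> D \<and> young (insert b D)}"

definition removable :: "(nat \<times> nat) set \<Rightarrow> (nat \<times> nat) set" where
  "removable D = {b \<in> D. young (D - {b})}"

lemma young_finite: "young D \<Longrightarrow> finite D"
  by (simp add: young_def)

lemma young_closed:
  "\<lbrakk>young D; (i, j) \<in> D; 1 \<le> i'; i' \<le> i; 1 \<le> j'; j' \<le> j\<rbrakk> \<Longrightarrow> (i', j') \<in> D"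
  unfolding young_def by blast

lemma young_pos: "young D \<Longrightarrow> (i, j) \<in> D \<Longrightarrow> 1 \<le> i \<and> 1 \<le> j"
  unfolding young_def by blast

text \<open>Order ideals form a lattice under intersection and union; these two closure properties
  carry the commutation of adding and removing boxes.\<close>

lemma young_Int: "young C \<Longrightarrow> young D \<Longrightarrow> young (C \<inter> D)"
  unfolding young_def by blast

lemma young_Un: "young C \<Longrightarrow> young D \<Longrightarrow> young (C \<union> D)"
  unfolding young_def by blast

lemma young_empty: "young {}"
  by (simp add: young_def)

text \<open>A box \<open>(i, j)\<close> forces the whole \<open>i\<close> by \<open>j\<close>
  rectangle into \<open>D\<close>, so both coordinates are at most \<open>card D\<close>. This makes
  \<open>diagrams n\<close> finite and later bounds the contents.\<close>

lemma young_subset_square: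
  assumes "young D"
  shows "D \<subseteq> {1..card D} \<times> {1..card D}"
proof
  fix b assume "b \<in> D"
  obtain i j where b: "b = (i, j)" by force
  have ij: "1 \<le> i" "1 \<le> j" using young_pos[OF assms] \<open>b \<in> D\<close> b by auto
  have "{1..i} \<times> {1..j} \<subseteq> D"
    using young_closed[OF assms, of i j] \<open>b \<in> D\<close> b by auto
  hence "card ({1..i} \<times> {1..j}) \<le> card D"
    by (intro card_mono young_finite assms)
  hence "i * j \<le> card D" by (simp add: card_cartesian_product)
  moreover have "i \<le> i * j" "j \<le> i * j" using ij by auto
  ultimately have "i \<le> card D" "j \<le> card D" by linarith+
  thus "b \<in> {1..card D} \<times> {1..card D}" using ij b by auto
qed

lemma finite_diagrams: "finite (diagrams n)"
proof (rule finite_subset)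
  show "diagrams n \<subseteq> Pow ({1..n} \<times> {1..n})"
    using young_subset_square by (fastforce simp: diagrams_def)
qed auto

lemma diagrams_0: "diagrams 0 = {{}}"
  using young_finite young_empty by (auto simp: diagrams_def)

section \<open>Commutation of adding and removing boxes\<close>

lemma finite_addable:
  assumes "young D"
  shows "finite (addable D)"
proof (rule finite_subset)
  show "addable D \<subseteq> {1..Suc (card D)} \<times> {1..Suc (card D)}"
  proof
    fix b assume b: "b \<in> addable D"
    hence "card (insert b D) = Suc (card D)"
      using young_finite[OF assms] by (simp add: addable_def)
    thus "b \<in> {1..Suc (card D)} \<times> {1..Suc (card D)}"
      using young_subset_square[of "insert b D"] b by (auto simp: addable_def)
  qed
qed auto

lemma finite_removable: "young D \<Longrightarrow> finite (removable D)"
  by (simp add: removable_def young_finite)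

text \<open>Both sides run over the edges of Young's graph between levels \<open>n\<close> and
  \<open>n + 1\<close>, listed by their upper end on the left and by their lower end on the
  right.\<close>

lemma sum_removable_eq_sum_addable:
  "(\<Sum>D\<in>diagrams (Suc n). \<Sum>b\<in>removable D. \<Phi> D b)
     = (\<Sum>C\<in>diagrams n. \<Sum>b\<in>addable C. \<Phi> (insert b C) b :: real)"
proof -
  have "(\<Sum>D\<in>diagrams (Suc n). \<Sum>b\<in>removable D. \<Phi> D b)
          = (\<Sum>(D,b)\<in>(SIGMA D:diagrams (Suc n). removable D). \<Phi> D b)"
    by (intro sum.Sigma finite_diagrams ballI finite_removable) (auto simp: diagrams_def)
  also have "\<dots> = (\<Sum>(C,b)\<in>(SIGMA C:diagrams n. addable C). \<Phi> (insert b C) b)"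
    by (rule sum.reindex_bij_witness[where i = "\<lambda>(C,b). (insert b C, b)"
            and j = "\<lambda>(D,b). (D - {b}, b)"])
       (auto simp: diagrams_def addable_def removable_def insert_absorb young_finite
          dest: young_finite)
  also have "\<dots> = (\<Sum>C\<in>diagrams n. \<Sum>b\<in>addable C. \<Phi> (insert b C) b)"
    by (intro sum.Sigma[symmetric] finite_diagrams ballI finite_addable) (auto simp: diagrams_def)
  finally show ?thesis .
qed

text \<open>The missing intermediate diagram is obtained from the known ones:
  \<open>C - {b'}\<close> as an intersection, \<open>insert b C\<close> as a union.\<close>

lemma add_remove_commute:
  assumes "young C" "b \<noteq> b'"
  shows "b \<in> addable C \<and> b' \<in> removable (insert b C)
           \<longleftrightarrow> b' \<in> removable C \<and> b \<in> addable (C - {b'})"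
proof
  assume *: "b \<in> addable C \<and> b' \<in> removable (insert b C)"
  have "C - {b'} = C \<inter> (insert b C - {b'})" by auto
  hence "young (C - {b'})"
    using young_Int[OF assms(1)] * by (simp add: removable_def)
  moreover have "insert b (C - {b'}) = insert b C - {b'}" using assms by auto
  ultimately show "b' \<in> removable C \<and> b \<in> addable (C - {b'})"
    using * assms by (auto simp: addable_def removable_def)
next
  assume *: "b' \<in> removable C \<and> b \<in> addable (C - {b'})"
  have "insert b C = C \<union> insert b (C - {b'})" by auto
  moreover have "young (insert b (C - {b'}))" using * by (simp add: addable_def)
  ultimately have "young (insert b C)"
    using young_Un[OF assms(1), of "insert b (C - {b'})"] by argo
  moreover have "insert b (C - {b'}) = insert b C - {b'}" using assms by auto
  ultimately show "b \<in> addable C \<and> b' \<in> removable (insert b C)"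
    using * assms by (auto simp: addable_def removable_def)
qed

text \<open>A weighted form of the relation \<open>D U - U D = I\<close> in Young's graph. Pairs
  with \<open>b \<noteq> b'\<close> match on both sides; the diagonal pairs lead back to
  \<open>C\<close> and give the two single sums. The first argument of \<open>\<Psi>\<close> is the
  added box, which later enters through its content.\<close>

lemma sum_add_remove_commute:
  fixes \<Psi> :: "nat \<times> nat \<Rightarrow> (nat \<times> nat) set \<Rightarrow> real"
  assumes C: "young C"
  shows "(\<Sum>b\<in>addable C. \<Sum>b'\<in>removable (insert b C). \<Psi> b (insert b C - {b'}))
     = (\<Sum>b\<in>addable C. \<Psi> b C) - (\<Sum>b\<in>removable C. \<Psi> b C)
       + (\<Sum>b'\<in>removable C. \<Sum>b\<in>addable (C - {b'}). \<Psi> b (insert b (C - {b'})))"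
proof -
  have fin1: "finite (removable (insert b C))" for b
    using young_finite[OF C] by (simp add: removable_def)
  have fin2: "finite (addable (C - {b'}))" if "b' \<in> removable C" for b'
    using that by (intro finite_addable) (simp add: removable_def)
  let ?S = "SIGMA b:addable C. removable (insert b C) - {b}"
  let ?T = "SIGMA b':removable C. addable (C - {b'}) - {b'}"
  have key: "(b, b') \<in> ?S \<longleftrightarrow> (b', b) \<in> ?T" for b b'
    using add_remove_commute[OF C, of b b'] by auto
  have eq: "insert b C - {b'} = insert b (C - {b'})" if "b' \<noteq> b" for b b'
    using that by auto
  have "(\<Sum>b\<in>addable C. \<Sum>b'\<in>removable (insert b C) - {b}. \<Psi> b (insert b C - {b'}))
      = (\<Sum>(b,b')\<in>(SIGMA b:addable C. removable (insert b C) - {b}). \<Psi> b (insert b C - {b'}))"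
    using fin1 by (intro sum.Sigma finite_addable[OF C]) auto
  also have "\<dots> = (\<Sum>(b',b)\<in>(SIGMA b':removable C. addable (C - {b'}) - {b'}).
                       \<Psi> b (insert b (C - {b'})))"
  proof (rule sum.reindex_bij_witness[where i = prod.swap and j = prod.swap])
    fix p
    show "prod.swap (prod.swap p) = p" "prod.swap (prod.swap p) = p" by simp_all
    show "prod.swap p \<in> ?T" if "p \<in> ?S" for p
      using that key[of "fst p" "snd p"] by (simp only: prod.collapse prod.swap_def)
    show "prod.swap p \<in> ?S" if "p \<in> ?T" for p
      using that key[of "snd p" "fst p"] by (simp only: prod.collapse prod.swap_def)
    show "(case prod.swap p of (b', b) \<Rightarrow> \<Psi> b (insert b (C - {b'})))
            = (case p of (b, b') \<Rightarrow> \<Psi> b (insert b C - {b'}))" if "p \<in> ?S" for p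
    proof -
      obtain b b' where p: "p = (b, b')" by (cases p)
      have "b' \<noteq> b" using that unfolding p by blast
      from eq[OF this] show ?thesis unfolding p by simp
    qed
  qed
  also have "\<dots> = (\<Sum>b'\<in>removable C. \<Sum>b\<in>addable (C - {b'}) - {b'}. \<Psi> b (insert b (C - {b'})))"
    using fin2 by (intro sum.Sigma[symmetric] finite_removable[OF C]) auto
  finally have main:
    "(\<Sum>b\<in>addable C. \<Sum>b'\<in>removable (insert b C) - {b}. \<Psi> b (insert b C - {b'}))
      = (\<Sum>b'\<in>removable C. \<Sum>b\<in>addable (C - {b'}) - {b'}. \<Psi> b (insert b (C - {b'})))" .
  have "(\<Sum>b'\<in>removable (insert b C). \<Psi> b (insert b C - {b'}))
      = \<Psi> b C + (\<Sum>b'\<in>removable (insert b C) - {b}. \<Psi> b (insert b C - {b'}))"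
    if "b \<in> addable C" for b
  proof -
    have "b \<in> removable (insert b C)" "insert b C - {b} = C"
      using that C by (auto simp: addable_def removable_def)
    thus ?thesis using sum.remove[OF fin1, of b b "\<lambda>b'. \<Psi> b (insert b C - {b'})"] by simp
  qed
  moreover have "(\<Sum>b\<in>addable (C - {b'}). \<Psi> b (insert b (C - {b'})))
      = \<Psi> b' C + (\<Sum>b\<in>addable (C - {b'}) - {b'}. \<Psi> b (insert b (C - {b'})))"
    if "b' \<in> removable C" for b'
  proof -
    have "b' \<in> addable (C - {b'})" "insert b' (C - {b'}) = C"
      using that C by (auto simp: addable_def removable_def insert_absorb)
    thus ?thesis using sum.remove[OF fin2[OF that], of b' "\<lambda>b. \<Psi> b (insert b (C - {b'}))"] by simp
  qed
  ultimately show ?thesis using main by (simp add: sum.distrib)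
qed

section \<open>Row lengths and contents of corners\<close>

lemma down_closed_nat_set:
  assumes "finite R" "0 \<notin> R" "\<And>j j'. j \<in> R \<Longrightarrow> 1 \<le> j' \<Longrightarrow> j' \<le> j \<Longrightarrow> j' \<in> R"
  shows "R = {1..card R}"
proof (cases "R = {}")
  case False
  have "R = {1..Max R}"
  proof
    show "R \<subseteq> {1..Max R}"
    proof
      fix x assume "x \<in> R"
      thus "x \<in> {1..Max R}" using assms(1,2) by (cases x) auto
    qed
    show "{1..Max R} \<subseteq> R" using assms(3)[OF Max_in[OF assms(1) False]] by auto
  qed
  moreover from this have "card R = Max R" by (metis card_atLeastAtMost diff_Suc_1)
  ultimately show ?thesis by simp
qed auto

text \<open>Row lengths are counted from 0 and extended by 0, so that sums over
  \<open>m < card D\<close> cover all rows and the empty ones need no separate treatment.\<close>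

lemma young_rowsE:
  assumes "young D"
  obtains \<rho> where "antimono \<rho>" "\<rho> (card D) = 0" "\<And>m j. (Suc m, Suc j) \<in> D \<longleftrightarrow> j < \<rho> m"
proof -
  define R where "R m = {j. (Suc m, j) \<in> D}" for m
  define \<rho> where "\<rho> m = card (R m)" for m
  have fin: "finite (R m)" for m
  proof (rule finite_subset)
    show "R m \<subseteq> snd ` D" by (force simp: R_def)
  qed (use young_finite[OF assms] in auto)
  have R: "R m = {1..\<rho> m}" for m
    unfolding \<rho>_def
  proof (rule down_closed_nat_set[OF fin])
    show "0 \<notin> R m" using young_pos[OF assms, of "Suc m" 0] by (auto simp: R_def)
    show "j' \<in> R m" if "j \<in> R m" "1 \<le> j'" "j' \<le> j" for j j'
      using that young_closed[OF assms, of "Suc m" j "Suc m" j'] by (auto simp: R_def)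
  qed
  have mem: "(Suc m, Suc j) \<in> D \<longleftrightarrow> j < \<rho> m" for m j
  proof -
    have "(Suc m, Suc j) \<in> D \<longleftrightarrow> Suc j \<in> R m" by (simp add: R_def)
    thus ?thesis by (simp add: R Suc_le_eq)
  qed
  have "antimono \<rho>"
  proof (rule antimonoI, unfold \<rho>_def, rule card_mono[OF fin])
    fix m m' :: nat assume "m \<le> m'"
    show "R m' \<subseteq> R m"
    proof
      fix j assume "j \<in> R m'"
      thus "j \<in> R m" using \<open>m \<le> m'\<close> young_closed[OF assms, of "Suc m'" j "Suc m" j]
          young_pos[OF assms, of "Suc m'" j] by (auto simp: R_def)
    qed
  qed
  moreover have "\<rho> (card D) = 0"
  proof -
    have "(Suc (card D), Suc 0) \<notin> D" using young_subset_square[OF assms] by auto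
    thus ?thesis using mem[of "card D" 0] by simp
  qed
  ultimately show ?thesis using that mem by blast
qed

definition box_content :: "nat \<times> nat \<Rightarrow> int" where
  "box_content b = int (snd b) - int (fst b)"

definition content_sum :: "(int \<Rightarrow> real) \<Rightarrow> (nat \<times> nat) set \<Rightarrow> real" where
  "content_sum g D = (\<Sum>b\<in>D. g (box_content b))"

text \<open>Along a row the second difference telescopes to first differences at the two ends. The
  left ends telescope again down the first column; at the right ends consecutive rows cancel except
  where the border has a corner, with opposite signs for addable and removable ones.\<close>

lemma sum_addable_minus_removable:
  assumes "young D"
  shows "(\<Sum>b\<in>addable D. g (box_content b)) - (\<Sum>b\<in>removable D. g (box_content b))
           = g 0 + content_sum (\<lambda>c. g (c + 1) - 2 * g c + g (c - 1)) D"
proof -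
  define n where "n = card D"
  obtain \<rho> where anti: "antimono \<rho>" and \<rho>n: "\<rho> n = 0"
    and mem: "\<And>m j. (Suc m, Suc j) \<in> D \<longleftrightarrow> j < \<rho> m"
    using young_rowsE[OF assms] unfolding n_def by blast
  have le: "m \<le> m' \<Longrightarrow> \<rho> m' \<le> \<rho> m" for m m' using anti by (rule antimonoD)
  have D: "D = (SIGMA i:{1..n}. {1..\<rho> (i - 1)})"
  proof (rule set_eqI, clarify)
    fix i j
    show "(i, j) \<in> D \<longleftrightarrow> (i, j) \<in> (SIGMA i:{1..n}. {1..\<rho> (i - 1)})"
    proof (cases "1 \<le> i \<and> 1 \<le> j")
      case True
      then obtain m k where mk: "i = Suc m" "j = Suc k"
        by (metis Suc_le_D One_nat_def)
      have "k < \<rho> m \<Longrightarrow> m < n" using le[of n m] \<rho>n by (cases "m < n") auto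
      thus ?thesis by (auto simp: mk mem Suc_le_eq)
    next
      case False
      thus ?thesis using young_pos[OF assms, of i j] by auto
    qed
  qed
  \<comment> \<open>Row \<open>m = n\<close> has to be included: if all \<open>n\<close> boxes lie
    in one column, the box below them is addable.\<close>
  have add: "addable D = (\<lambda>m. (Suc m, Suc (\<rho> m))) ` {m. m \<le> n \<and> (m = 0 \<or> \<rho> m < \<rho> (m - 1))}"
  proof (intro equalityI subsetI)
    fix b assume b: "b \<in> addable D"
    then obtain m j where mj: "b = (Suc m, Suc j)"
      using young_pos[of "insert b D" "fst b" "snd b"] unfolding addable_def
      by (metis (no_types, lifting) One_nat_def Suc_le_D insertI1 mem_Collect_eq prod.collapse)
    have y: "young (insert b D)" and "b \<notin> D" using b by (auto simp: addable_def)
    hence "\<rho> m \<le> j" using mem mj by auto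
    moreover have "\<not> \<rho> m < j"
    proof
      assume "\<rho> m < j"
      hence "(Suc m, Suc (\<rho> m)) \<in> insert b D"
        using young_closed[OF y, of "Suc m" "Suc j" "Suc m" "Suc (\<rho> m)"] mj by auto
      thus False using mj mem \<open>\<rho> m < j\<close> by auto
    qed
    ultimately have j: "j = \<rho> m" by simp
    have "\<rho> m < \<rho> (m - 1)" if "m \<noteq> 0"
    proof -
      obtain m' where m': "m = Suc m'" using \<open>m \<noteq> 0\<close> not0_implies_Suc by blast
      have "(Suc m', Suc j) \<in> insert b D"
        using young_closed[OF y, of "Suc m" "Suc j" "Suc m'" "Suc j"] mj m' by auto
      thus ?thesis using mj m' mem j by auto
    qed
    moreover have "m \<le> n"
    proof (rule ccontr)
      assume "\<not> m \<le> n"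
      hence "\<rho> (m - 1) = 0" using le[of n "m - 1"] \<rho>n by simp
      with calculation show False using \<open>\<not> m \<le> n\<close> by simp
    qed
    ultimately show "b \<in> (\<lambda>m. (Suc m, Suc (\<rho> m))) ` {m. m \<le> n \<and> (m = 0 \<or> \<rho> m < \<rho> (m - 1))}"
      using mj j by (intro image_eqI[where x = m]) auto
  next
    fix b assume "b \<in> (\<lambda>m. (Suc m, Suc (\<rho> m))) ` {m. m \<le> n \<and> (m = 0 \<or> \<rho> m < \<rho> (m - 1))}"
    then obtain m where m: "b = (Suc m, Suc (\<rho> m))" "m = 0 \<or> \<rho> m < \<rho> (m - 1)" by auto
    have "young (insert b D)"
      unfolding young_def
    proof (intro conjI allI impI)
      show "finite (insert b D)" using young_finite[OF assms] by simp
      fix i j assume ij: "(i, j) \<in> insert b D"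
      show "1 \<le> i" "1 \<le> j" using ij young_pos[OF assms, of i j] m by auto
      fix i' j' assume le': "1 \<le> i'" "i' \<le> i" "1 \<le> j'" "j' \<le> j"
      show "(i', j') \<in> insert b D"
      proof (cases "(i, j) \<in> D")
        case True
        thus ?thesis using young_closed[OF assms] le' by blast
      next
        case False
        hence ij': "i = Suc m" "j = Suc (\<rho> m)" using ij m by auto
        obtain p q where pq: "i' = Suc p" "j' = Suc q" using le' by (metis Suc_le_D One_nat_def)
        show ?thesis
        proof (cases "p = m")
          case True
          thus ?thesis using le' ij' pq mem[of p q] m(1) by (cases "q = \<rho> m") auto
        next
          case False
          hence "p \<le> m - 1" "m \<noteq> 0" using le' ij' pq by auto
          hence "\<rho> m < \<rho> p" using m(2) le[of p "m - 1"] by auto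
          thus ?thesis using le' ij' pq mem[of p q] by auto
        qed
      qed
    qed
    thus "b \<in> addable D" using m(1) mem by (simp add: addable_def)
  qed
  have rem: "removable D = (\<lambda>m. (Suc m, \<rho> m)) ` {m. m < n \<and> \<rho> (Suc m) < \<rho> m}"
  proof (intro equalityI subsetI)
    fix b assume b: "b \<in> removable D"
    then obtain m j where mj: "b = (Suc m, Suc j)"
      using young_pos[OF assms, of "fst b" "snd b"] unfolding removable_def
      by (metis (no_types, lifting) One_nat_def Suc_le_D mem_Collect_eq prod.collapse)
    have y: "young (D - {b})" and "b \<in> D" using b by (auto simp: removable_def)
    hence "j < \<rho> m" using mem mj by auto
    moreover have "\<not> Suc j < \<rho> m"
    proof
      assume "Suc j < \<rho> m"
      hence "(Suc m, Suc (Suc j)) \<in> D - {b}" using mem mj by auto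
      from young_closed[OF y this, of "Suc m" "Suc j"] mj show False by auto
    qed
    moreover have "\<not> j < \<rho> (Suc m)"
    proof
      assume "j < \<rho> (Suc m)"
      hence "(Suc (Suc m), Suc j) \<in> D - {b}" using mem mj by auto
      from young_closed[OF y this, of "Suc m" "Suc j"] mj show False by auto
    qed
    moreover have "m < n" using calculation(1) le[of n m] \<rho>n by (cases "m < n") auto
    ultimately have "Suc j = \<rho> m" "m < n" "\<rho> (Suc m) < \<rho> m" by auto
    thus "b \<in> (\<lambda>m. (Suc m, \<rho> m)) ` {m. m < n \<and> \<rho> (Suc m) < \<rho> m}"
      using mj by (intro image_eqI[where x = m]) auto
  next
    fix b assume "b \<in> (\<lambda>m. (Suc m, \<rho> m)) ` {m. m < n \<and> \<rho> (Suc m) < \<rho> m}"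
    then obtain m where m: "b = (Suc m, \<rho> m)" "\<rho> (Suc m) < \<rho> m" by auto
    then obtain r where r: "\<rho> m = Suc r" by (cases "\<rho> m") auto
    have "young (D - {b})"
      unfolding young_def
    proof (intro conjI allI impI)
      show "finite (D - {b})" using young_finite[OF assms] by simp
      fix i j assume ij: "(i, j) \<in> D - {b}"
      show "1 \<le> i" "1 \<le> j" using ij young_pos[OF assms, of i j] by auto
      fix i' j' assume le': "1 \<le> i'" "i' \<le> i" "1 \<le> j'" "j' \<le> j"
      have "(i', j') \<in> D" using ij le' young_closed[OF assms] by blast
      moreover have "(i', j') \<noteq> b"
      proof
        assume eq: "(i', j') = b"
        obtain p q where pq: "i = Suc p" "j = Suc q"
          using young_pos[OF assms, of i j] ij by (metis DiffD1 Suc_le_D One_nat_def)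
        have "m \<le> p" "r \<le> q" "q < \<rho> p" using ij pq mem[of p q] eq m r le' by auto
        moreover have "p = m"
        proof (rule ccontr)
          assume "p \<noteq> m"
          hence "\<rho> p \<le> \<rho> (Suc m)" using \<open>m \<le> p\<close> by (intro le) auto
          thus False using calculation m r by auto
        qed
        ultimately show False using ij pq m r by auto
      qed
      ultimately show "(i', j') \<in> D - {b}" by simp
    qed
    moreover have "b \<in> D" using m mem[of m r] r by simp
    ultimately show "b \<in> removable D" by (simp add: removable_def)
  qed
  \<comment> \<open>\<open>h m\<close> is the value at the box just after the end of row
    \<open>m\<close>, \<open>h' m\<close> the value at the last box of that row.\<close>
  define h where "h m = g (int (\<rho> m) - int m)" for m
  define h' where "h' m = g (int (\<rho> m) - int m - 1)" for m
  have "(\<Sum>b\<in>addable D. g (box_content b))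
      = (\<Sum>m | m \<le> n \<and> (m = 0 \<or> \<rho> m < \<rho> (m - 1)). h m)"
    unfolding add by (subst sum.reindex) (auto simp: inj_on_def box_content_def h_def)
  also have "\<dots> = (\<Sum>m\<le>n. if m = 0 \<or> \<rho> m < \<rho> (m - 1) then h m else 0)"
    by (subst sum.If_cases) (auto intro!: sum.cong)
  also have "\<dots> = h 0 + (\<Sum>m<n. if \<rho> (Suc m) < \<rho> m then h (Suc m) else 0)"
    by (subst sum.atMost_shift) simp
  finally have sadd: "(\<Sum>b\<in>addable D. g (box_content b))
      = h 0 + (\<Sum>m<n. if \<rho> (Suc m) < \<rho> m then h (Suc m) else 0)" .
  have "(\<Sum>b\<in>removable D. g (box_content b)) = (\<Sum>m | m < n \<and> \<rho> (Suc m) < \<rho> m. h' m)"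
    unfolding rem
    by (subst sum.reindex) (auto simp: inj_on_def box_content_def h'_def algebra_simps)
  also have "\<dots> = (\<Sum>m<n. if \<rho> (Suc m) < \<rho> m then h' m else 0)"
    by (subst sum.If_cases) (auto intro!: sum.cong)
  finally have srem: "(\<Sum>b\<in>removable D. g (box_content b))
      = (\<Sum>m<n. if \<rho> (Suc m) < \<rho> m then h' m else 0)" .
  have "(\<Sum>m<n. if \<rho> (Suc m) < \<rho> m then h (Suc m) else 0)
        - (\<Sum>m<n. if \<rho> (Suc m) < \<rho> m then h' m else 0)
      = (\<Sum>m<n. h (Suc m) - h' m)"
    unfolding sum_subtractf[symmetric]
  proof (rule sum.cong[OF refl])
    fix m
    have "\<rho> (Suc m) \<le> \<rho> m" by (rule le) simp
    hence "\<rho> (Suc m) < \<rho> m \<or> \<rho> (Suc m) = \<rho> m" by auto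
    thus "(if \<rho> (Suc m) < \<rho> m then h (Suc m) else 0) - (if \<rho> (Suc m) < \<rho> m then h' m else 0)
            = h (Suc m) - h' m"
      by (auto simp: h_def h'_def algebra_simps)
  qed
  hence lhs: "(\<Sum>b\<in>addable D. g (box_content b)) - (\<Sum>b\<in>removable D. g (box_content b))
      = h 0 + (\<Sum>m<n. h (Suc m)) - (\<Sum>m<n. h' m)"
    by (simp add: sadd srem sum_subtractf)
  define G where "G c = g (c + 1) - 2 * g c + g (c - 1)" for c
  have row: "(\<Sum>j\<in>{1..r}. G (int j - int (Suc m)))
      = (g (int r - int m) - g (int r - int m - 1)) - (g (- int m) - g (- int m - 1))" for r m
  proof (induction r)
    case (Suc r)
    have eq: "int (Suc r) - int (Suc m) + 1 = int (Suc r) - int m" "int (Suc r) - int (Suc m) = int r - int m"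
      "int (Suc r) - int m - 1 = int r - int m" "int (Suc r) - int (Suc m) - 1 = int r - int m - 1"
      by auto
    have "(\<Sum>j\<in>{1..Suc r}. G (int j - int (Suc m))) = (\<Sum>j\<in>{1..r}. G (int j - int (Suc m))) + G (int (Suc r) - int (Suc m))"
      by simp
    also have "\<dots> = (g (int (Suc r) - int m) - g (int (Suc r) - int m - 1)) - (g (- int m) - g (- int m - 1))"
      unfolding Suc.IH G_def[of "int (Suc r) - int (Suc m)"] eq(1) eq(4) unfolding eq by simp
    finally show ?case .
  qed simp
  have minus_Suc: "- int (Suc m) = - int m - 1" for m by simp
  have "content_sum G D = (\<Sum>(i,j)\<in>(SIGMA i:{1..n}. {1..\<rho> (i - 1)}). G (int j - int i))"
    unfolding content_sum_def by (rule sum.cong[OF D]) (auto simp: box_content_def)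
  also have "\<dots> = (\<Sum>i\<in>{1..n}. \<Sum>j\<in>{1..\<rho> (i - 1)}. G (int j - int i))"
    by (rule sum.Sigma[symmetric]) auto
  also have "\<dots> = (\<Sum>m<n. \<Sum>j\<in>{1..\<rho> m}. G (int j - int (Suc m)))"
    by (rule sum.reindex_bij_witness[where i = Suc and j = "\<lambda>i. i - 1"]) auto
  also have "\<dots> = (\<Sum>m<n. h m - h' m) - (\<Sum>m<n. g (- int m) - g (- int (Suc m)))"
    unfolding row minus_Suc by (simp add: h_def h'_def sum_subtractf sum.distrib algebra_simps)
  also have "(\<Sum>m<n. g (- int m) - g (- int (Suc m))) = g 0 - g (- int n)"
    using sum_lessThan_telescope'[of "\<lambda>m. g (- int m)" n] by simp
  also have "g (- int n) = h n" by (simp add: h_def \<rho>n)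
  finally have rhs: "content_sum G D = (\<Sum>m<n. h m) + h n - g 0 - (\<Sum>m<n. h' m)"
    by (simp add: sum_subtractf)
  have "h 0 + (\<Sum>m<n. h (Suc m)) = (\<Sum>m<n. h m) + h n"
    using sum.atMost_shift[of h n] sum.lessThan_Suc[of h n] by (simp add: lessThan_Suc_atMost)
  thus ?thesis using lhs rhs unfolding G_def by simp
qed

section \<open>Standard Young tableaux and Plancherel growth\<close>

text \<open>Indexed by the diagram itself, so that a box can be removed without returning to a list
  of parts.\<close>

definition tableaux :: "(nat \<times> nat) set \<Rightarrow> (nat \<times> nat \<Rightarrow> nat) set" where
  "tableaux D =
     {T \<in> extensional D. bij_betw T D {1..card D} \<and>
        (\<forall>i j j'. (i, j) \<in> D \<longrightarrow> (i, j') \<in> D \<longrightarrow> j < j' \<longrightarrow> T (i, j) < T (i, j')) \<and>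
        (\<forall>i i' j. (i, j) \<in> D \<longrightarrow> (i', j) \<in> D \<longrightarrow> i < i' \<longrightarrow> T (i, j) < T (i', j))}"

lemma tableaux_empty: "tableaux {} = {\<lambda>_. undefined}"
  by (auto simp: tableaux_def bij_betw_def)

lemma finite_tableaux: "finite D \<Longrightarrow> finite (tableaux D)"
proof (rule finite_subset)
  show "tableaux D \<subseteq> (\<Pi>\<^sub>E b\<in>D. {1..card D})"
    by (auto simp: tableaux_def PiE_def bij_betw_def)
qed (simp add: finite_PiE)

lemma tableaux_le_max:
  assumes "T \<in> tableaux D" "b \<in> D"
  shows "T b \<le> card D"
  using assms by (auto simp: tableaux_def bij_betw_def)

lemma tableaux_mono:
  assumes "T \<in> tableaux D" "young D" "(i', j') \<in> D" "1 \<le> i" "i \<le> i'" "1 \<le> j" "j \<le> j'"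
  shows "T (i, j) \<le> T (i', j')"
proof -
  have "(i, j) \<in> D" "(i, j') \<in> D"
    using young_closed[OF assms(2,3)] assms by auto
  hence "T (i, j) \<le> T (i, j')" "T (i, j') \<le> T (i', j')"
    using assms unfolding tableaux_def by (auto simp: le_less)
  thus ?thesis by simp
qed

text \<open>Entries increase towards the lower right, so nothing lies to the right of or below the
  box with the largest entry, and that box is a corner.\<close>

lemma tableaux_remove_max:
  assumes D: "young D" and T: "T \<in> tableaux D" and b: "b \<in> D" "T b = card D"
  shows "b \<in> removable D" "restrict T (D - {b}) \<in> tableaux (D - {b})"
proof -
  have bij: "bij_betw T D {1..card D}" using T by (simp add: tableaux_def)
  have inj: "c = b" if "c \<in> D" "T c = card D" for c
    using bij that b by (auto simp: bij_betw_def inj_on_def)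
  have "young (D - {b})"
    unfolding young_def
  proof (intro conjI allI impI)
    show "finite (D - {b})" using young_finite[OF D] by simp
    fix i j assume ij: "(i, j) \<in> D - {b}"
    show "1 \<le> i" "1 \<le> j" using ij young_pos[OF D, of i j] by auto
    fix i' j' assume le: "1 \<le> i'" "i' \<le> i" "1 \<le> j'" "j' \<le> j"
    have "T (i', j') \<le> T (i, j)" using tableaux_mono[OF T D] ij le by simp
    moreover have "T (i, j) \<le> card D" using tableaux_le_max[OF T] ij by simp
    moreover have "T (i, j) \<noteq> card D" using inj[of "(i, j)"] ij by blast
    ultimately have "(i', j') \<noteq> b" using b by auto
    moreover have "(i', j') \<in> D" using young_closed[OF D] ij le by blast
    ultimately show "(i', j') \<in> D - {b}" by simp
  qed
  thus "b \<in> removable D" using b by (simp add: removable_def)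
  have fin: "finite D" by (rule young_finite[OF D])
  have "bij_betw T (D - {b}) ({1..card D} - {T b})"
    using bij b by (intro bij_betw_DiffI) (auto simp: bij_betw_def card_gt_0_iff Suc_le_eq fin)
  moreover have "card D > 0" using b fin by (auto simp: card_gt_0_iff)
  hence "{1..card D} - {T b} = {1..card (D - {b})}"
    using b fin by (auto simp: card_Diff_singleton)
  ultimately have "bij_betw T (D - {b}) {1..card (D - {b})}" by simp
  hence "bij_betw (restrict T (D - {b})) (D - {b}) {1..card (D - {b})}"
    by (subst bij_betw_cong[where g = T]) auto
  thus "restrict T (D - {b}) \<in> tableaux (D - {b})"
    using T unfolding tableaux_def by auto
qed

lemma tableaux_extend:
  assumes D: "young D" and b: "b \<in> removable D" and T: "T \<in> tableaux (D - {b})"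
  shows "T(b := card D) \<in> tableaux D"
proof -
  have fin: "finite D" by (rule young_finite[OF D])
  have bD: "b \<in> D" and y: "young (D - {b})" using b by (auto simp: removable_def)
  have lt: "T c < card D" if "c \<in> D - {b}" for c
  proof -
    have "T c \<le> card (D - {b})" by (rule tableaux_le_max[OF T that])
    also have "\<dots> < card D" by (rule card_Diff1_less[OF fin bD])
    finally show ?thesis .
  qed
  have bij: "bij_betw T (D - {b}) {1..card (D - {b})}" using T by (simp add: tableaux_def)
  have "bij_betw (T(b := card D)) ({b} \<union> (D - {b})) ({card D} \<union> {1..card (D - {b})})"
  proof (rule bij_betw_combine)
    show "bij_betw (T(b := card D)) {b} {card D}" by (simp add: bij_betw_def)
    show "bij_betw (T(b := card D)) (D - {b}) {1..card (D - {b})}"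
      using bij by (subst bij_betw_cong[where g = T]) auto
    show "{card D} \<inter> {1..card (D - {b})} = {}"
      using card_Diff1_less[OF fin bD] by auto
  qed
  moreover have "{b} \<union> (D - {b}) = D" using bD by auto
  moreover have "{card D} \<union> {1..card (D - {b})} = {1..card D}"
    using bD fin card_gt_0_iff[of D] by (auto simp: card_Diff_singleton)
  ultimately have bij': "bij_betw (T(b := card D)) D {1..card D}" by (simp only:)
  have row: "(T(b := card D)) (i, j) < (T(b := card D)) (i, j')"
    if "(i, j) \<in> D" "(i, j') \<in> D" "j < j'" for i j j'
  proof -
    have "(i, j) \<noteq> b"
    proof
      assume "(i, j) = b"
      hence "(i, j') \<in> D - {b}" using that by auto
      from young_closed[OF y this, of i j] young_pos[OF D that(1)] \<open>(i, j) = b\<close> that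
      show False by auto
    qed
    thus ?thesis using that lt[of "(i, j)"] T by (auto simp: tableaux_def)
  qed
  have col: "(T(b := card D)) (i, j) < (T(b := card D)) (i', j)"
    if "(i, j) \<in> D" "(i', j) \<in> D" "i < i'" for i i' j
  proof -
    have "(i, j) \<noteq> b"
    proof
      assume "(i, j) = b"
      hence "(i', j) \<in> D - {b}" using that by auto
      from young_closed[OF y this, of i j] young_pos[OF D that(1)] \<open>(i, j) = b\<close> that
      show False by auto
    qed
    thus ?thesis using that lt[of "(i, j)"] T by (auto simp: tableaux_def)
  qed
  have "T(b := card D) \<in> extensional D"
    using T bD by (auto simp: tableaux_def extensional_def)
  thus ?thesis using bij' row col by (auto simp only: tableaux_def mem_Collect_eq)
qed

text \<open>Tableaux are classified by the corner that carries the largest entry; erasing this entry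
  and restoring it are inverse operations.\<close>

lemma card_tableaux_branching:
  assumes D: "young D" and ne: "D \<noteq> {}"
  shows "card (tableaux D) = (\<Sum>b\<in>removable D. card (tableaux (D - {b})))"
proof -
  have fin: "finite D" by (rule young_finite[OF D])
  let ?E = "\<lambda>b. (\<lambda>T. T(b := card D)) ` tableaux (D - {b})"
  have "tableaux D = (\<Union>b\<in>removable D. ?E b)"
  proof (intro equalityI subsetI)
    fix T assume T: "T \<in> tableaux D"
    have "card D \<in> T ` D"
      using T ne fin by (auto simp: tableaux_def bij_betw_def Suc_le_eq card_gt_0_iff)
    then obtain b where b: "b \<in> D" "T b = card D" by force
    have "T = (restrict T (D - {b}))(b := card D)"
      using T b by (auto simp: fun_eq_iff tableaux_def extensional_def)
    thus "T \<in> (\<Union>b\<in>removable D. ?E b)"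
      using tableaux_remove_max[OF D T b] by blast
  next
    fix T assume "T \<in> (\<Union>b\<in>removable D. ?E b)"
    thus "T \<in> tableaux D" using tableaux_extend[OF D] by blast
  qed
  also have "card (\<Union>b\<in>removable D. ?E b) = (\<Sum>b\<in>removable D. card (?E b))"
  proof (intro card_UN_disjoint ballI impI finite_removable D finite_imageI finite_tableaux)
    fix b c assume bc: "b \<in> removable D" "c \<in> removable D" "b \<noteq> c"
    have False if "T \<in> ?E b" "T \<in> ?E c" for T
    proof -
      have "T \<in> tableaux D" using that bc tableaux_extend[OF D] by blast
      hence "inj_on T D" by (simp add: tableaux_def bij_betw_def)
      moreover have "T b = card D" using that(1) by auto
      moreover have "T c = card D" using that(2) by auto
      ultimately show False using bc by (auto simp: removable_def inj_on_def)
    qed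
    thus "?E b \<inter> ?E c = {}" by blast
  qed (use fin in auto)
  also have "\<dots> = (\<Sum>b\<in>removable D. card (tableaux (D - {b})))"
  proof (intro sum.cong refl card_image inj_onI)
    fix b T T' assume TT: "T \<in> tableaux (D - {b})" "T' \<in> tableaux (D - {b})"
      "T(b := card D) = T'(b := card D)"
    hence "T \<in> extensional (D - {b})" "T' \<in> extensional (D - {b})"
      by (simp_all only: tableaux_def mem_Collect_eq)
    \<comment> \<open>Both functions are \<open>undefined\<close> at \<open>b\<close>, which lies
      outside their domain, so overwriting the value there loses no information.\<close>
    hence "T b = T' b" using extensional_arb[of _ "D - {b}" b] by (metis Diff_iff singletonI)
    show "T = T'"
    proof
      fix c show "T c = T' c"
        using fun_cong[OF TT(3), of c] \<open>T b = T' b\<close> by (cases "c = b") simp_all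
    qed
  qed
  finally show ?thesis .
qed

definition num_tableaux :: "(nat \<times> nat) set \<Rightarrow> real" where
  "num_tableaux D = real (card (tableaux D))"

lemma num_tableaux_empty: "num_tableaux {} = 1"
  by (simp add: num_tableaux_def tableaux_empty)

lemma num_tableaux_branching:
  "D \<in> diagrams (Suc n) \<Longrightarrow> num_tableaux D = (\<Sum>b\<in>removable D. num_tableaux (D - {b}))"
  using card_tableaux_branching[of D] by (cases "D = {}") (auto simp: num_tableaux_def diagrams_def)

lemma insert_addable: "C \<in> diagrams n \<Longrightarrow> b \<in> addable C \<Longrightarrow> insert b C \<in> diagrams (Suc n)"
  by (auto simp: diagrams_def addable_def young_finite)

lemma remove_removable: "C \<in> diagrams (Suc n) \<Longrightarrow> b \<in> removable C \<Longrightarrow> C - {b} \<in> diagrams n"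
  by (auto simp: diagrams_def removable_def young_finite)

lemma removable_empty: "removable {} = {}"
  by (simp add: removable_def)

lemma addable_minus_removable_card:
  assumes "young C"
  shows "real (card (addable C)) - real (card (removable C)) = 1"
  using sum_addable_minus_removable[OF assms, of "\<lambda>_. 1"] by (simp add: content_sum_def)

text \<open>The branching rule read upwards. In the induction step, branching and commutation give
  the number of tableaux of \<open>C\<close> once from the surplus of addable corners and
  \<open>n + 1\<close> times from the induction hypothesis for the diagrams
  \<open>C - {b'}\<close>.\<close>

lemma sum_addable_num_tableaux:
  "C \<in> diagrams n \<Longrightarrow> (\<Sum>b\<in>addable C. num_tableaux (insert b C)) = (real n + 1) * num_tableaux C"
proof (induction n arbitrary: C)
  case (0 C)
  hence C: "C = {}" "young C" by (auto simp: diagrams_0 young_empty)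
  have "(\<Sum>b\<in>addable C. num_tableaux (insert b C))
      = (\<Sum>b\<in>addable C. \<Sum>b'\<in>removable (insert b C). num_tableaux (insert b C - {b'}))"
    by (intro sum.cong refl num_tableaux_branching[OF insert_addable[OF 0]])
  also have "\<dots> = real (card (addable C)) * num_tableaux C"
    using sum_add_remove_commute[OF C(2), of "\<lambda>_. num_tableaux"] by (simp add: C(1) removable_empty)
  also have "real (card (addable C)) = 1"
    using addable_minus_removable_card[OF C(2)] by (simp add: C(1) removable_empty)
  finally show ?case by simp
next
  case (Suc n C)
  hence y: "young C" by (simp add: diagrams_def)
  have "(\<Sum>b\<in>addable C. num_tableaux (insert b C))
      = (\<Sum>b\<in>addable C. \<Sum>b'\<in>removable (insert b C). num_tableaux (insert b C - {b'}))"
    by (intro sum.cong refl num_tableaux_branching[OF insert_addable[OF Suc.prems]])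
  also have "\<dots> = (real (card (addable C)) - real (card (removable C))) * num_tableaux C
     + (\<Sum>b'\<in>removable C. \<Sum>b\<in>addable (C - {b'}). num_tableaux (insert b (C - {b'})))"
    using sum_add_remove_commute[OF y, of "\<lambda>_. num_tableaux"] by (simp add: algebra_simps)
  also have "(\<Sum>b'\<in>removable C. \<Sum>b\<in>addable (C - {b'}). num_tableaux (insert b (C - {b'})))
     = (\<Sum>b'\<in>removable C. (real n + 1) * num_tableaux (C - {b'}))"
    by (intro sum.cong refl Suc.IH remove_removable[OF Suc.prems])
  also have "\<dots> = (real n + 1) * num_tableaux C"
    by (simp add: num_tableaux_branching[OF Suc.prems] sum_distrib_left)
  finally show ?case
    unfolding addable_minus_removable_card[OF y] by (simp add: algebra_simps)
qed

section \<open>Plancherel growth\<close>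

definition plancherel_sum :: "nat \<Rightarrow> ((nat \<times> nat) set \<Rightarrow> real) \<Rightarrow> real" where
  "plancherel_sum n S = (\<Sum>D\<in>diagrams n. (num_tableaux D)\<^sup>2 * S D)"

text \<open>Plancherel growth adds \<open>b\<close> to \<open>C\<close> with probability
  \<open>num_tableaux (insert b C) / ((n + 1) * num_tableaux C)\<close>; the sum is
  \<open>(n + 1)!\<close> times the mean of \<open>g\<close> at the content of the new box.\<close>

definition growth_sum :: "nat \<Rightarrow> (int \<Rightarrow> real) \<Rightarrow> real" where
  "growth_sum n g = (\<Sum>C\<in>diagrams n. \<Sum>b\<in>addable C.
     num_tableaux C * num_tableaux (insert b C) * g (box_content b))"

lemma plancherel_sum_1: "plancherel_sum n (\<lambda>_. 1) = fact n"
proof (induction n)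
  case (Suc n)
  have "plancherel_sum (Suc n) (\<lambda>_. 1)
      = (\<Sum>D\<in>diagrams (Suc n). \<Sum>b\<in>removable D. num_tableaux D * num_tableaux (D - {b}))"
    unfolding plancherel_sum_def
    by (intro sum.cong refl) (simp add: power2_eq_square num_tableaux_branching sum_distrib_left)
  also have "\<dots> = (\<Sum>C\<in>diagrams n. \<Sum>b\<in>addable C. num_tableaux (insert b C) * num_tableaux (insert b C - {b}))"
    by (rule sum_removable_eq_sum_addable)
  also have "\<dots> = (\<Sum>C\<in>diagrams n. num_tableaux C * (\<Sum>b\<in>addable C. num_tableaux (insert b C)))"
    unfolding sum_distrib_left by (intro sum.cong refl) (simp add: addable_def mult.commute)
  also have "\<dots> = (real n + 1) * plancherel_sum n (\<lambda>_. 1)"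
    unfolding plancherel_sum_def sum_distrib_left[of "real n + 1"]
    by (intro sum.cong refl) (simp add: sum_addable_num_tableaux power2_eq_square)
  finally show ?case by (simp add: Suc)
qed (simp add: plancherel_sum_def diagrams_0 num_tableaux_empty)

text \<open>One factor \<open>num_tableaux D\<close> is expanded by branching. The content sum then
  splits into the new box and the old diagram, and the upward branching rule turns the old part into
  the factor \<open>n + 1\<close>.\<close>

lemma plancherel_sum_Suc:
  "plancherel_sum (Suc n) (content_sum g) = (real n + 1) * plancherel_sum n (content_sum g) + growth_sum n g"
proof -
  have "plancherel_sum (Suc n) (content_sum g)
      = (\<Sum>D\<in>diagrams (Suc n). \<Sum>b\<in>removable D. num_tableaux D * num_tableaux (D - {b}) * content_sum g D)"
    unfolding plancherel_sum_def
    by (intro sum.cong refl)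
       (simp add: power2_eq_square num_tableaux_branching sum_distrib_left sum_distrib_right)
  also have "\<dots> = (\<Sum>C\<in>diagrams n. \<Sum>b\<in>addable C.
      num_tableaux (insert b C) * num_tableaux (insert b C - {b}) * content_sum g (insert b C))"
    by (rule sum_removable_eq_sum_addable)
  also have "\<dots> = (\<Sum>C\<in>diagrams n. \<Sum>b\<in>addable C.
      num_tableaux C * num_tableaux (insert b C) * g (box_content b)
      + num_tableaux C * content_sum g C * num_tableaux (insert b C))"
  proof (intro sum.cong refl)
    fix C b assume "C \<in> diagrams n" "b \<in> addable C"
    hence "finite C" "b \<notin> C" by (auto simp: diagrams_def addable_def young_finite)
    thus "num_tableaux (insert b C) * num_tableaux (insert b C - {b}) * content_sum g (insert b C)
        = num_tableaux C * num_tableaux (insert b C) * g (box_content b)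
          + num_tableaux C * content_sum g C * num_tableaux (insert b C)"
      by (simp add: content_sum_def algebra_simps)
  qed
  also have "\<dots> = growth_sum n g + (\<Sum>C\<in>diagrams n. num_tableaux C * content_sum g C *
      (\<Sum>b\<in>addable C. num_tableaux (insert b C)))"
    by (simp add: growth_sum_def sum.distrib sum_distrib_left)
  also have "(\<Sum>C\<in>diagrams n. num_tableaux C * content_sum g C * (\<Sum>b\<in>addable C. num_tableaux (insert b C)))
      = (real n + 1) * plancherel_sum n (content_sum g)"
    unfolding plancherel_sum_def sum_distrib_left[of "real n + 1"]
    by (intro sum.cong refl) (simp add: sum_addable_num_tableaux power2_eq_square)
  finally show ?thesis by simp
qed

text \<open>Branching in the larger diagram, then commutation. The two single sums of the
  commutation combine to the second difference of \<open>g\<close>; this is where a mean over new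
  boxes turns into a mean over all boxes.\<close>

lemma growth_sum_eq:
  "growth_sum n g = (\<Sum>C\<in>diagrams n. (num_tableaux C)\<^sup>2 *
       (g 0 + content_sum (\<lambda>c. g (c + 1) - 2 * g c + g (c - 1)) C))
     + (\<Sum>C\<in>diagrams n. \<Sum>b'\<in>removable C. \<Sum>b\<in>addable (C - {b'}).
          num_tableaux C * (g (box_content b) * num_tableaux (insert b (C - {b'}))))"
proof -
  let ?G = "content_sum (\<lambda>c. g (c + 1) - 2 * g c + g (c - 1))"
  have "growth_sum n g = (\<Sum>C\<in>diagrams n. num_tableaux C * (\<Sum>b\<in>addable C. \<Sum>b'\<in>removable (insert b C).
      g (box_content b) * num_tableaux (insert b C - {b'})))"
    unfolding growth_sum_def sum_distrib_left
    by (intro sum.cong refl)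
       (simp add: num_tableaux_branching[OF insert_addable] sum_distrib_left sum_distrib_right mult_ac)
  also have "\<dots> = (\<Sum>C\<in>diagrams n. (num_tableaux C)\<^sup>2 * (g 0 + ?G C)
      + num_tableaux C * (\<Sum>b'\<in>removable C. \<Sum>b\<in>addable (C - {b'}).
          g (box_content b) * num_tableaux (insert b (C - {b'}))))"
  proof (intro sum.cong refl)
    fix C assume "C \<in> diagrams n"
    hence y: "young C" by (simp add: diagrams_def)
    have "(\<Sum>b\<in>addable C. g (box_content b) * num_tableaux C) - (\<Sum>b\<in>removable C. g (box_content b) * num_tableaux C)
        = (g 0 + ?G C) * num_tableaux C"
      unfolding sum_addable_minus_removable[OF y, symmetric] by (simp add: left_diff_distrib sum_distrib_right)
    thus "num_tableaux C * (\<Sum>b\<in>addable C. \<Sum>b'\<in>removable (insert b C).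
        g (box_content b) * num_tableaux (insert b C - {b'}))
      = (num_tableaux C)\<^sup>2 * (g 0 + ?G C)
      + num_tableaux C * (\<Sum>b'\<in>removable C. \<Sum>b\<in>addable (C - {b'}).
          g (box_content b) * num_tableaux (insert b (C - {b'})))"
      unfolding sum_add_remove_commute[OF y, of "\<lambda>b E. g (box_content b) * num_tableaux E"]
      by (simp add: power2_eq_square algebra_simps)
  qed
  finally show ?thesis by (simp add: sum.distrib sum_distrib_left)
qed

lemma growth_sum_0: "growth_sum 0 g = g 0"
  unfolding growth_sum_eq
  by (simp add: diagrams_0 num_tableaux_empty content_sum_def removable_empty)

lemma growth_sum_Suc:
  "growth_sum (Suc n) g = fact (Suc n) * g 0
     + plancherel_sum (Suc n) (content_sum (\<lambda>c. g (c + 1) - 2 * g c + g (c - 1)))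
     + (real n + 1) * growth_sum n g"
proof -
  let ?G = "content_sum (\<lambda>c. g (c + 1) - 2 * g c + g (c - 1))"
  have "(\<Sum>C\<in>diagrams (Suc n). \<Sum>b'\<in>removable C. \<Sum>b\<in>addable (C - {b'}).
          num_tableaux C * (g (box_content b) * num_tableaux (insert b (C - {b'}))))
      = (\<Sum>C\<in>diagrams n. \<Sum>b'\<in>addable C. \<Sum>b\<in>addable (insert b' C - {b'}).
          num_tableaux (insert b' C) * (g (box_content b) * num_tableaux (insert b (insert b' C - {b'}))))"
    by (rule sum_removable_eq_sum_addable)
  \<comment> \<open>Removing \<open>b'\<close> returns to \<open>C\<close>, so the terms in
    \<open>b\<close> no longer involve \<open>b'\<close> and the double sum factors.\<close>
  also have "\<dots> = (\<Sum>C\<in>diagrams n. \<Sum>b'\<in>addable C. \<Sum>b\<in>addable C.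
          num_tableaux (insert b' C) * (g (box_content b) * num_tableaux (insert b C)))"
    by (intro sum.cong refl) (auto simp: addable_def)
  also have "\<dots> = (\<Sum>C\<in>diagrams n. (\<Sum>b'\<in>addable C. num_tableaux (insert b' C)) *
          (\<Sum>b\<in>addable C. g (box_content b) * num_tableaux (insert b C)))"
    by (simp add: sum_product)
  also have "\<dots> = (real n + 1) * growth_sum n g"
    unfolding growth_sum_def sum_distrib_left
    by (intro sum.cong refl) (simp add: sum_addable_num_tableaux sum_distrib_left mult_ac)
  finally have *: "(\<Sum>C\<in>diagrams (Suc n). \<Sum>b'\<in>removable C. \<Sum>b\<in>addable (C - {b'}).
          num_tableaux C * (g (box_content b) * num_tableaux (insert b (C - {b'}))))
      = (real n + 1) * growth_sum n g" .
  have "(\<Sum>C\<in>diagrams (Suc n). (num_tableaux C)\<^sup>2 * (g 0 + ?G C))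
      = plancherel_sum (Suc n) (\<lambda>_. 1) * g 0 + plancherel_sum (Suc n) ?G"
    by (simp add: plancherel_sum_def algebra_simps sum.distrib sum_distrib_left)
  thus ?thesis
    by (subst growth_sum_eq) (simp only: * plancherel_sum_1)
qed

section \<open>The expected Durfee size as a binomial sum\<close>

text \<open>The even central factorial of degree \<open>2 * k\<close>. Divided by
  \<open>(2 * k)!\<close> it is for the second central difference what \<open>x^k / k!\<close> is
  for the derivative.\<close>

definition central_factorial :: "nat \<Rightarrow> real \<Rightarrow> real" where
  "central_factorial k c = (\<Prod>i<k. c\<^sup>2 - (real i)\<^sup>2)"

lemma central_factorial_Suc:
  "central_factorial (Suc k) c = central_factorial k c * (c\<^sup>2 - (real k)\<^sup>2)"
  by (simp add: central_factorial_def)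

lemma central_factorial_uminus: "central_factorial k (- c) = central_factorial k c"
  by (simp add: central_factorial_def)

text \<open>At \<open>c + 1\<close> the linear factors are the consecutive numbers from
  \<open>c - k\<close> to \<open>c + k + 2\<close>, with \<open>c + 1\<close> taken twice.
  Collecting those from \<open>c - k\<close> to \<open>c + k\<close> exposes the part shared with
  the values at \<open>c\<close> and \<open>c - 1\<close>.\<close>

lemma central_factorial_shift:
  "central_factorial (Suc (Suc k)) (c + 1)
     = (c + 1) * (c + real k + 1) * (c + real k + 2) * (c * (\<Prod>i\<in>{1..k}. c\<^sup>2 - (real i)\<^sup>2))"
proof (induction k)
  case 0
  show ?case by (simp add: central_factorial_def power2_eq_square lessThan_Suc algebra_simps)
next
  case (Suc k)
  show ?case
    unfolding central_factorial_Suc[of "Suc (Suc k)"] Suc.IH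
    by (simp add: power2_eq_square algebra_simps)
qed

lemma central_factorial_diff2:
  "central_factorial (Suc k) (c + 1) - 2 * central_factorial (Suc k) c + central_factorial (Suc k) (c - 1)
     = real ((2 * k + 2) * (2 * k + 1)) * central_factorial k c"
proof (cases k)
  case 0
  thus ?thesis by (simp add: central_factorial_def power2_eq_square algebra_simps)
next
  case (Suc m)
  define S where "S = (\<Prod>i\<in>{1..m}. c\<^sup>2 - (real i)\<^sup>2)"
  have P: "central_factorial k c = c\<^sup>2 * S"
    unfolding central_factorial_def Suc S_def by (subst prod.lessThan_Suc_shift) (simp add: prod.atLeast1_atMost_eq)
  have 1: "central_factorial (Suc k) (c + 1) = (c + 1) * (c + real k) * (c + real k + 1) * (c * S)"
    using central_factorial_shift[of m c] by (simp add: S_def Suc algebra_simps)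
  \<comment> \<open>Evenness reduces the value at \<open>c - 1\<close> to the shift formula at
    \<open>- c\<close>.\<close>
  have "central_factorial (Suc k) (c - 1) = central_factorial (Suc k) (- c + 1)"
    using central_factorial_uminus[of "Suc k" "c - 1"] by simp
  also have "\<dots> = (- c + 1) * (- c + real k) * (- c + real k + 1) * (- c * S)"
    using central_factorial_shift[of m "- c"] by (simp add: S_def Suc algebra_simps)
  finally have 2: "central_factorial (Suc k) (c - 1) = (- c + 1) * (- c + real k) * (- c + real k + 1) * (- c * S)" .
  show ?thesis
    unfolding 1 2 unfolding central_factorial_Suc P by (simp add: power2_eq_square algebra_simps)
qed

text \<open>Induction on \<open>k\<close>: the second difference of \<open>g (Suc k)\<close> is
  \<open>g k\<close>, so the growth recursion is driven by sums that are already known.\<close>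

lemma plancherel_central_factorial:
  defines "g \<equiv> (\<lambda>k (c::int). central_factorial k (of_int c) / fact (2 * k))"
  shows "plancherel_sum n (content_sum (g k)) = fact n * real (n choose Suc k) / fact (Suc k)"
proof -
  \<comment> \<open>Given the growth sums, \<open>plancherel_sum_Suc\<close> becomes Pascal's rule
    for the binomial coefficients.\<close>
  have growth_to_sum: "plancherel_sum n (content_sum (g k)) = fact n * real (n choose Suc k) / fact (Suc k)"
    if growth: "\<And>n. growth_sum n (g k) = fact (Suc n) * real (n choose k) / fact (Suc k)" for k n
  proof (induction n)
    case 0
    show ?case by (simp add: plancherel_sum_def diagrams_0 content_sum_def)
  next
    case (Suc n)
    define F where "F = (fact (Suc k) :: real)"
    show ?case
      unfolding plancherel_sum_Suc Suc.IH growth F_def[symmetric]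
      by (simp add: algebra_simps add_divide_distrib)
  qed
  have IH: "plancherel_sum n (content_sum (g k)) = fact n * real (n choose Suc k) / fact (Suc k)" for n
  proof (induction k arbitrary: n)
    case (0 n)
    have G: "(\<lambda>c. g 0 (c + 1) - 2 * g 0 c + g 0 (c - 1)) = (\<lambda>_. 0)"
      by (simp add: g_def central_factorial_def)
    have "growth_sum n (g 0) = fact (Suc n)" for n
    proof (induction n)
      case (Suc n)
      have "plancherel_sum (Suc n) (content_sum (\<lambda>_. 0)) = 0"
        by (simp add: plancherel_sum_def content_sum_def)
      thus ?case unfolding growth_sum_Suc G Suc.IH
        by (simp add: g_def central_factorial_def algebra_simps)
    qed (simp add: growth_sum_0 g_def central_factorial_def)
    thus ?case by (intro growth_to_sum) simp
  next
    case (Suc k n)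
    note IH = Suc.IH
    \<comment> \<open>The factor with \<open>i = 0\<close> vanishes at content 0, so the term
      \<open>g 0\<close> of the growth recursion survives only for \<open>k = 0\<close>.\<close>
    have g0: "g (Suc k) 0 = 0"
      unfolding g_def central_factorial_def by (subst prod.lessThan_Suc_shift) simp
    have G: "(\<lambda>c. g (Suc k) (c + 1) - 2 * g (Suc k) c + g (Suc k) (c - 1)) = g k"
    proof
      fix c :: int
      define F where "F = (fact (2 * k) :: real)"
      have F: "F \<noteq> 0" "fact (2 * Suc k) = real ((2 * k + 2) * (2 * k + 1)) * F"
        by (simp_all add: F_def algebra_simps)
      have "g (Suc k) (c + 1) - 2 * g (Suc k) c + g (Suc k) (c - 1)
          = real ((2 * k + 2) * (2 * k + 1)) * central_factorial k (of_int c) / fact (2 * Suc k)"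
        using central_factorial_diff2[of k "of_int c"]
        by (simp add: g_def diff_divide_distrib[symmetric] add_divide_distrib[symmetric])
      also have "\<dots> = g k c"
        unfolding g_def F(2) F_def[symmetric] by (rule mult_divide_mult_cancel_left) (simp del: of_nat_mult of_nat_add)
      finally show "g (Suc k) (c + 1) - 2 * g (Suc k) c + g (Suc k) (c - 1) = g k c" .
    qed
    have "growth_sum n (g (Suc k)) = fact (Suc n) * real (n choose Suc k) / fact (Suc (Suc k))" for n
    proof (induction n)
      case 0
      show ?case by (simp add: growth_sum_0 g0)
    next
      case (Suc n)
      have "real ((Suc n - Suc k) * (Suc n choose Suc k)) = real (Suc n * (n choose Suc k))"
        using binomial_absorb_comp[of "Suc n" "Suc k"] by simp
      hence "(real n - real k) * real (Suc n choose Suc k) = (real n + 1) * real (n choose Suc k)"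
        by (cases "k \<le> n") (auto simp: of_nat_diff binomial_eq_0 algebra_simps simp del: binomial_Suc_Suc)
      hence *: "(real k + 2) * real (Suc n choose Suc k) + (real n + 1) * real (n choose Suc k)
          = (real n + 2) * real (Suc n choose Suc k)"
        by (simp add: algebra_simps del: binomial_Suc_Suc)
      define F where "F = (fact (Suc n) :: real)"
      define H where "H = (fact (Suc k) :: real)"
      define K where "K = real k + 2"
      have nz: "H \<noteq> 0" "K \<noteq> 0" by (simp_all add: H_def K_def del: fact_Suc)
      have facts: "fact (Suc (Suc k)) = K * H" "fact (Suc (Suc n)) = (real n + 2) * F"
        unfolding F_def H_def K_def by (simp_all add: algebra_simps)
      have "growth_sum (Suc n) (g (Suc k))
          = F / (K * H) * (K * real (Suc n choose Suc k) + (real n + 1) * real (n choose Suc k))"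
        unfolding growth_sum_Suc G g0 Suc.IH IH facts F_def[symmetric] H_def[symmetric]
        using nz by (simp add: field_simps del: binomial_Suc_Suc)
      also have "K * real (Suc n choose Suc k) + (real n + 1) * real (n choose Suc k)
          = (real n + 2) * real (Suc n choose Suc k)"
        unfolding K_def by (rule *)
      finally show ?case unfolding facts by (simp del: binomial_Suc_Suc)
    qed
    thus ?case by (rule growth_to_sum)
  qed
  thus ?thesis .
qed

text \<open>Each term is the increment of the product of the factors \<open>1 - c^2 / i^2\<close>,
  so the partial sums are these products. For \<open>0 < \<bar>c\<bar> \<le> m\<close> the factor
  with \<open>i = \<bar>c\<bar>\<close> is zero.\<close>

lemma central_factorial_delta:
  fixes c :: int
  assumes "\<bar>c\<bar> \<le> int m"
  shows "(\<Sum>k\<le>m. (-1) ^ k * fact (2 * k) / (fact k)\<^sup>2 * (central_factorial k (of_int c) / fact (2 * k)))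
           = (if c = 0 then 1 else 0 :: real)"
proof -
  have "(\<Sum>k\<le>m. (-1) ^ k * fact (2 * k) / (fact k)\<^sup>2 * (central_factorial k (of_int c) / fact (2 * k)))
      = (\<Sum>k\<le>m. (-1) ^ k * central_factorial k (of_int c) / (fact k :: real)\<^sup>2)"
    by (intro sum.cong) auto
  also have "\<dots> = (\<Prod>i\<in>{1..m}. 1 - (of_int c)\<^sup>2 / (real i)\<^sup>2)"
  proof (induction m)
    case (Suc m)
    have "(-1) ^ Suc m * central_factorial (Suc m) (of_int c) / (fact (Suc m) :: real)\<^sup>2
        = - ((of_int c)\<^sup>2 / (real (Suc m))\<^sup>2) * (\<Prod>i\<in>{1..m}. 1 - (of_int c)\<^sup>2 / (real i)\<^sup>2)"
    proof (induction m)
      case (Suc m)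
      have "(-1) ^ Suc (Suc m) * central_factorial (Suc (Suc m)) (of_int c) / (fact (Suc (Suc m)) :: real)\<^sup>2
         = ((-1) ^ Suc m * central_factorial (Suc m) (of_int c) / (fact (Suc m) :: real)\<^sup>2)
           * (((real (Suc m))\<^sup>2 - (of_int c)\<^sup>2) / (real (Suc (Suc m)))\<^sup>2)"
      proof -
        have p: "(-1) ^ Suc (Suc m) = - ((-1) ^ Suc m :: real)" by simp
        have f: "(fact (Suc (Suc m)) :: real)\<^sup>2 = (fact (Suc m))\<^sup>2 * (real (Suc (Suc m)))\<^sup>2"
          by (subst fact_Suc) (simp only: power_mult_distrib of_nat_mult mult.commute)
        show ?thesis
          unfolding p f central_factorial_Suc[of "Suc m"] times_divide_times_eq
          by (rule arg_cong2[where f = "(/)"]) (simp_all add: algebra_simps del: fact_Suc power_Suc)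
      qed
      also have "\<dots> = - ((of_int c)\<^sup>2 / (real (Suc (Suc m)))\<^sup>2) * (\<Prod>i\<in>{1..Suc m}. 1 - (of_int c)\<^sup>2 / (real i)\<^sup>2)"
        unfolding Suc.IH by (simp add: field_simps)
      finally show ?case .
    qed (simp add: central_factorial_def)
    thus ?case using Suc.IH by (simp add: algebra_simps)
  qed (simp add: central_factorial_def)
  also have "\<dots> = (if c = 0 then 1 else 0)"
  proof (cases "c = 0")
    case False
    hence "nat \<bar>c\<bar> \<in> {1..m}" "1 - (of_int c)\<^sup>2 / (real (nat \<bar>c\<bar>))\<^sup>2 = (0::real)"
      using assms by auto
    hence "\<exists>i\<in>{1..m}. 1 - (of_int c)\<^sup>2 / (real i)\<^sup>2 = (0::real)" by blast
    thus ?thesis using False by (simp add: prod_zero_iff)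
  qed simp
  finally show ?thesis .
qed

section \<open>From lists of parts to sets of boxes\<close>

lemma young_diagram_Sigma:
  "young_diagram l = (SIGMA i:{1..length l}. {1..part l i})"
  by (auto simp: young_diagram_def)

lemma card_young_diagram: "card (young_diagram l) = sum_list l"
proof -
  have "card (young_diagram l) = (\<Sum>i\<in>{1..length l}. l ! (i - 1))"
    unfolding young_diagram_Sigma by (subst card_SigmaI) (auto simp: part_def)
  also have "\<dots> = (\<Sum>i<length l. l ! i)"
    by (rule sum.reindex_bij_witness[where i = Suc and j = "\<lambda>i. i - 1"]) auto
  finally show ?thesis by (simp add: sum_list_sum_nth atLeast0LessThan)
qed

lemma young_young_diagram:
  assumes "l \<in> partitions n"
  shows "young (young_diagram l)"
proof -
  have part: "part l i \<le> part l i'" if "1 \<le> i'" "i' \<le> i" "i \<le> length l" for i i'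
    using assms that sorted_wrt_nth_less[of "(\<ge>)" l "i' - 1" "i - 1"]
    by (cases "i' = i") (auto simp: partitions_def part_def)
  have "finite (young_diagram l)" unfolding young_diagram_Sigma by auto
  thus ?thesis unfolding young_def young_diagram_def
    using part by (auto intro: order_trans)
qed

lemma bij_betw_young_diagram: "bij_betw young_diagram (partitions n) (diagrams n)"
  unfolding bij_betw_def
proof
  show "inj_on young_diagram (partitions n)"
  proof (rule inj_onI)
    fix l l' assume l: "l \<in> partitions n" "l' \<in> partitions n" "young_diagram l = young_diagram l'"
    have pos: "1 \<le> k ! i" if "k \<in> partitions n" "i < length k" for k i
      using that by (auto simp: partitions_def)
    have len: "{i. (i, 1) \<in> young_diagram k} = {1..length k}" if "k \<in> partitions n" for k
      using pos[OF that] by (auto simp: young_diagram_def part_def)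
    have row: "{j. (Suc i, j) \<in> young_diagram k} = {1..k ! i}" if "i < length k" for k i
      using that by (auto simp: young_diagram_def part_def)
    show "l = l'"
    proof (rule nth_equalityI)
      show length: "length l = length l'"
        using len[OF l(1)] len[OF l(2)] l(3) by (metis card_atLeastAtMost diff_Suc_1)
      fix i assume "i < length l"
      thus "l ! i = l' ! i"
        using row[of i l] row[of i l'] l(3) length by (metis card_atLeastAtMost diff_Suc_1)
    qed
  qed
  show "young_diagram ` partitions n = diagrams n"
  proof (intro equalityI subsetI)
    fix D assume "D \<in> young_diagram ` partitions n"
    then obtain l where l: "l \<in> partitions n" "D = young_diagram l" by auto
    thus "D \<in> diagrams n"
      using young_young_diagram[OF l(1)] card_young_diagram[of l]
      by (simp add: diagrams_def partitions_def)
  next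
    fix D assume "D \<in> diagrams n"
    hence y: "young D" and card: "card D = n" by (auto simp: diagrams_def)
    obtain \<rho> where anti: "antimono \<rho>" and \<rho>n: "\<rho> n = 0"
      and mem: "\<And>m j. (Suc m, Suc j) \<in> D \<longleftrightarrow> j < \<rho> m"
      using young_rowsE[OF y] unfolding card by blast
    \<comment> \<open>The number of nonempty rows; cutting the list there makes every part
      positive.\<close>
    define k where "k = (LEAST m. \<rho> m = 0)"
    have \<rho>k: "\<rho> k = 0" unfolding k_def by (rule LeastI[of _ n]) (rule \<rho>n)
    have pos: "\<rho> m > 0" if "m < k" for m
      using that not_less_Least[of m "\<lambda>m. \<rho> m = 0"] by (auto simp: k_def)
    have zero: "\<rho> m = 0" if "k \<le> m" for m
      using antimonoD[OF anti that] \<rho>k by simp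
    define l where "l = map \<rho> [0..<k]"
    have "(i, j) \<in> young_diagram l \<longleftrightarrow> (i, j) \<in> D" for i j
    proof (cases "1 \<le> i \<and> 1 \<le> j")
      case True
      then obtain p q where pq: "i = Suc p" "j = Suc q" by (metis Suc_le_D One_nat_def)
      have "q < \<rho> p \<Longrightarrow> p < k" using zero[of p] by (cases "p < k") auto
      thus ?thesis by (auto simp: pq mem young_diagram_def part_def l_def)
    next
      case False
      thus ?thesis using young_pos[OF y, of i j] by (auto simp: young_diagram_def)
    qed
    hence D: "young_diagram l = D" by auto
    have "sorted_wrt (\<ge>) l"
      unfolding l_def sorted_wrt_map
      by (rule sorted_wrt_mono_rel[OF _ sorted_wrt_upt]) (auto intro: antimonoD[OF anti])
    moreover have "\<forall>x\<in>set l. 1 \<le> x" using pos by (auto simp: l_def Suc_le_eq)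
    moreover have "sum_list l = n" using card_young_diagram[of l] D card by simp
    ultimately have "l \<in> partitions n" by (simp add: partitions_def)
    thus "D \<in> young_diagram ` partitions n" using D by blast
  qed
qed

lemma num_syt_eq: "real (num_syt l) = num_tableaux (young_diagram l)"
  by (simp add: num_syt_def num_tableaux_def standard_young_tableaux_def tableaux_def card_young_diagram)

text \<open>Down-closure makes the indices of the diagonal boxes an initial segment
  \<open>{1..d}\<close>, so their maximum equals their number. For \<open>n \<ge> 1\<close> this
  segment is nonempty, which gives \<open>Max\<close> its meaning.\<close>

lemma durfee_eq:
  assumes "l \<in> partitions n" "n \<ge> 1"
  shows "real (durfee l) = content_sum (\<lambda>c. if c = 0 then 1 else 0) (young_diagram l)"
proof -
  let ?D = "young_diagram l"
  have y: "young ?D" by (rule young_young_diagram[OF assms(1)])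
  define R where "R = {i. (i, i) \<in> ?D}"
  have fin: "finite R"
    by (rule finite_subset[of _ "fst ` ?D"]) (use young_finite[OF y] in \<open>force simp: R_def\<close>)+
  have R: "R = {1..card R}"
  proof (rule down_closed_nat_set[OF fin])
    show "0 \<notin> R" using young_pos[OF y, of 0 0] by (auto simp: R_def)
    show "j' \<in> R" if "j \<in> R" "1 \<le> j'" "j' \<le> j" for j j'
      using that young_closed[OF y, of j j j' j'] by (simp add: R_def)
  qed
  have "?D \<noteq> {}" using card_young_diagram[of l] assms by (auto simp: partitions_def)
  then obtain i j where "(i, j) \<in> ?D" by auto
  hence "1 \<in> R" using young_closed[OF y, of i j 1 1] young_pos[OF y, of i j] by (simp add: R_def)
  hence "1 \<le> card R" using R by auto
  have "durfee l = Max R"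
    unfolding durfee_def R_def young_diagram_def by (intro arg_cong[where f = Max]) auto
  also have "\<dots> = card R" by (subst R, rule Max_eqI) (use \<open>1 \<le> card R\<close> in auto)
  also have "card R = card ((\<lambda>i. (i, i)) ` R)" by (rule card_image[symmetric]) (simp add: inj_on_def)
  also have "(\<lambda>i. (i, i)) ` R = {b \<in> ?D. box_content b = 0}"
    by (auto simp: R_def box_content_def)
  also have "real (card {b \<in> ?D. box_content b = 0})
      = content_sum (\<lambda>c. if c = 0 then 1 else 0) ?D"
    unfolding content_sum_def using young_finite[OF y] by (simp add: sum.If_cases Int_def)
  finally show ?thesis .
qed

theorem expected_durfee_binomial_sum:
  assumes n: "n \<ge> 1"
  shows "expected_durfee n
     = (\<Sum>k<n. (-1) ^ k * real ((2 * k) choose k) * real (n choose Suc k) / fact (Suc k))"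
proof -
  let ?\<delta> = "\<lambda>c::int. if c = 0 then 1 else 0 :: real"
  let ?g = "\<lambda>k (c::int). central_factorial k (of_int c) / fact (2 * k) :: real"
  have fin: "finite (partitions n)"
    using bij_betw_finite[OF bij_betw_young_diagram] finite_diagrams by blast
  have "expected_durfee n = (\<Sum>l\<in>partitions n. (real (num_syt l))\<^sup>2 / fact n * real (durfee l))"
    unfolding expected_durfee_def plancherel_measure_def
    by (subst lebesgue_integral_point_measure_finite[OF fin]) auto
  also have "\<dots> = (\<Sum>l\<in>partitions n. (num_tableaux (young_diagram l))\<^sup>2 / fact n * content_sum ?\<delta> (young_diagram l))"
    by (intro sum.cong refl) (simp add: num_syt_eq durfee_eq[OF _ n])
  also have "\<dots> = (\<Sum>D\<in>diagrams n. (num_tableaux D)\<^sup>2 / fact n * content_sum ?\<delta> D)"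
    by (rule sum.reindex_bij_betw[OF bij_betw_young_diagram])
  also have "\<dots> = plancherel_sum n (content_sum ?\<delta>) / fact n"
    by (simp add: plancherel_sum_def sum_divide_distrib)
  \<comment> \<open>Contents in a diagram of \<open>n\<close> boxes have absolute value at most
    \<open>n\<close>, so the expansion of the indicator may stop at \<open>k = n\<close>.\<close>
  also have "plancherel_sum n (content_sum ?\<delta>)
      = plancherel_sum n (\<lambda>D. \<Sum>k\<le>n. (-1) ^ k * fact (2 * k) / (fact k)\<^sup>2 * content_sum (?g k) D)"
    unfolding plancherel_sum_def
  proof (intro sum.cong refl arg_cong2[where f = "(*)"])
    fix D assume D: "D \<in> diagrams n"
    have "content_sum ?\<delta> D = (\<Sum>b\<in>D. \<Sum>k\<le>n. (-1) ^ k * fact (2 * k) / (fact k)\<^sup>2 * ?g k (box_content b))"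
      unfolding content_sum_def
    proof (intro sum.cong refl)
      fix b assume "b \<in> D"
      hence "b \<in> {1..n} \<times> {1..n}"
        using young_subset_square[of D] D by (auto simp: diagrams_def)
      hence "\<bar>box_content b\<bar> \<le> int n" by (cases b) (auto simp: box_content_def)
      from central_factorial_delta[OF this]
      show "?\<delta> (box_content b) = (\<Sum>k\<le>n. (-1) ^ k * fact (2 * k) / (fact k)\<^sup>2 * ?g k (box_content b))"
        by simp
    qed
    also have "\<dots> = (\<Sum>k\<le>n. (-1) ^ k * fact (2 * k) / (fact k)\<^sup>2 * content_sum (?g k) D)"
      unfolding content_sum_def sum_distrib_left by (rule sum.swap)
    finally show "content_sum ?\<delta> D = (\<Sum>k\<le>n. (-1) ^ k * fact (2 * k) / (fact k)\<^sup>2 * content_sum (?g k) D)" .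
  qed
  also have "\<dots> = (\<Sum>k\<le>n. (-1) ^ k * fact (2 * k) / (fact k)\<^sup>2 * plancherel_sum n (content_sum (?g k)))"
    unfolding plancherel_sum_def sum_distrib_left by (subst sum.swap) (simp add: mult_ac)
  also have "\<dots> = (\<Sum>k\<le>n. (-1) ^ k * fact (2 * k) / (fact k)\<^sup>2 * (fact n * real (n choose Suc k) / fact (Suc k)))"
    by (simp only: plancherel_central_factorial)
  also have "\<dots> / fact n = (\<Sum>k\<le>n. (-1) ^ k * real ((2 * k) choose k) * real (n choose Suc k) / fact (Suc k))"
    unfolding sum_divide_distrib
  proof (intro sum.cong refl)
    fix k
    have "real ((2 * k) choose k) = fact (2 * k) / (fact k)\<^sup>2"
      using binomial_fact[of k "2 * k", where ?'a = real] by (simp add: power2_eq_square mult_2)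
    thus "(-1) ^ k * fact (2 * k) / (fact k)\<^sup>2 * (fact n * real (n choose Suc k) / fact (Suc k)) / fact n
        = (-1) ^ k * real ((2 * k) choose k) * real (n choose Suc k) / fact (Suc k)"
      by (simp del: fact_Suc)
  qed
  \<comment> \<open>The term \<open>k = n\<close> contains
    \<open>n choose Suc n = 0\<close>.\<close>
  also have "\<dots> = (\<Sum>k<n. (-1) ^ k * real ((2 * k) choose k) * real (n choose Suc k) / fact (Suc k))"
    by (simp add: lessThan_Suc_atMost[symmetric])
  finally show ?thesis .
qed

section \<open>Means with respect to the arcsine law\<close>

text \<open>The arcsine law on \<open>[0, 4]\<close> has density
  \<open>1 / (pi * sqrt (x * (4 - x)))\<close>. The angular form removes the endpoint singularities,
  so that continuous functions have continuous integrands.\<close>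

definition arcsine_mean :: "(real \<Rightarrow> real) \<Rightarrow> real" where
  "arcsine_mean g = 2 / pi * integral {0..pi / 2} (\<lambda>t. g (4 * (sin t)\<^sup>2))"

lemma four_sin_squared_in: "4 * (sin t)\<^sup>2 \<in> {0..4::real}"
  using abs_sin_le_one[of t] by (simp add: abs_square_le_1)

lemma continuous_on_four_sin_squared:
  fixes g :: "real \<Rightarrow> real" and S :: "real set"
  assumes "continuous_on {0..4} g"
  shows "continuous_on S (\<lambda>t. g (4 * (sin t)\<^sup>2) :: real)"
  by (rule continuous_on_compose2[OF assms]) (use four_sin_squared_in in \<open>auto intro!: continuous_intros\<close>)

lemma arcsine_integrable:
  assumes "continuous_on {0..4} g"
  shows "(\<lambda>t. g (4 * (sin t)\<^sup>2) :: real) integrable_on {0..pi / 2}"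
  by (rule integrable_continuous_real[OF continuous_on_four_sin_squared[OF assms]])

lemma arcsine_mean_cong:
  assumes "\<And>x. x \<in> {0..4} \<Longrightarrow> g x = h x"
  shows "arcsine_mean g = arcsine_mean h"
  unfolding arcsine_mean_def using assms[OF four_sin_squared_in] by simp

lemma arcsine_mean_add:
  assumes "continuous_on {0..4} g" "continuous_on {0..4} h"
  shows "arcsine_mean (\<lambda>x. g x + h x) = arcsine_mean g + arcsine_mean h"
  unfolding arcsine_mean_def
  by (subst integral_add) (use assms arcsine_integrable in \<open>auto simp: algebra_simps\<close>)

lemma arcsine_mean_diff:
  assumes "continuous_on {0..4} g" "continuous_on {0..4} h"
  shows "arcsine_mean (\<lambda>x. g x - h x) = arcsine_mean g - arcsine_mean h"
  unfolding arcsine_mean_def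
  by (subst integral_diff) (use assms arcsine_integrable in \<open>auto simp: algebra_simps\<close>)

lemma arcsine_mean_cmult: "arcsine_mean (\<lambda>x. c * g x) = c * arcsine_mean g"
  unfolding arcsine_mean_def by simp

lemma arcsine_mean_const: "arcsine_mean (\<lambda>x. c) = c"
  unfolding arcsine_mean_def by simp

lemma arcsine_mean_sum:
  assumes "\<And>i. i \<in> I \<Longrightarrow> continuous_on {0..4} (g i)" "finite I"
  shows "arcsine_mean (\<lambda>x. \<Sum>i\<in>I. g i x) = (\<Sum>i\<in>I. arcsine_mean (g i))"
  unfolding arcsine_mean_def
  by (subst integral_sum) (use assms arcsine_integrable in \<open>auto simp: sum_distrib_left\<close>)

lemma arcsine_mean_mono:
  assumes "continuous_on {0..4} g" "continuous_on {0..4} h" "\<And>x. x \<in> {0..4} \<Longrightarrow> g x \<le> h x"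
  shows "arcsine_mean g \<le> arcsine_mean h"
  unfolding arcsine_mean_def
  by (intro mult_left_mono integral_le arcsine_integrable assms four_sin_squared_in) auto

lemma arcsine_mean_abs_le:
  assumes "continuous_on {0..4} g" "\<And>x. x \<in> {0..4} \<Longrightarrow> \<bar>g x\<bar> \<le> C"
  shows "\<bar>arcsine_mean g\<bar> \<le> C"
proof -
  have "arcsine_mean g \<le> arcsine_mean (\<lambda>_. C)" "arcsine_mean (\<lambda>_. - C) \<le> arcsine_mean g"
    using assms(2) by (intro arcsine_mean_mono assms(1) continuous_intros; force simp: abs_le_iff)+
  thus ?thesis by (simp add: arcsine_mean_const)
qed

text \<open>In the variable \<open>x\<close> this integrates the derivative of
  \<open>sqrt (x * (4 - x)) * h x\<close>, which vanishes at both ends. The factor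
  \<open>x * (4 - x)\<close> is the price for the absence of boundary terms.\<close>

lemma arcsine_mean_by_parts:
  assumes deriv: "\<And>x. (h has_real_derivative h' x) (at x)" and cont: "continuous_on {0..4} h'"
  shows "arcsine_mean (\<lambda>x. x * (4 - x) * h' x) = arcsine_mean (\<lambda>x. (x - 2) * h x)"
proof -
  have ch: "continuous_on {0..4} h"
    by (meson DERIV_isCont continuous_at_imp_continuous_on deriv)
  define T' where "T' x = (x - 2) * h x - x * (4 - x) * h' x" for x
  have "((\<lambda>t. - 2 * sin t * cos t * h (4 * (sin t)\<^sup>2)) has_vector_derivative T' (4 * (sin t)\<^sup>2)) (at t within {0..pi/2})" for t
  proof -
    have "((\<lambda>t. - 2 * sin t * cos t * h (4 * (sin t)\<^sup>2)) has_real_derivative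
        - 2 * cos t * cos t * h (4 * (sin t)\<^sup>2) + 2 * sin t * sin t * h (4 * (sin t)\<^sup>2)
        - 2 * sin t * cos t * (h' (4 * (sin t)\<^sup>2) * (8 * sin t * cos t))) (at t)"
      by (auto intro!: derivative_eq_intros DERIV_chain2[OF deriv] simp: algebra_simps power2_eq_square)
    moreover have "- 2 * cos t * cos t * h (4 * (sin t)\<^sup>2) + 2 * sin t * sin t * h (4 * (sin t)\<^sup>2)
        - 2 * sin t * cos t * (h' (4 * (sin t)\<^sup>2) * (8 * sin t * cos t)) = T' (4 * (sin t)\<^sup>2)"
    proof -
      have c: "cos t * cos t = 1 - (sin t)\<^sup>2" using sin_cos_squared_add[of t] by (simp add: power2_eq_square algebra_simps)
      define s where "s = (sin t)\<^sup>2"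
      have poly: "- 2 * cos t * cos t * H + 2 * sin t * sin t * H - 2 * sin t * cos t * (H' * (8 * sin t * cos t))
         = (2 * (sin t)\<^sup>2 - 2 * (cos t * cos t)) * H - 16 * (sin t)\<^sup>2 * (cos t * cos t) * H'" for H H'
        by (simp add: algebra_simps power2_eq_square)
      show ?thesis unfolding poly c T'_def s_def[symmetric] by (simp add: algebra_simps)
    qed
    ultimately have "((\<lambda>t. - 2 * sin t * cos t * h (4 * (sin t)\<^sup>2)) has_real_derivative
        T' (4 * (sin t)\<^sup>2)) (at t)" by (simp only:)
    thus ?thesis
      unfolding has_real_derivative_iff_has_vector_derivative[symmetric]
      by (rule has_field_derivative_at_within)
  qed
  hence "((\<lambda>t. T' (4 * (sin t)\<^sup>2)) has_integral
      (- 2 * sin (pi/2) * cos (pi/2) * h (4 * (sin (pi/2))\<^sup>2) - (- 2 * sin 0 * cos 0 * h (4 * (sin 0)\<^sup>2)))) {0..pi/2}"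
    by (intro fundamental_theorem_of_calculus) auto
  hence "arcsine_mean T' = 0" unfolding arcsine_mean_def by (simp add: integral_unique)
  moreover have "arcsine_mean T' = arcsine_mean (\<lambda>x. (x - 2) * h x) - arcsine_mean (\<lambda>x. x * (4 - x) * h' x)"
    unfolding T'_def by (intro arcsine_mean_diff continuous_intros ch cont)
  ultimately show ?thesis by simp
qed

lemma central_binomial_Suc:
  "real (k + 1) * real (2 * (k + 1) choose (k + 1)) = real (2 * (2 * k + 1)) * real (2 * k choose k)"
proof -
  have *: "real (2 * m choose m) = fact (2 * m) / (fact m)\<^sup>2" for m
    using binomial_fact[of m "2 * m", where ?'a = real] by (simp add: power2_eq_square mult_2)
  have f: "(fact (2 * (k + 1)) :: real) = (2 * real k + 2) * ((2 * real k + 1) * fact (2 * k))"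
    "(fact (k + 1) :: real) = (real k + 1) * fact k"
    by (simp_all add: algebra_simps)
  define F where "F = (fact k :: real)"
  define K where "K = real k + 1"
  define M where "M = 2 * real k + 1"
  have nz: "F \<noteq> 0" "K \<noteq> 0" by (simp_all add: F_def K_def)
  have KM: "real (k + 1) = K" "2 * real k + 2 = 2 * K" "real (2 * (2 * k + 1)) = 2 * M"
    by (simp_all add: K_def M_def)
  show ?thesis
    unfolding * f F_def[symmetric] KM unfolding K_def[symmetric] M_def[symmetric] using nz
    by (simp add: field_simps power2_eq_square)
qed

text \<open>Integration by parts with \<open>h x = x ^ k\<close> links two successive moments by the
  recursion of the central binomial coefficients.\<close>

lemma arcsine_mean_power: "arcsine_mean (\<lambda>x. x ^ k) = real (2 * k choose k)"
proof (induction k)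
  case (Suc k)
  have "arcsine_mean (\<lambda>x. x * (4 - x) * (if k = 0 then 0 else real k * x ^ (k - 1)))
      = arcsine_mean (\<lambda>x. (x - 2) * x ^ k)"
  proof (rule arcsine_mean_by_parts)
    show "((\<lambda>x. x ^ k) has_real_derivative (if k = 0 then 0 else real k * x ^ (k - 1))) (at x)" for x
      by (auto intro!: derivative_eq_intros)
    show "continuous_on {0..4} (\<lambda>x::real. if k = 0 then 0 else real k * x ^ (k - 1))"
      by (cases "k = 0") (auto intro!: continuous_intros)
  qed
  also have "arcsine_mean (\<lambda>x. x * (4 - x) * (if k = 0 then 0 else real k * x ^ (k - 1)))
      = arcsine_mean (\<lambda>x. 4 * real k * x ^ k - real k * x ^ Suc k)"
    by (rule arcsine_mean_cong) (cases k, auto simp: algebra_simps)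
  also have "\<dots> = 4 * real k * arcsine_mean (\<lambda>x. x ^ k) - real k * arcsine_mean (\<lambda>x. x ^ Suc k)"
    by (subst arcsine_mean_diff) (auto intro!: continuous_intros simp: arcsine_mean_cmult[symmetric] mult.assoc)
  also have "arcsine_mean (\<lambda>x. (x - 2) * x ^ k) = arcsine_mean (\<lambda>x. x ^ Suc k - 2 * x ^ k)"
    by (rule arcsine_mean_cong) (auto simp: algebra_simps)
  also have "\<dots> = arcsine_mean (\<lambda>x. x ^ Suc k) - 2 * arcsine_mean (\<lambda>x. x ^ k)"
    by (subst arcsine_mean_diff) (auto intro!: continuous_intros simp: arcsine_mean_cmult[symmetric])
  finally have "real (k + 1) * arcsine_mean (\<lambda>x. x ^ Suc k) = real (2 * (2 * k + 1)) * real (2 * k choose k)"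
    unfolding Suc.IH by (simp add: algebra_simps)
  hence "real (k + 1) * arcsine_mean (\<lambda>x. x ^ Suc k) = real (k + 1) * real (2 * (k + 1) choose (k + 1))"
    unfolding central_binomial_Suc .
  thus ?case by (subst (asm) mult_cancel_left) auto
qed (simp add: arcsine_mean_const)

text \<open>Absolute convergence at \<open>x = 4\<close> gives uniform convergence on
  \<open>[0, 4]\<close>, so the mean may be taken term by term.\<close>

lemma arcsine_mean_power_series:
  assumes sums: "\<And>x. x \<in> {0..4} \<Longrightarrow> (\<lambda>k. a k * x ^ k) sums g x"
    and summable: "summable (\<lambda>k. \<bar>a k\<bar> * 4 ^ k)"
  shows "(\<lambda>k. a k * real (2 * k choose k)) sums arcsine_mean g"
proof -
  have ul: "uniform_limit {0..4} (\<lambda>n x. \<Sum>k<n. a k * x ^ k) (\<lambda>x. \<Sum>k. a k * x ^ k) sequentially"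
  proof (rule Weierstrass_m_test)
    show "norm (a k * x ^ k) \<le> \<bar>a k\<bar> * 4 ^ k" if "x \<in> {0..4}" for k and x :: real
      using that by (auto simp: abs_mult power_abs intro!: mult_left_mono power_mono)
  qed (rule summable)
  have ul': "uniform_limit (cbox 0 (pi/2)) (\<lambda>n t. \<Sum>k<n. a k * (4 * (sin t)\<^sup>2) ^ k)
      (\<lambda>t. \<Sum>k. a k * (4 * (sin t)\<^sup>2) ^ k) sequentially"
    using uniform_limit_compose'[OF ul, of "\<lambda>t. 4 * (sin t)\<^sup>2" "cbox 0 (pi/2)"] four_sin_squared_in by blast
  obtain I J where IJ: "\<And>n. ((\<lambda>t. \<Sum>k<n. a k * (4 * (sin t)\<^sup>2) ^ k) has_integral I n) (cbox 0 (pi/2))"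
      "((\<lambda>t. \<Sum>k. a k * (4 * (sin t)\<^sup>2) ^ k) has_integral J) (cbox 0 (pi/2))" "I \<longlonglongrightarrow> J"
  proof (rule uniform_limit_integral_cbox[OF ul'])
    show "continuous_on (cbox 0 (pi/2)) (\<lambda>t. \<Sum>k<n. a k * (4 * (sin t)\<^sup>2) ^ k)" for n
      by (intro continuous_intros)
  qed auto
  have "2 / pi * I n = (\<Sum>k<n. a k * real (2 * k choose k))" for n
  proof -
    have "2 / pi * I n = arcsine_mean (\<lambda>x. \<Sum>k<n. a k * x ^ k)"
      unfolding arcsine_mean_def using IJ(1)[of n] by (simp add: integral_unique)
    also have "\<dots> = (\<Sum>k<n. a k * real (2 * k choose k))"
      by (subst arcsine_mean_sum) (auto intro!: continuous_intros simp: arcsine_mean_cmult arcsine_mean_power)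
    finally show ?thesis .
  qed
  moreover have "(\<lambda>n. 2 / pi * I n) \<longlonglongrightarrow> 2 / pi * J" by (intro tendsto_intros IJ)
  moreover have "2 / pi * J = arcsine_mean g"
  proof -
    have "(\<Sum>k. a k * (4 * (sin t)\<^sup>2) ^ k) = g (4 * (sin t)\<^sup>2)" for t
      using sums[OF four_sin_squared_in[of t]] by (rule sums_unique[symmetric])
    thus ?thesis unfolding arcsine_mean_def using IJ(2) by (simp add: integral_unique)
  qed
  ultimately show ?thesis by (simp add: sums_def)
qed

text \<open>Differentiation in the scale \<open>\<theta>\<close> produces new Bessel means from
  known ones without further series.\<close>

lemma arcsine_mean_has_derivative:
  assumes deriv: "\<And>x. (g has_real_derivative g' x) (at x)"
    and cont: "continuous_on UNIV g'" and h: "continuous_on {0..4} h"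
  shows "((\<lambda>\<theta>. arcsine_mean (\<lambda>x. h x * g (\<theta> * x))) has_real_derivative
            arcsine_mean (\<lambda>x. h x * (x * g' (\<theta> * x)))) (at \<theta>)"
proof -
  have cg: "continuous_on UNIV g"
    by (meson DERIV_isCont continuous_at_imp_continuous_on deriv)
  have "((\<lambda>\<theta>. integral (cbox 0 (pi/2)) (\<lambda>t. h (4 * (sin t)\<^sup>2) * g (\<theta> * (4 * (sin t)\<^sup>2)))) has_field_derivative
      integral (cbox 0 (pi/2)) (\<lambda>t. h (4 * (sin t)\<^sup>2) * (4 * (sin t)\<^sup>2 * g' (\<theta> * (4 * (sin t)\<^sup>2)))))
      (at \<theta> within UNIV)"
  proof (rule leibniz_rule_field_derivative)
    show "((\<lambda>\<theta>. h (4 * (sin t)\<^sup>2) * g (\<theta> * (4 * (sin t)\<^sup>2))) has_field_derivative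
        h (4 * (sin t)\<^sup>2) * (4 * (sin t)\<^sup>2 * g' (\<theta> * (4 * (sin t)\<^sup>2)))) (at \<theta> within UNIV)"
      for \<theta> t
      by (auto intro!: derivative_eq_intros DERIV_chain2[OF deriv])
    show "(\<lambda>t. h (4 * (sin t)\<^sup>2) * g (\<theta> * (4 * (sin t)\<^sup>2))) integrable_on cbox 0 (pi/2)" for \<theta>
      by (intro integrable_continuous continuous_intros continuous_on_four_sin_squared[OF h]
            continuous_on_compose2[OF cg]) auto
    have "continuous_on (UNIV \<times> cbox 0 (pi/2)) (\<lambda>x::real \<times> real. h (4 * (sin (snd x))\<^sup>2))"
      by (rule continuous_on_compose2[OF continuous_on_four_sin_squared[OF h, of UNIV]])
         (auto intro!: continuous_intros)
    thus "continuous_on (UNIV \<times> cbox 0 (pi/2)) (\<lambda>(\<theta>, t). h (4 * (sin t)\<^sup>2) * (4 * (sin t)\<^sup>2 * g' (\<theta> * (4 * (sin t)\<^sup>2))))"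
      unfolding case_prod_unfold
      by (intro continuous_intros continuous_on_compose2[OF cont]) auto
  qed auto
  thus ?thesis unfolding arcsine_mean_def by (intro DERIV_cmult) simp
qed

section \<open>The Bessel function of order zero\<close>

text \<open>Series in \<open>q = z^2 / 4\<close> rather than in \<open>z\<close>: at
  \<open>q = \<theta> * x\<close> the Bessel terms are entire in both variables and no square roots
  enter the means.\<close>

definition bessel_coeff :: "nat \<Rightarrow> real" where
  "bessel_coeff k = (-1) ^ k / (fact k)\<^sup>2"

text \<open>The Bessel function is \<open>J\<^sub>0(z) = bessel (z\<^sup>2 / 4)\<close>.\<close>

definition bessel :: "real \<Rightarrow> real" where
  "bessel q = (\<Sum>k. bessel_coeff k * q ^ k)"

definition bessel' :: "real \<Rightarrow> real" where
  "bessel' q = (\<Sum>k. diffs bessel_coeff k * q ^ k)"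

definition bessel'' :: "real \<Rightarrow> real" where
  "bessel'' q = (\<Sum>k. diffs (diffs bessel_coeff) k * q ^ k)"

lemma summable_bessel_abs: "summable (\<lambda>k. \<bar>bessel_coeff k\<bar> * \<bar>q\<bar> ^ k)"
proof (rule summable_comparison_test')
  show "summable (\<lambda>k. inverse (fact k) * \<bar>q\<bar> ^ k)" by (rule summable_exp)
  show "norm (\<bar>bessel_coeff k\<bar> * \<bar>q\<bar> ^ k) \<le> inverse (fact k) * \<bar>q\<bar> ^ k" for k
  proof -
    have "(fact k :: real) \<le> (fact k)\<^sup>2" by (simp add: power2_eq_square)
    hence "\<bar>bessel_coeff k\<bar> \<le> inverse (fact k)"
      by (simp add: bessel_coeff_def abs_mult power_abs divide_simps)
    thus ?thesis by (simp add: abs_mult mult_right_mono)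
  qed
qed

lemma summable_bessel: "summable (\<lambda>k. bessel_coeff k * q ^ k)"
  using summable_bessel_abs[of q] by (intro summable_norm_cancel[where f = "\<lambda>k. bessel_coeff k * q ^ k"]) (simp add: abs_mult power_abs)

lemma summable_bessel': "summable (\<lambda>k. diffs bessel_coeff k * q ^ k)"
  by (rule termdiff_converges_all) (rule summable_bessel)

lemma summable_bessel'': "summable (\<lambda>k. diffs (diffs bessel_coeff) k * q ^ k)"
  by (rule termdiff_converges_all) (rule summable_bessel')

lemma bessel_sums: "(\<lambda>k. bessel_coeff k * q ^ k) sums bessel q"
  unfolding bessel_def by (rule summable_sums[OF summable_bessel])

lemma bessel_has_derivative: "(bessel has_real_derivative bessel' q) (at q)"
  unfolding bessel_def[abs_def] bessel'_def
  by (rule termdiffs_strong_converges_everywhere) (rule summable_bessel)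

lemma bessel'_has_derivative: "(bessel' has_real_derivative bessel'' q) (at q)"
  unfolding bessel'_def[abs_def] bessel''_def
  by (rule termdiffs_strong_converges_everywhere) (rule summable_bessel')

lemma continuous_bessel'': "continuous_on S bessel''"
proof -
  have "(bessel'' has_real_derivative (\<Sum>k. diffs (diffs (diffs bessel_coeff)) k * q ^ k)) (at q)" for q
    unfolding bessel''_def[abs_def]
    by (rule termdiffs_strong_converges_everywhere) (rule summable_bessel'')
  thus ?thesis by (meson DERIV_isCont continuous_at_imp_continuous_on)
qed

lemma continuous_bessel: "continuous_on S bessel"
  by (meson DERIV_isCont bessel_has_derivative continuous_at_imp_continuous_on)

lemma continuous_bessel': "continuous_on S bessel'"
  by (meson DERIV_isCont bessel'_has_derivative continuous_at_imp_continuous_on)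

lemma bessel_0: "bessel 0 = 1"
  using sums_unique2[OF bessel_sums[of 0] powser_sums_zero] by (simp add: bessel_coeff_def)

lemmas bessel_DERIV [derivative_intros] =
  DERIV_chain2[OF bessel_has_derivative] DERIV_chain2[OF bessel'_has_derivative]

lemma continuous_on_bessel_compose [continuous_intros]:
  assumes "continuous_on S f"
  shows "continuous_on S (\<lambda>x. bessel (f x))" "continuous_on S (\<lambda>x. bessel' (f x))"
    "continuous_on S (\<lambda>x. bessel'' (f x))"
  using continuous_on_compose2[OF continuous_bessel[of UNIV] assms]
    continuous_on_compose2[OF continuous_bessel'[of UNIV] assms]
    continuous_on_compose2[OF continuous_bessel''[of UNIV] assms] by auto

lemma bessel_ode: "q * bessel'' q + bessel' q + bessel q = 0"
proof -
  let ?b = "\<lambda>k. real k * real (k + 1) * bessel_coeff (k + 1) * q ^ k"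
  have "(\<lambda>k. q * (diffs (diffs bessel_coeff) k * q ^ k)) sums (q * bessel'' q)"
    unfolding bessel''_def by (intro sums_mult summable_sums summable_bessel'')
  hence "(\<lambda>k. ?b (Suc k)) sums (q * bessel'' q)"
    by (simp add: diffs_def mult_ac)
  hence 2: "?b sums (q * bessel'' q)" by (subst (asm) sums_Suc_iff) simp
  have 1: "(\<lambda>k. diffs bessel_coeff k * q ^ k) sums bessel' q"
    unfolding bessel'_def by (intro summable_sums summable_bessel')
  have "(\<lambda>k. ?b k + diffs bessel_coeff k * q ^ k + bessel_coeff k * q ^ k) sums
      (q * bessel'' q + bessel' q + bessel q)"
    by (intro sums_add 1 2 bessel_sums)
  moreover have "?b k + diffs bessel_coeff k * q ^ k + bessel_coeff k * q ^ k = 0" for k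
  proof -
    have *: "bessel_coeff k = - ((real k + 1)\<^sup>2 * bessel_coeff (Suc k))"
      by (simp add: bessel_coeff_def power_mult_distrib add.commute)
    show ?thesis by (subst *) (simp add: diffs_def algebra_simps power2_eq_square)
  qed
  ultimately have "(\<lambda>k. 0) sums (q * bessel'' q + bessel' q + bessel q)" by simp
  from sums_unique2[OF this sums_zero] show ?thesis .
qed

text \<open>Classically \<open>J0^2 + J1^2 \<le> 1\<close>. By the differential equation the
  left-hand side has derivative \<open>- (bessel' q)^2\<close>, and it starts at 1.\<close>

lemma bessel_energy_le:
  assumes "q \<ge> 0"
  shows "(bessel q)\<^sup>2 + q * (bessel' q)\<^sup>2 \<le> 1"
proof -
  have "(bessel q)\<^sup>2 + q * (bessel' q)\<^sup>2 \<le> (bessel 0)\<^sup>2 + 0 * (bessel' 0)\<^sup>2"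
  proof (rule DERIV_nonpos_imp_nonincreasing[OF assms])
    fix x :: real
    have "((\<lambda>q. (bessel q)\<^sup>2 + q * (bessel' q)\<^sup>2) has_real_derivative
        2 * bessel x * bessel' x + (bessel' x)\<^sup>2 + 2 * bessel' x * (x * bessel'' x)) (at x)"
      by (auto intro!: derivative_eq_intros simp: algebra_simps)
    also have "x * bessel'' x = - bessel' x - bessel x" using bessel_ode[of x] by linarith
    also have "2 * bessel x * bessel' x + (bessel' x)\<^sup>2 + 2 * bessel' x * (- bessel' x - bessel x) = - (bessel' x)\<^sup>2"
      by (simp add: power2_eq_square algebra_simps)
    finally show "\<exists>y. ((\<lambda>q. (bessel q)\<^sup>2 + q * (bessel' q)\<^sup>2) has_real_derivative y) (at x) \<and> y \<le> 0"
      by force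
  qed
  thus ?thesis by (simp add: bessel_0)
qed

lemma bessel_abs_le_1: "q \<ge> 0 \<Longrightarrow> \<bar>bessel q\<bar> \<le> 1"
  using bessel_energy_le[of q] mult_nonneg_nonneg[of q "(bessel' q)\<^sup>2"] zero_le_power2[of "bessel' q"]
  unfolding abs_square_le_1[symmetric] by linarith

text \<open>In classical notation, \<open>\<langle>J\<^sub>0(z y)\<rangle> = J\<^sub>0(z)\<^sup>2\<close> for \<open>y = 2 sin t\<close> and \<open>z = 2 sqrt \<theta>\<close>.\<close>

lemma arcsine_mean_bessel: "arcsine_mean (\<lambda>x. bessel (\<theta> * x)) = (bessel \<theta>)\<^sup>2"
proof -
  \<comment> \<open>In the Cauchy square of the series, \<open>bessel_coeff k\<close> appears with
    the sum of the squares \<open>(k choose i)^2\<close>, which is \<open>2 * k choose k\<close>,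
    the \<open>k\<close>-th arcsine moment.\<close>
  have "(\<lambda>k. \<Sum>i\<le>k. (bessel_coeff i * \<theta> ^ i) * (bessel_coeff (k - i) * \<theta> ^ (k - i))) sums
      ((\<Sum>k. bessel_coeff k * \<theta> ^ k) * (\<Sum>k. bessel_coeff k * \<theta> ^ k))"
    using summable_bessel_abs[of \<theta>] by (intro Cauchy_product_sums) (simp_all add: abs_mult power_abs)
  moreover have "(\<Sum>i\<le>k. (bessel_coeff i * \<theta> ^ i) * (bessel_coeff (k - i) * \<theta> ^ (k - i)))
      = bessel_coeff k * \<theta> ^ k * real (2 * k choose k)" for k
  proof -
    have "(\<Sum>i\<le>k. (bessel_coeff i * \<theta> ^ i) * (bessel_coeff (k - i) * \<theta> ^ (k - i)))
        = (\<Sum>i\<le>k. bessel_coeff k * \<theta> ^ k * real ((k choose i)\<^sup>2))"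
    proof (intro sum.cong refl)
      fix i assume "i \<in> {..k}"
      hence i: "i \<le> k" by simp
      have s: "(-1) ^ i * (-1) ^ (k - i) = ((-1) ^ k :: real)" "\<theta> ^ i * \<theta> ^ (k - i) = \<theta> ^ k"
        using i by (simp_all add: power_add[symmetric])
      have "real ((k choose i)\<^sup>2) = (fact k)\<^sup>2 / ((fact i)\<^sup>2 * (fact (k - i))\<^sup>2)"
        using i by (simp add: binomial_fact power_divide power_mult_distrib)
      hence "bessel_coeff k * \<theta> ^ k * real ((k choose i)\<^sup>2) = ((-1) ^ k * \<theta> ^ k) / ((fact i)\<^sup>2 * (fact (k - i))\<^sup>2)"
        by (simp add: bessel_coeff_def)
      also have "\<dots> = (((-1) ^ i * (-1) ^ (k - i)) * (\<theta> ^ i * \<theta> ^ (k - i))) / ((fact i)\<^sup>2 * (fact (k - i))\<^sup>2)"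
        unfolding s ..
      also have "\<dots> = (bessel_coeff i * \<theta> ^ i) * (bessel_coeff (k - i) * \<theta> ^ (k - i))"
        by (simp add: bessel_coeff_def)
      finally show "(bessel_coeff i * \<theta> ^ i) * (bessel_coeff (k - i) * \<theta> ^ (k - i))
        = bessel_coeff k * \<theta> ^ k * real ((k choose i)\<^sup>2)" ..
    qed
    also have "\<dots> = bessel_coeff k * \<theta> ^ k * real (2 * k choose k)"
      by (simp only: sum_distrib_left[symmetric] of_nat_sum[symmetric] choose_square_sum)
    finally show ?thesis .
  qed
  ultimately have "(\<lambda>k. bessel_coeff k * \<theta> ^ k * real (2 * k choose k)) sums (bessel \<theta>)\<^sup>2"
    by (simp add: bessel_def power2_eq_square)
  moreover have "(\<lambda>k. bessel_coeff k * \<theta> ^ k * real (2 * k choose k)) sums arcsine_mean (\<lambda>x. bessel (\<theta> * x))"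
  proof (rule arcsine_mean_power_series)
    show "(\<lambda>k. bessel_coeff k * \<theta> ^ k * x ^ k) sums bessel (\<theta> * x)" for x
      using bessel_sums[of "\<theta> * x"] by (simp add: power_mult_distrib mult.assoc)
    show "summable (\<lambda>k. \<bar>bessel_coeff k * \<theta> ^ k\<bar> * 4 ^ k)"
      using summable_bessel_abs[of "\<theta> * 4"] by (simp add: abs_mult power_abs power_mult_distrib mult.assoc)
  qed
  ultimately show ?thesis by (rule sums_unique2[symmetric])
qed

text \<open>The cosine series of \<open>z * sin t\<close> is a power series in
  \<open>x = 4 * (sin t)^2\<close>, and the arcsine moments turn its coefficients into
  \<open>bessel_coeff k\<close>. This integral is the starting point for stationary phase.\<close>

lemma bessel_eq_mean_cos:
  "bessel (z\<^sup>2 / 4) = 2 / pi * integral {0..pi / 2} (\<lambda>t. cos (z * sin t))"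
proof -
  define w where "w = z\<^sup>2 / 4"
  have w0: "w \<ge> 0" by (simp add: w_def)
  define a where "a k = (-1) ^ k * w ^ k / fact (2 * k)" for k
  define g where "g x = cos (z * (sqrt x / 2))" for x
  have coeff: "a k * x ^ k = cos_coeff (2 * k) * (z * (sqrt x / 2)) ^ (2 * k)" if "x \<ge> 0" for k x
  proof -
    have "(z * (sqrt x / 2))\<^sup>2 = w * x"
      using that by (simp add: power_mult_distrib power_divide w_def)
    hence "(z * (sqrt x / 2)) ^ (2 * k) = w ^ k * x ^ k"
      by (simp only: power_mult power_mult_distrib[of w x])
    thus ?thesis by (simp add: a_def cos_coeff_def)
  qed
  have "(\<lambda>k. a k * real (2 * k choose k)) sums arcsine_mean g"
  proof (rule arcsine_mean_power_series)
    fix x :: real assume "x \<in> {0..4}"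
    have "(\<lambda>k. cos_coeff k * (z * (sqrt x / 2)) ^ k) sums cos (z * (sqrt x / 2))"
      using cos_converges[of "z * (sqrt x / 2)"] by simp
    moreover have "cos_coeff n * (z * (sqrt x / 2)) ^ n = 0" if "n \<notin> range (\<lambda>k. 2 * k)" for n
    proof -
      have "odd n" using that by (metis evenE rangeI)
      thus ?thesis by (simp add: cos_coeff_def)
    qed
    ultimately have "(\<lambda>k. cos_coeff (2 * k) * (z * (sqrt x / 2)) ^ (2 * k)) sums cos (z * (sqrt x / 2))"
      by (intro iffD2[OF sums_mono_reindex[of "\<lambda>k. 2 * k" "\<lambda>k. cos_coeff k * (z * (sqrt x / 2)) ^ k"]])
         (auto simp: strict_mono_def)
    thus "(\<lambda>k. a k * x ^ k) sums g x" using coeff \<open>x \<in> {0..4}\<close> by (simp add: g_def)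
  next
    have "summable (\<lambda>k. inverse (fact k) * (w * 4) ^ k)" by (rule summable_exp)
    thus "summable (\<lambda>k. \<bar>a k\<bar> * 4 ^ k)"
    proof (rule summable_comparison_test')
      fix k :: nat
      have "\<bar>a k\<bar> * 4 ^ k = inverse (fact (2 * k)) * (w * 4) ^ k"
        using w0 by (simp add: a_def abs_mult power_mult_distrib field_simps)
      also have "\<dots> \<le> inverse (fact k) * (w * 4) ^ k"
        using w0 by (intro mult_right_mono le_imp_inverse_le fact_mono) auto
      finally show "norm (\<bar>a k\<bar> * 4 ^ k) \<le> inverse (fact k) * (w * 4) ^ k" by simp
    qed
  qed
  moreover have "a k * real (2 * k choose k) = bessel_coeff k * w ^ k" for k
  proof -
    have "real (2 * k choose k) = fact (2 * k) / (fact k)\<^sup>2"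
      using binomial_fact[of k "2 * k", where ?'a = real] by (simp add: power2_eq_square mult_2)
    thus ?thesis by (simp add: a_def bessel_coeff_def)
  qed
  ultimately have "(\<lambda>k. bessel_coeff k * w ^ k) sums arcsine_mean g" by simp
  hence "bessel (z\<^sup>2 / 4) = arcsine_mean g"
    unfolding w_def[symmetric] by (rule sums_unique2[OF bessel_sums])
  also have "\<dots> = 2 / pi * integral {0..pi / 2} (\<lambda>t. cos (z * sin t))"
    unfolding arcsine_mean_def
  proof (intro arg_cong2[where f = "(*)"] refl integral_cong)
    fix t assume "t \<in> {0..pi / 2}"
    hence "sin t \<ge> 0" by (intro sin_ge_zero) auto
    thus "g (4 * (sin t)\<^sup>2) = cos (z * sin t)" by (simp add: g_def real_sqrt_mult)
  qed
  finally show ?thesis .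
qed

section \<open>Closed forms for Bessel means\<close>

lemma arcsine_mean_x_bessel':
  "arcsine_mean (\<lambda>x. x * bessel' (\<theta> * x)) = 2 * bessel \<theta> * bessel' \<theta>"
proof -
  have "((\<lambda>\<theta>. arcsine_mean (\<lambda>x. 1 * bessel (\<theta> * x))) has_real_derivative
      arcsine_mean (\<lambda>x. 1 * (x * bessel' (\<theta> * x)))) (at \<theta>)"
    by (intro arcsine_mean_has_derivative bessel_has_derivative continuous_bessel' continuous_intros)
  moreover have "((\<lambda>\<theta>. (bessel \<theta>)\<^sup>2) has_real_derivative 2 * bessel \<theta> * bessel' \<theta>) (at \<theta>)"
    by (auto intro!: derivative_eq_intros)
  ultimately show ?thesis by (simp add: arcsine_mean_bessel DERIV_unique)
qed

text \<open>Averaging Bessel's equation shows that \<open>\<theta> * K \<theta>\<close> has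
  derivative \<open>- (bessel \<theta>)^2\<close>; the claimed value times \<open>\<theta>\<close>
  has the same derivative.\<close>

lemma arcsine_mean_bessel':
  assumes "\<theta> > 0"
  shows "arcsine_mean (\<lambda>x. bessel' (\<theta> * x)) = - ((bessel \<theta>)\<^sup>2 + \<theta> * (bessel' \<theta>)\<^sup>2)"
proof -
  define K where "K \<theta> = arcsine_mean (\<lambda>x. bessel' (\<theta> * x))" for \<theta>
  define K1 where "K1 \<theta> = arcsine_mean (\<lambda>x. x * bessel'' (\<theta> * x))" for \<theta>
  have K': "(K has_real_derivative K1 \<theta>) (at \<theta>)" for \<theta>
    using arcsine_mean_has_derivative[of bessel' bessel'' "\<lambda>_. 1" \<theta>] bessel'_has_derivative continuous_bessel''
    by (simp add: K_def[abs_def] K1_def)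
  have K: "K \<theta> + \<theta> * K1 \<theta> = - (bessel \<theta>)\<^sup>2" for \<theta>
  proof -
    have "K \<theta> + \<theta> * K1 \<theta> = arcsine_mean (\<lambda>x. bessel' (\<theta> * x) + \<theta> * (x * bessel'' (\<theta> * x)))"
      unfolding K_def K1_def
      by (subst arcsine_mean_add) (auto intro!: continuous_intros simp: arcsine_mean_cmult)
    also have "\<dots> = arcsine_mean (\<lambda>x. (-1) * bessel (\<theta> * x))"
    proof (rule arcsine_mean_cong)
      show "bessel' (\<theta> * x) + \<theta> * (x * bessel'' (\<theta> * x)) = (-1) * bessel (\<theta> * x)" for x
        using bessel_ode[of "\<theta> * x"] by (simp add: algebra_simps)
    qed
    also have "\<dots> = - (bessel \<theta>)\<^sup>2" by (simp add: arcsine_mean_cmult[of "-1", simplified] arcsine_mean_bessel)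
    finally show ?thesis .
  qed
  \<comment> \<open>The factor \<open>\<theta>\<close> makes \<open>G\<close> vanish at 0, which
    fixes the constant of integration; \<open>\<theta> > 0\<close> allows dividing it out.\<close>
  define G where "G \<theta> = \<theta> * (K \<theta> + (bessel \<theta>)\<^sup>2 + \<theta> * (bessel' \<theta>)\<^sup>2)" for \<theta>
  have "(G has_real_derivative 0) (at \<theta>)" for \<theta>
  proof -
    have "(G has_real_derivative (K \<theta> + \<theta> * K1 \<theta>) + (bessel \<theta>)\<^sup>2
       + 2 * \<theta> * bessel' \<theta> * (\<theta> * bessel'' \<theta> + bessel' \<theta> + bessel \<theta>)) (at \<theta>)"
      unfolding G_def[abs_def]
      by (auto intro!: derivative_eq_intros K' simp: algebra_simps power2_eq_square)
    thus ?thesis unfolding K bessel_ode by simp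
  qed
  hence "G \<theta> = G 0" by (intro DERIV_isconst_all[rule_format]) auto
  thus ?thesis using assms by (simp add: G_def K_def add_eq_0_iff2)
qed

text \<open>A further differentiation of \<open>arcsine_mean_x_bessel'\<close> gives the mean of
  \<open>x * (x * bessel'')\<close>, and Bessel's equation expresses \<open>x * bessel\<close> by
  this term and \<open>x * bessel'\<close>.\<close>

lemma arcsine_mean_x_bessel:
  "arcsine_mean (\<lambda>x. x * bessel (\<theta> * x)) = 2 * (bessel \<theta>)\<^sup>2 - 2 * \<theta> * (bessel' \<theta>)\<^sup>2"
proof -
  let ?A = "arcsine_mean (\<lambda>x. x * (x * bessel'' (\<theta> * x)))"
  have "((\<lambda>\<theta>. arcsine_mean (\<lambda>x. x * bessel' (\<theta> * x))) has_real_derivative ?A) (at \<theta>)"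
    by (intro arcsine_mean_has_derivative bessel'_has_derivative continuous_bessel'' continuous_intros)
  moreover have "((\<lambda>\<theta>. 2 * bessel \<theta> * bessel' \<theta>) has_real_derivative
      2 * (bessel' \<theta>)\<^sup>2 + 2 * bessel \<theta> * bessel'' \<theta>) (at \<theta>)"
    by (auto intro!: derivative_eq_intros simp: power2_eq_square)
  ultimately have A: "?A = 2 * (bessel' \<theta>)\<^sup>2 + 2 * bessel \<theta> * bessel'' \<theta>"
    by (simp add: arcsine_mean_x_bessel' DERIV_unique)
  have "arcsine_mean (\<lambda>x. x * bessel (\<theta> * x))
      = arcsine_mean (\<lambda>x. (- \<theta>) * (x * (x * bessel'' (\<theta> * x))) - x * bessel' (\<theta> * x))"
  proof (rule arcsine_mean_cong)
    fix x
    have *: "bessel (\<theta> * x) = - (\<theta> * x * bessel'' (\<theta> * x)) - bessel' (\<theta> * x)"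
      using bessel_ode[of "\<theta> * x"] by linarith
    show "x * bessel (\<theta> * x) = (- \<theta>) * (x * (x * bessel'' (\<theta> * x))) - x * bessel' (\<theta> * x)"
      unfolding * by (simp add: algebra_simps)
  qed
  also have "\<dots> = (- \<theta>) * ?A - arcsine_mean (\<lambda>x. x * bessel' (\<theta> * x))"
    unfolding arcsine_mean_cmult[symmetric] by (intro arcsine_mean_diff continuous_intros)
  also have "\<dots> = - 2 * \<theta> * (bessel' \<theta>)\<^sup>2 - 2 * bessel \<theta> * (\<theta> * bessel'' \<theta> + bessel' \<theta> + bessel \<theta>) + 2 * (bessel \<theta>)\<^sup>2"
    unfolding A arcsine_mean_x_bessel' by (simp add: algebra_simps power2_eq_square)
  finally show ?thesis unfolding bessel_ode by simp
qed

text \<open>The function \<open>(1 - bessel q) / q\<close>, given by its series so that the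
  singularity at 0 is filled correctly.\<close>

definition bessel_quotient :: "real \<Rightarrow> real" where
  "bessel_quotient q = (\<Sum>k. - bessel_coeff (Suc k) * q ^ k)"

lemma summable_bessel_quotient: "summable (\<lambda>k. - bessel_coeff (Suc k) * q ^ k)"
proof (cases "q = 0")
  case False
  have "summable (\<lambda>k. bessel_coeff (Suc k) * q ^ Suc k)"
    using summable_bessel[of q] by (subst summable_Suc_iff)
  hence "summable (\<lambda>k. (bessel_coeff (Suc k) * q ^ Suc k) * (- inverse q))" by (rule summable_mult2)
  thus ?thesis using False by (simp add: field_simps)
qed (auto intro: summable_finite[of "{0}"])

lemma bessel_quotient_eq: "q * bessel_quotient q = 1 - bessel q"
proof -
  have "(\<lambda>k. bessel_coeff (Suc k) * q ^ Suc k) sums (bessel q - bessel_coeff 0 * q ^ 0)"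
    using bessel_sums[of q] by (subst sums_Suc_iff) simp
  hence "(\<lambda>k. - (bessel_coeff (Suc k) * q ^ Suc k)) sums - (bessel q - bessel_coeff 0 * q ^ 0)" by (rule sums_minus)
  moreover have "(\<lambda>k. q * (- bessel_coeff (Suc k) * q ^ k)) sums (q * bessel_quotient q)"
    unfolding bessel_quotient_def by (intro sums_mult summable_sums summable_bessel_quotient)
  ultimately show ?thesis by (simp add: sums_unique2 mult_ac bessel_coeff_def)
qed

text \<open>The left-hand side is \<open>\<langle>(1 - J\<^sub>0(z y)) / y\<^sup>2\<rangle>\<close>, the mean Durfee size of the Poissonized
  Plancherel measure with parameter \<open>\<theta> = z\<^sup>2 / 4\<close>.\<close>

lemma arcsine_mean_bessel_quotient:
  assumes "\<theta> > 0"
  shows "\<theta> * arcsine_mean (\<lambda>x. bessel_quotient (\<theta> * x))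
     = 2 * \<theta> * ((bessel \<theta>)\<^sup>2 + \<theta> * (bessel' \<theta>)\<^sup>2) + \<theta> * bessel \<theta> * bessel' \<theta>"
proof -
  define b' where "b' q = (\<Sum>k. diffs (\<lambda>k. - bessel_coeff (Suc k)) k * q ^ k)" for q
  have b'1: "(bessel_quotient has_real_derivative b' q) (at q)" for q
    unfolding bessel_quotient_def[abs_def] b'_def
    by (rule termdiffs_strong_converges_everywhere) (rule summable_bessel_quotient)
  have "(b' has_real_derivative (\<Sum>k. diffs (diffs (\<lambda>k. - bessel_coeff (Suc k))) k * q ^ k)) (at q)" for q
    unfolding b'_def[abs_def]
    by (rule termdiffs_strong_converges_everywhere termdiff_converges_all summable_bessel_quotient)+
  hence cb': "continuous_on UNIV b'" by (meson DERIV_isCont continuous_at_imp_continuous_on)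
  have cb: "continuous_on UNIV bessel_quotient" by (meson DERIV_isCont b'1 continuous_at_imp_continuous_on)
  have bb': "bessel_quotient q + q * b' q = - bessel' q" for q
  proof -
    have "((\<lambda>q. q * bessel_quotient q) has_real_derivative bessel_quotient q + q * b' q) (at q)"
      by (auto intro!: derivative_eq_intros b'1)
    moreover have "((\<lambda>q. 1 - bessel q) has_real_derivative - bessel' q) (at q)"
      by (auto intro!: derivative_eq_intros)
    ultimately show ?thesis by (simp add: bessel_quotient_eq DERIV_unique)
  qed
  define F where "F \<theta> = \<theta> * arcsine_mean (\<lambda>x. bessel_quotient (\<theta> * x))" for \<theta>
  have F': "(F has_real_derivative - arcsine_mean (\<lambda>x. bessel' (\<theta> * x))) (at \<theta>)" for \<theta>
  proof -
    have "((\<lambda>\<theta>. arcsine_mean (\<lambda>x. 1 * bessel_quotient (\<theta> * x))) has_real_derivative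
        arcsine_mean (\<lambda>x. 1 * (x * b' (\<theta> * x)))) (at \<theta>)"
      by (intro arcsine_mean_has_derivative b'1 cb' continuous_intros)
    hence "(F has_real_derivative arcsine_mean (\<lambda>x. bessel_quotient (\<theta> * x))
        + \<theta> * arcsine_mean (\<lambda>x. x * b' (\<theta> * x))) (at \<theta>)"
      unfolding F_def[abs_def] by (auto intro!: derivative_eq_intros)
    also have "arcsine_mean (\<lambda>x. bessel_quotient (\<theta> * x)) + \<theta> * arcsine_mean (\<lambda>x. x * b' (\<theta> * x))
        = arcsine_mean (\<lambda>x. bessel_quotient (\<theta> * x) + \<theta> * (x * b' (\<theta> * x)))"
      by (subst arcsine_mean_add)
         (auto intro!: continuous_intros continuous_on_compose2[OF cb] continuous_on_compose2[OF cb']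
            simp: arcsine_mean_cmult)
    also have "\<dots> = arcsine_mean (\<lambda>x. (-1) * bessel' (\<theta> * x))"
    proof (rule arcsine_mean_cong)
      show "bessel_quotient (\<theta> * x) + \<theta> * (x * b' (\<theta> * x)) = (-1) * bessel' (\<theta> * x)" for x
        using bb'[of "\<theta> * x"] by (simp add: mult.assoc)
    qed
    also have "\<dots> = - arcsine_mean (\<lambda>x. bessel' (\<theta> * x))" by (simp add: arcsine_mean_cmult[of "-1", simplified])
    finally show ?thesis .
  qed
  \<comment> \<open>An antiderivative of
    \<open>(bessel \<theta>)^2 + \<theta> * (bessel' \<theta>)^2\<close>, which for
    \<open>\<theta> > 0\<close> is also the derivative of \<open>F\<close>; both functions vanish at
    0.\<close>
  define R where "R \<theta> = 2 * \<theta> * ((bessel \<theta>)\<^sup>2 + \<theta> * (bessel' \<theta>)\<^sup>2) + \<theta> * bessel \<theta> * bessel' \<theta>" for \<theta>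
  have R': "(R has_real_derivative (bessel \<theta>)\<^sup>2 + \<theta> * (bessel' \<theta>)\<^sup>2) (at \<theta>)" for \<theta>
  proof -
    have "(R has_real_derivative (2 * (bessel \<theta>)\<^sup>2 + 4 * \<theta> * bessel \<theta> * bessel' \<theta> + 4 * \<theta> * (bessel' \<theta>)\<^sup>2
         + 4 * \<theta> * bessel' \<theta> * (\<theta> * bessel'' \<theta>))
         + (bessel \<theta> * bessel' \<theta> + \<theta> * (bessel' \<theta>)\<^sup>2 + bessel \<theta> * (\<theta> * bessel'' \<theta>))) (at \<theta>)"
      unfolding R_def[abs_def]
      by (auto intro!: derivative_eq_intros simp: algebra_simps power2_eq_square)
    also have "\<theta> * bessel'' \<theta> = - bessel' \<theta> - bessel \<theta>" using bessel_ode[of \<theta>] by linarith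
    finally show ?thesis by (simp add: algebra_simps power2_eq_square)
  qed
  have "F \<theta> - R \<theta> = F 0 - R 0"
  proof (rule DERIV_isconst2[of 0 \<theta> "\<lambda>\<theta>. F \<theta> - R \<theta>"])
    show "continuous_on {0..\<theta>} (\<lambda>\<theta>. F \<theta> - R \<theta>)"
      using DERIV_isCont[OF DERIV_diff[OF F' R']] by (intro continuous_at_imp_continuous_on ballI)
    show "((\<lambda>\<theta>. F \<theta> - R \<theta>) has_real_derivative 0) (at x)" if "0 < x" "x < \<theta>" for x
      using DERIV_diff[OF F'[of x] R'[of x]] arcsine_mean_bessel'[OF that(1)] by simp
  qed (use assms in auto)
  thus ?thesis by (simp add: F_def R_def)
qed

section \<open>Fresnel integrals\<close>

text \<open>The bound makes \<open>f z - M / z ^ p\<close> increasing and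
  \<open>f z + M / z ^ p\<close> decreasing. Every value of the first lies below every value of the
  second, so some \<open>L\<close> separates them.\<close>

lemma limit_of_small_derivative:
  fixes f f' :: "real \<Rightarrow> real"
  assumes deriv: "\<And>z. z \<ge> 1 \<Longrightarrow> (f has_real_derivative f' z) (at z)"
    and bound: "\<And>z. z \<ge> 1 \<Longrightarrow> \<bar>f' z\<bar> \<le> M / z ^ Suc p" and p: "p \<ge> 1"
  obtains L where "\<And>z. z \<ge> 1 \<Longrightarrow> \<bar>f z - L\<bar> \<le> M / z ^ p"
proof -
  have M: "M \<ge> 0" using bound[of 1] by simp
  have D: "((\<lambda>z. M / z ^ p) has_real_derivative - (real p * M / z ^ Suc p)) (at z)" if "z \<ge> 1" for z
  proof -
    have "((\<lambda>z. M / z ^ p) has_real_derivative - (M * (real p * z ^ (p - 1)) / (z ^ p * z ^ p))) (at z)"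
      using that by (auto intro!: derivative_eq_intros)
    also have "M * (real p * z ^ (p - 1)) / (z ^ p * z ^ p) = real p * M / z ^ Suc p"
      using that p by (cases p) (auto simp: field_simps)
    finally show ?thesis .
  qed
  have pM: "M / z ^ Suc p \<le> real p * M / z ^ Suc p" if "z \<ge> 1" for z
    using that M p by (intro divide_right_mono) (auto simp: mult_le_cancel_right1)
  have up: "f x - M / x ^ p \<le> f y - M / y ^ p" if "1 \<le> x" "x \<le> y" for x y
  proof (rule DERIV_nonneg_imp_nondecreasing[OF that(2)])
    fix z assume "x \<le> z" "z \<le> y"
    hence z: "z \<ge> 1" using that by simp
    show "\<exists>d. ((\<lambda>z. f z - M / z ^ p) has_real_derivative d) (at z) \<and> d \<ge> 0"
      using DERIV_diff[OF deriv[OF z] D[OF z]] bound[OF z] pM[OF z] by (intro exI conjI) (assumption, linarith)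
  qed
  have down: "f y + M / y ^ p \<le> f x + M / x ^ p" if "1 \<le> x" "x \<le> y" for x y
  proof (rule DERIV_nonpos_imp_nonincreasing[OF that(2)])
    fix z assume "x \<le> z" "z \<le> y"
    hence z: "z \<ge> 1" using that by simp
    show "\<exists>d. ((\<lambda>z. f z + M / z ^ p) has_real_derivative d) (at z) \<and> d \<le> 0"
      using DERIV_add[OF deriv[OF z] D[OF z]] bound[OF z] pM[OF z] by (intro exI conjI) (assumption, linarith)
  qed
  have cross: "f x - M / x ^ p \<le> f y + M / y ^ p" if "1 \<le> x" "1 \<le> y" for x y
  proof -
    have "f x - M / x ^ p \<le> f (max x y) - M / (max x y) ^ p" using that by (intro up) auto
    also have "\<dots> \<le> f (max x y) + M / (max x y) ^ p" using M that by simp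
    also have "\<dots> \<le> f y + M / y ^ p" using that by (intro down) auto
    finally show ?thesis .
  qed
  define L where "L = Sup ((\<lambda>z. f z - M / z ^ p) ` {1..})"
  have bdd: "bdd_above ((\<lambda>z. f z - M / z ^ p) ` {1..})"
    using cross[of _ 1] by (intro bdd_aboveI[of _ "f 1 + M / 1 ^ p"]) auto
  show thesis
  proof (rule that)
    fix z :: real assume z: "z \<ge> 1"
    have "f z - M / z ^ p \<le> L" unfolding L_def using z bdd by (intro cSup_upper) auto
    moreover have "L \<le> f z + M / z ^ p" unfolding L_def using z cross by (intro cSup_least) auto
    ultimately show "\<bar>f z - L\<bar> \<le> M / z ^ p" by linarith
  qed
qed

text \<open>Integration by parts: \<open>u'\<close> carries the oscillation and has a small
  primitive \<open>u\<close>, while the amplitude \<open>k\<close> enters only through its end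
  values and total variation.\<close>

lemma oscillatory_integral_bound:
  fixes u k :: "real \<Rightarrow> real"
  assumes ab: "a \<le> b"
    and u: "\<And>t. t \<in> {a..b} \<Longrightarrow> (u has_real_derivative u' t) (at t)"
    and k: "\<And>t. t \<in> {a..b} \<Longrightarrow> (k has_real_derivative k' t) (at t)"
    and cont: "continuous_on {a..b} u'" "continuous_on {a..b} k'"
    and U: "\<And>t. t \<in> {a..b} \<Longrightarrow> \<bar>u t\<bar> \<le> U"
    and V: "integral {a..b} (\<lambda>t. \<bar>k' t\<bar>) \<le> V"
  shows "\<bar>integral {a..b} (\<lambda>t. u' t * k t)\<bar> \<le> U * (\<bar>k a\<bar> + \<bar>k b\<bar> + V)"
proof -
  have cu: "continuous_on {a..b} u" and ck: "continuous_on {a..b} k"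
    using u k by (meson DERIV_isCont continuous_at_imp_continuous_on)+
  have "((\<lambda>t. u' t * k t + k' t * u t) has_integral (u b * k b - u a * k a)) {a..b}"
  proof (rule fundamental_theorem_of_calculus[OF ab])
    show "((\<lambda>t. u t * k t) has_vector_derivative u' t * k t + k' t * u t) (at t within {a..b})" if "t \<in> {a..b}" for t
      unfolding has_real_derivative_iff_has_vector_derivative[symmetric]
      by (rule has_field_derivative_at_within[OF DERIV_mult[OF u[OF that] k[OF that]]])
  qed
  moreover have i: "(\<lambda>t. u' t * k t) integrable_on {a..b}" "(\<lambda>t. k' t * u t) integrable_on {a..b}"
    by (intro integrable_continuous_real continuous_intros cu ck cont)+
  ultimately have eq: "integral {a..b} (\<lambda>t. u' t * k t) = u b * k b - u a * k a - integral {a..b} (\<lambda>t. k' t * u t)"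
    using integral_add[OF i] by (simp add: integral_unique)
  have "norm (integral {a..b} (\<lambda>t. k' t * u t)) \<le> integral {a..b} (\<lambda>t. U * \<bar>k' t\<bar>)"
    using i(2)
  proof (rule Henstock_Kurzweil_Integration.integral_norm_bound_integral)
    show "(\<lambda>t. U * \<bar>k' t\<bar>) integrable_on {a..b}"
      by (intro integrable_continuous_real continuous_intros cont)
    show "norm (k' t * u t) \<le> U * \<bar>k' t\<bar>" if "t \<in> {a..b}" for t
    proof -
      have "norm (k' t * u t) = \<bar>u t\<bar> * \<bar>k' t\<bar>" by (simp add: abs_mult)
      also have "\<dots> \<le> U * \<bar>k' t\<bar>" by (intro mult_right_mono U that) auto
      finally show ?thesis .
    qed
  qed
  also have "\<dots> \<le> U * V" using V U[of a] ab by (simp add: mult_left_mono)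
  finally have "\<bar>integral {a..b} (\<lambda>t. k' t * u t)\<bar> \<le> U * V" by simp
  moreover have "\<bar>u b * k b\<bar> \<le> U * \<bar>k b\<bar>" "\<bar>u a * k a\<bar> \<le> U * \<bar>k a\<bar>"
    using U[of a] U[of b] ab by (auto simp: abs_mult intro!: mult_right_mono)
  ultimately show ?thesis unfolding eq distrib_left by linarith
qed

section \<open>Squares of the Fresnel integrals\<close>

definition fresnel_cos :: "real \<Rightarrow> real" where
  "fresnel_cos x = integral {0..x} (\<lambda>v. cos (v\<^sup>2))"

definition fresnel_sin :: "real \<Rightarrow> real" where
  "fresnel_sin x = integral {0..x} (\<lambda>v. sin (v\<^sup>2))"

text \<open>One-sided at 0, because \<open>{0..x}\<close> is empty for negative \<open>x\<close> and
  the functions are constant there.\<close>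

lemma fresnel_has_derivative:
  assumes "x \<ge> 0"
  shows "(fresnel_cos has_real_derivative cos (x\<^sup>2)) (at x within {0..})"
    "(fresnel_sin has_real_derivative sin (x\<^sup>2)) (at x within {0..})"
proof -
  have *: "((\<lambda>x. integral {0..x} f) has_real_derivative f x) (at x within {0..})"
    if "continuous_on {0..x+1} f" for f :: "real \<Rightarrow> real"
  proof -
    have "((\<lambda>x. integral {0..x} f) has_vector_derivative f x) (at x within {0..x+1})"
      using assms by (intro integral_has_vector_derivative that) auto
    moreover have "at x within {0..x+1} = at x within {0..}"
      by (rule at_within_nhd[of _ "{..<x+1}"]) (use assms in auto)
    ultimately show ?thesis by (simp add: has_real_derivative_iff_has_vector_derivative)
  qed
  show "(fresnel_cos has_real_derivative cos (x\<^sup>2)) (at x within {0..})"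
    unfolding fresnel_cos_def[abs_def] by (rule *) (intro continuous_intros)
  show "(fresnel_sin has_real_derivative sin (x\<^sup>2)) (at x within {0..})"
    unfolding fresnel_sin_def[abs_def] by (rule *) (intro continuous_intros)
qed

text \<open>The classical device: the squares of the Fresnel integrals have the same derivative as
  \<open>fresnel_aux\<close>, an integral over a fixed interval which tends to 0.\<close>

definition fresnel_aux :: "(real \<Rightarrow> real) \<Rightarrow> real \<Rightarrow> real" where
  "fresnel_aux f x = integral {0..1} (\<lambda>s. f (x\<^sup>2 * (1 + s\<^sup>2)) / (1 + s\<^sup>2))"

lemma one_plus_square_pos: "1 + s\<^sup>2 > (0::real)"
  by (simp add: add_pos_nonneg)

lemma fresnel_aux_has_derivative:
  assumes f: "\<And>x. (f has_real_derivative f' x) (at x)" and cont: "continuous_on UNIV f'"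
  shows "(fresnel_aux f has_real_derivative 2 * x * integral {0..1} (\<lambda>s. f' (x\<^sup>2 * (1 + s\<^sup>2)))) (at x)"
proof -
  have cf: "continuous_on UNIV f" by (meson DERIV_isCont continuous_at_imp_continuous_on f)
  have "((\<lambda>x. integral (cbox 0 1) (\<lambda>s. f (x\<^sup>2 * (1 + s\<^sup>2)) / (1 + s\<^sup>2))) has_field_derivative
      integral (cbox 0 1) (\<lambda>s. 2 * x * f' (x\<^sup>2 * (1 + s\<^sup>2)))) (at x within UNIV)"
  proof (rule leibniz_rule_field_derivative)
    show "((\<lambda>x. f (x\<^sup>2 * (1 + s\<^sup>2)) / (1 + s\<^sup>2)) has_field_derivative 2 * x * f' (x\<^sup>2 * (1 + s\<^sup>2))) (at x within UNIV)" for x s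
    proof -
      have "((\<lambda>x. f (x\<^sup>2 * (1 + s\<^sup>2)) / (1 + s\<^sup>2)) has_field_derivative
          f' (x\<^sup>2 * (1 + s\<^sup>2)) * (2 * x * (1 + s\<^sup>2)) / (1 + s\<^sup>2)) (at x)"
        by (intro DERIV_cdivide DERIV_chain2[OF f]) (auto intro!: derivative_eq_intros)
      moreover have "f' (x\<^sup>2 * (1 + s\<^sup>2)) * (2 * x * (1 + s\<^sup>2)) / (1 + s\<^sup>2) = 2 * x * f' (x\<^sup>2 * (1 + s\<^sup>2))"
        using one_plus_square_pos[of s] by (simp del: add_pos_nonneg)
      ultimately show ?thesis by (simp only:)
    qed
    show "(\<lambda>s. f (x\<^sup>2 * (1 + s\<^sup>2)) / (1 + s\<^sup>2)) integrable_on cbox 0 1" for x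
      using one_plus_square_pos
      by (intro integrable_continuous continuous_intros continuous_on_compose2[OF cf]) (auto simp: less_imp_neq[symmetric])
    show "continuous_on (UNIV \<times> cbox 0 1) (\<lambda>(x, s). 2 * x * f' (x\<^sup>2 * (1 + s\<^sup>2)))"
      unfolding case_prod_unfold by (intro continuous_intros continuous_on_compose2[OF cont]) auto
  qed auto
  thus ?thesis unfolding fresnel_aux_def[abs_def] by simp
qed

lemma integral_rescale:
  fixes f :: "real \<Rightarrow> real"
  assumes "x \<ge> 0" "continuous_on {0..x} f"
  shows "integral {0..x} f = x * integral {0..1} (\<lambda>s. f (x * s))"
proof -
  have "((\<lambda>s. x *\<^sub>R f (x * s)) has_integral (integral {x * 0..x * 1} f)) {0..1}"
  proof (rule has_integral_substitution)
    show "continuous_on {0..x} f" by (rule assms)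
    show "(\<lambda>s. x * s) ` {0..1} \<subseteq> {0..x}" using assms(1) by (auto intro: mult_left_le)
    show "((\<lambda>s. x * s) has_real_derivative x) (at s within {0..1})" for s
      by (auto intro!: derivative_eq_intros)
  qed (use assms in auto)
  thus ?thesis by (simp add: has_integral_iff)
qed

text \<open>Real and imaginary part of one identity: \<open>(C + i S)^2\<close> has derivative
  \<open>2 exp(i x^2) (C + i S)\<close>, and the rescaling \<open>v = x * s\<close> makes this
  \<open>2 x\<close> times the integral of \<open>exp(i x^2 (1 + s^2))\<close> over
  \<open>[0, 1]\<close>. The constant \<open>pi / 4\<close> is the integral of
  \<open>1 / (1 + s^2)\<close>.\<close>

lemma fresnel_squares:
  assumes "x \<ge> 0"
  shows "(fresnel_cos x)\<^sup>2 - (fresnel_sin x)\<^sup>2 = fresnel_aux sin x"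
    "2 * fresnel_cos x * fresnel_sin x = pi / 4 - fresnel_aux cos x"
proof -
  have int: "(\<lambda>v. cos (v\<^sup>2)) integrable_on {0..x}" "(\<lambda>v. sin (v\<^sup>2)) integrable_on {0..x}" for x :: real
    by (intro integrable_continuous_real continuous_intros)+
  have 1: "2 * fresnel_cos x * cos (x\<^sup>2) - 2 * fresnel_sin x * sin (x\<^sup>2)
      = 2 * x * integral {0..1} (\<lambda>s. cos (x\<^sup>2 * (1 + s\<^sup>2)))" if "x \<ge> 0" for x
  proof -
    have "fresnel_cos x * cos (x\<^sup>2) - fresnel_sin x * sin (x\<^sup>2)
        = integral {0..x} (\<lambda>v. cos (v\<^sup>2) * cos (x\<^sup>2) - sin (v\<^sup>2) * sin (x\<^sup>2))"
      unfolding fresnel_cos_def fresnel_sin_def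
      by (subst integral_diff) (auto intro!: integrable_on_mult_left int)
    also have "\<dots> = integral {0..x} (\<lambda>v. cos (v\<^sup>2 + x\<^sup>2))" by (simp add: cos_add)
    also have "\<dots> = x * integral {0..1} (\<lambda>s. cos ((x * s)\<^sup>2 + x\<^sup>2))"
      by (intro integral_rescale that continuous_intros)
    finally show ?thesis by (simp add: power_mult_distrib algebra_simps)
  qed
  have 2: "2 * fresnel_sin x * cos (x\<^sup>2) + 2 * fresnel_cos x * sin (x\<^sup>2)
      = 2 * x * integral {0..1} (\<lambda>s. sin (x\<^sup>2 * (1 + s\<^sup>2)))" if "x \<ge> 0" for x
  proof -
    have "fresnel_sin x * cos (x\<^sup>2) + fresnel_cos x * sin (x\<^sup>2)
        = integral {0..x} (\<lambda>v. sin (v\<^sup>2) * cos (x\<^sup>2) + cos (v\<^sup>2) * sin (x\<^sup>2))"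
      unfolding fresnel_cos_def fresnel_sin_def
      by (subst integral_add) (auto intro!: integrable_on_mult_left int)
    also have "\<dots> = integral {0..x} (\<lambda>v. sin (v\<^sup>2 + x\<^sup>2))" by (simp add: sin_add)
    also have "\<dots> = x * integral {0..1} (\<lambda>s. sin ((x * s)\<^sup>2 + x\<^sup>2))"
      by (intro integral_rescale that continuous_intros)
    finally show ?thesis by (simp add: power_mult_distrib algebra_simps)
  qed
  have aux: "(fresnel_aux sin has_real_derivative 2 * x * integral {0..1} (\<lambda>s. cos (x\<^sup>2 * (1 + s\<^sup>2)))) (at x within S)"
    "((\<lambda>x. fresnel_aux cos x) has_real_derivative 2 * x * integral {0..1} (\<lambda>s. - sin (x\<^sup>2 * (1 + s\<^sup>2)))) (at x within S)" for x S
    by (rule has_field_derivative_at_within[OF fresnel_aux_has_derivative];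
        intro DERIV_sin DERIV_cos continuous_intros)+
  have zero: "fresnel_cos 0 = 0" "fresnel_sin 0 = 0" by (simp_all add: fresnel_cos_def fresnel_sin_def)
  have aux0: "fresnel_aux sin 0 = 0" by (simp add: fresnel_aux_def)
  have aux1: "fresnel_aux cos 0 = pi / 4"
  proof -
    have "((\<lambda>s. 1 / (1 + s\<^sup>2)) has_integral (arctan 1 - arctan 0)) {0..1}"
    proof (rule fundamental_theorem_of_calculus)
      show "(arctan has_vector_derivative 1 / (1 + s\<^sup>2)) (at s within {0..1})" for s
        unfolding has_real_derivative_iff_has_vector_derivative[symmetric]
        using has_field_derivative_at_within[OF DERIV_arctan[of s]] by (simp add: inverse_eq_divide)
    qed auto
    thus ?thesis by (simp add: fresnel_aux_def integral_unique arctan_one)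
  qed
  have "(fresnel_cos x)\<^sup>2 - (fresnel_sin x)\<^sup>2 - fresnel_aux sin x
      = (fresnel_cos 0)\<^sup>2 - (fresnel_sin 0)\<^sup>2 - fresnel_aux sin 0"
  proof -
    have "((\<lambda>x. (fresnel_cos x)\<^sup>2 - (fresnel_sin x)\<^sup>2 - fresnel_aux sin x) has_real_derivative 0) (at x within {0..})"
      if "x \<in> {0..}" for x
      using that 1[of x] by (auto intro!: derivative_eq_intros fresnel_has_derivative aux simp: algebra_simps)
    then obtain c where "\<forall>x\<in>{0..}. (fresnel_cos x)\<^sup>2 - (fresnel_sin x)\<^sup>2 - fresnel_aux sin x = c"
      using has_field_derivative_zero_constant[of "{0..}" "\<lambda>x. (fresnel_cos x)\<^sup>2 - (fresnel_sin x)\<^sup>2 - fresnel_aux sin x"] by auto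
    thus ?thesis using assms by simp
  qed
  thus "(fresnel_cos x)\<^sup>2 - (fresnel_sin x)\<^sup>2 = fresnel_aux sin x" by (simp add: zero aux0)
  have "2 * fresnel_cos x * fresnel_sin x + fresnel_aux cos x = 2 * fresnel_cos 0 * fresnel_sin 0 + fresnel_aux cos 0"
  proof -
    have "((\<lambda>x. 2 * fresnel_cos x * fresnel_sin x + fresnel_aux cos x) has_real_derivative 0) (at x within {0..})"
      if "x \<in> {0..}" for x
      using that 2[of x] by (auto intro!: derivative_eq_intros fresnel_has_derivative aux simp: algebra_simps)
    then obtain c where "\<forall>x\<in>{0..}. 2 * fresnel_cos x * fresnel_sin x + fresnel_aux cos x = c"
      using has_field_derivative_zero_constant[of "{0..}" "\<lambda>x. 2 * fresnel_cos x * fresnel_sin x + fresnel_aux cos x"] by auto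
    thus ?thesis using assms by simp
  qed
  thus "2 * fresnel_cos x * fresnel_sin x = pi / 4 - fresnel_aux cos x" by (simp add: zero aux1)
qed

lemma fresnel_aux_bound:
  assumes x: "x \<ge> 1"
    and F: "\<And>y. (F has_real_derivative f y) (at y)" and F1: "\<And>y. \<bar>F y\<bar> \<le> 1"
    and f1: "\<And>y. \<bar>f y\<bar> \<le> 1" and cont: "continuous_on UNIV f"
  shows "\<bar>fresnel_aux f x\<bar> \<le> 2 / x"
proof -
  \<comment> \<open>The phase \<open>x^2 * (1 + s^2)\<close> is stationary at \<open>s = 0\<close>.
    Up to \<open>1 / x\<close> the trivial bound \<open>\<delta>\<close> is used; beyond,
    integration by parts gives \<open>k \<delta> / x^2\<close>, which is at most
    \<open>\<delta>\<close> again.\<close>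
  define \<delta> where "\<delta> = 1 / x"
  have \<delta>: "0 < \<delta>" "\<delta> \<le> 1" using x by (auto simp: \<delta>_def)
  let ?g = "\<lambda>s. f (x\<^sup>2 * (1 + s\<^sup>2)) / (1 + s\<^sup>2)"
  have cg: "continuous_on S ?g" for S
    using one_plus_square_pos
    by (intro continuous_intros continuous_on_compose2[OF cont]) (auto simp: less_imp_neq[symmetric])
  have split: "integral {0..1} ?g = integral {0..\<delta>} ?g + integral {\<delta>..1} ?g"
    using \<delta> by (intro Henstock_Kurzweil_Integration.integral_combine[symmetric] integrable_continuous_real cg) auto
  have "norm (integral {0..\<delta>} ?g) \<le> integral {0..\<delta>} (\<lambda>_. 1)"
  proof (rule Henstock_Kurzweil_Integration.integral_norm_bound_integral)
    show "norm (?g s) \<le> 1" for s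
    proof -
      have "norm (?g s) \<le> 1 / (1 + s\<^sup>2)"
        using f1[of "x\<^sup>2 * (1 + s\<^sup>2)"] one_plus_square_pos[of s] by (simp add: divide_right_mono)
      also have "\<dots> \<le> 1" by (simp add: divide_simps one_plus_square_pos)
      finally show ?thesis .
    qed
  qed (intro integrable_continuous_real cg continuous_intros)+
  hence A: "\<bar>integral {0..\<delta>} ?g\<bar> \<le> \<delta>" using \<delta> by simp
  define u where "u s = F (x\<^sup>2 * (1 + s\<^sup>2)) / (2 * x\<^sup>2)" for s
  \<comment> \<open>The factor \<open>s\<close> is the derivative of the phase up to
    \<open>2 * x^2\<close>, so \<open>k\<close> takes over \<open>1 / s\<close>. As \<open>k\<close>
    decreases, its total variation is \<open>k \<delta> - k 1\<close>.\<close>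
  define u' where "u' s = f (x\<^sup>2 * (1 + s\<^sup>2)) * s" for s
  define k where "k s = 1 / (s * (1 + s\<^sup>2))" for s :: real
  define k' where "k' s = (- 1 - 3 * s\<^sup>2) / (s * (1 + s\<^sup>2))\<^sup>2" for s :: real
  have k0: "k' s \<le> 0" for s
    unfolding k'_def using zero_le_power2[of s] by (intro divide_nonpos_nonneg) (linarith, simp)
  have nz: "s * (1 + s\<^sup>2) \<noteq> 0" if "s > 0" for s :: real
    using that one_plus_square_pos[of s] by auto
  have Dk: "(k has_real_derivative k' s) (at s)" if "s > 0" for s
  proof -
    have "((\<lambda>s. s * (1 + s\<^sup>2)) has_real_derivative 1 + 3 * s\<^sup>2) (at s)"
      by (auto intro!: derivative_eq_intros simp: power2_eq_square algebra_simps)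
    from DERIV_divide[OF DERIV_const[of 1] this nz[OF that]] show ?thesis
      by (simp add: k_def[abs_def] k'_def power2_eq_square)
  qed
  have ck': "continuous_on {\<delta>..1} k'"
    unfolding k'_def using \<delta> nz by (intro continuous_intros) force
  have hi: "((\<lambda>s. - k' s) has_integral (- k 1 - - k \<delta>)) {\<delta>..1}"
  proof (rule fundamental_theorem_of_calculus)
    show "((\<lambda>s. - k s) has_vector_derivative - k' s) (at s within {\<delta>..1})" if "s \<in> {\<delta>..1}" for s
      unfolding has_real_derivative_iff_has_vector_derivative[symmetric]
      using that \<delta> by (intro has_field_derivative_at_within[OF DERIV_minus[OF Dk]]) auto
  qed (use \<delta> in auto)
  have "(\<lambda>s. \<bar>k' s\<bar>) = (\<lambda>s. - k' s)" using k0 by (auto simp: abs_of_nonpos)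
  hence V: "integral {\<delta>..1} (\<lambda>s. \<bar>k' s\<bar>) = k \<delta> - k 1"
    using integral_unique[OF hi] by simp
  have "\<bar>integral {\<delta>..1} (\<lambda>s. u' s * k s)\<bar> \<le> 1 / (2 * x\<^sup>2) * (\<bar>k \<delta>\<bar> + \<bar>k 1\<bar> + (k \<delta> - k 1))"
  proof (rule oscillatory_integral_bound)
    show "(u has_real_derivative u' s) (at s)" for s
      unfolding u_def[abs_def] u'_def using x
      by (auto intro!: derivative_eq_intros DERIV_chain2[OF F])
    show "(k has_real_derivative k' s) (at s)" if "s \<in> {\<delta>..1}" for s
      using that \<delta> by (intro Dk) auto
    show "continuous_on {\<delta>..1} u'"
      unfolding u'_def by (intro continuous_intros continuous_on_compose2[OF cont]) auto
    show "\<bar>u s\<bar> \<le> 1 / (2 * x\<^sup>2)" for s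
      using F1[of "x\<^sup>2 * (1 + s\<^sup>2)"] x by (simp add: u_def divide_right_mono)
  qed (use \<delta> ck' V in auto)
  also have "\<dots> = k \<delta> / x\<^sup>2" using \<delta> by (simp add: k_def)
  also have "\<dots> \<le> \<delta>"
  proof -
    have "k \<delta> \<le> 1 / \<delta>" using \<delta> one_plus_square_pos[of \<delta>] unfolding k_def
      by (intro divide_left_mono mult_pos_pos) (auto simp: mult_le_cancel_left1)
    hence "k \<delta> / x\<^sup>2 \<le> (1 / \<delta>) / x\<^sup>2" by (intro divide_right_mono) auto
    also have "\<dots> = \<delta>" using x by (simp add: \<delta>_def power2_eq_square)
    finally show ?thesis .
  qed
  also have "integral {\<delta>..1} (\<lambda>s. u' s * k s) = integral {\<delta>..1} ?g"
    using \<delta> by (intro integral_cong) (auto simp: u'_def k_def)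
  finally have "\<bar>fresnel_aux f x\<bar> \<le> \<delta> + \<delta>" using A split by (simp add: fresnel_aux_def)
  thus ?thesis by (simp add: \<delta>_def)
qed

lemma fresnel_aux_tendsto_0: "(fresnel_aux sin \<longlongrightarrow> 0) at_top" "(fresnel_aux cos \<longlongrightarrow> 0) at_top"
proof -
  have lim: "((\<lambda>x::real. 2 / x) \<longlongrightarrow> 0) at_top" by real_asymp
  have "\<forall>\<^sub>F x in at_top. norm (fresnel_aux sin x) \<le> 2 / x"
    using eventually_ge_at_top[of 1]
  proof eventually_elim
    case (elim x)
    show ?case unfolding real_norm_def
      by (rule fresnel_aux_bound[OF elim, of "\<lambda>y. - cos y"]) (auto intro!: derivative_eq_intros continuous_intros)
  qed
  thus "(fresnel_aux sin \<longlongrightarrow> 0) at_top" by (rule Lim_null_comparison[OF _ lim])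
  have "\<forall>\<^sub>F x in at_top. norm (fresnel_aux cos x) \<le> 2 / x"
    using eventually_ge_at_top[of 1]
  proof eventually_elim
    case (elim x)
    show ?case unfolding real_norm_def
      by (rule fresnel_aux_bound[OF elim, of sin]) (auto intro!: derivative_eq_intros continuous_intros)
  qed
  thus "(fresnel_aux cos \<longlongrightarrow> 0) at_top" by (rule Lim_null_comparison[OF _ lim])
qed

text \<open>These are \<open>J\<^sub>0\<close> and \<open>J\<^sub>0' = - J\<^sub>1\<close>; note the sign.\<close>

definition bessel_j0 :: "real \<Rightarrow> real" where
  "bessel_j0 z = bessel (z\<^sup>2 / 4)"

definition bessel_j1 :: "real \<Rightarrow> real" where
  "bessel_j1 z = z / 2 * bessel' (z\<^sup>2 / 4)"

lemma bessel_j0_has_derivative: "(bessel_j0 has_real_derivative bessel_j1 z) (at z)"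
  unfolding bessel_j0_def[abs_def] bessel_j1_def by (auto intro!: derivative_eq_intros)

lemma bessel_j1_has_derivative:
  assumes "z \<noteq> 0"
  shows "(bessel_j1 has_real_derivative - bessel_j0 z - bessel_j1 z / z) (at z)"
proof -
  have "(bessel_j1 has_real_derivative bessel' (z\<^sup>2 / 4) / 2 + z\<^sup>2 / 4 * bessel'' (z\<^sup>2 / 4)) (at z)"
    unfolding bessel_j1_def[abs_def]
    by (auto intro!: derivative_eq_intros simp: power2_eq_square)
  also have "z\<^sup>2 / 4 * bessel'' (z\<^sup>2 / 4) = - bessel' (z\<^sup>2 / 4) - bessel (z\<^sup>2 / 4)"
    using bessel_ode[of "z\<^sup>2 / 4"] by linarith
  also have "bessel' (z\<^sup>2 / 4) / 2 + (- bessel' (z\<^sup>2 / 4) - bessel (z\<^sup>2 / 4)) = - bessel_j0 z - bessel_j1 z / z"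
    using assms by (simp add: bessel_j0_def bessel_j1_def)
  finally show ?thesis .
qed

section \<open>Stationary phase for J0\<close>

lemma sqrt2_times_sin_pi_4: "sqrt 2 * sin (pi / 4) = 1"
  by (simp add: sin_45)

text \<open>The substitution \<open>y = sqrt (2 * z) * sin (pi / 4 - t / 2)\<close> makes the phase
  exactly quadratic, \<open>z * sin t = z - y^2\<close>, and the amplitude
  \<open>cos (pi / 4 - t / 2)\<close> is its Jacobian up to a constant; hence an identity without
  error term.\<close>

lemma bessel_j0_main_integral:
  assumes z: "z > 0"
  shows "integral {0..pi / 2} (\<lambda>t. cos (z * sin t) * cos (pi / 4 - t / 2))
      = sqrt 2 / sqrt z * (cos z * fresnel_cos (sqrt z) + sin z * fresnel_sin (sqrt z))"
proof -
  define y where "y t = sqrt z * sqrt 2 * sin (pi / 4 - t / 2)" for t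
  have y0: "y 0 = sqrt z" using sqrt2_times_sin_pi_4 by (simp add: y_def mult.assoc)
  have y1: "y (pi / 2) = 0" by (simp add: y_def)
  have ypos: "y t \<ge> 0" if "t \<in> {0..pi / 2}" for t
    unfolding y_def using that z by (intro mult_nonneg_nonneg sin_ge_zero) auto
  have ysq: "(y t)\<^sup>2 = z - z * sin t" for t
  proof -
    have "sin t = cos (2 * (pi / 4 - t / 2))" by (simp add: cos_sin_eq algebra_simps)
    also have "\<dots> = 1 - 2 * (sin (pi / 4 - t / 2))\<^sup>2" by (rule cos_double_sin)
    finally have *: "sin t = 1 - 2 * (sin (pi / 4 - t / 2))\<^sup>2" .
    show ?thesis unfolding * using z by (simp add: y_def power_mult_distrib algebra_simps)
  qed
  define y' where "y' t = - (sqrt z * sqrt 2 * cos (pi / 4 - t / 2) / 2)" for t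
  have dy: "(y has_real_derivative y' t) (at t within S)" for t S
    unfolding y_def[abs_def] y'_def by (auto intro!: derivative_eq_intros)
  have sub: "y ` {0..pi/2} \<subseteq> {0..}" using ypos by auto
  define K where "K t = - (sqrt 2 / sqrt z) * (cos z * fresnel_cos (y t) + sin z * fresnel_sin (y t))" for t
  have "((\<lambda>t. cos (z * sin t) * cos (pi / 4 - t / 2)) has_integral K (pi / 2) - K 0) {0..pi / 2}"
  proof (rule fundamental_theorem_of_calculus)
    fix t assume t: "t \<in> {0..pi / 2}"
    have d1: "((\<lambda>t. fresnel_cos (y t)) has_real_derivative cos ((y t)\<^sup>2) * y' t) (at t within {0..pi/2})"
      using DERIV_image_chain[OF DERIV_subset[OF fresnel_has_derivative(1)[OF ypos[OF t]] sub] dy] by (simp add: o_def)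
    have d2: "((\<lambda>t. fresnel_sin (y t)) has_real_derivative sin ((y t)\<^sup>2) * y' t) (at t within {0..pi/2})"
      using DERIV_image_chain[OF DERIV_subset[OF fresnel_has_derivative(2)[OF ypos[OF t]] sub] dy] by (simp add: o_def)
    have "(K has_real_derivative - (sqrt 2 / sqrt z) * (cos z * (cos ((y t)\<^sup>2) * y' t) + sin z * (sin ((y t)\<^sup>2) * y' t)))
        (at t within {0..pi/2})"
      unfolding K_def[abs_def] by (intro DERIV_cmult DERIV_add d1 d2)
    also have "- (sqrt 2 / sqrt z) * (cos z * (cos ((y t)\<^sup>2) * y' t) + sin z * (sin ((y t)\<^sup>2) * y' t))
        = - (sqrt 2 / sqrt z * y' t) * (cos z * cos ((y t)\<^sup>2) + sin z * sin ((y t)\<^sup>2))"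
      by (simp add: algebra_simps)
    also have "- (sqrt 2 / sqrt z * y' t) = cos (pi / 4 - t / 2)"
      using z by (simp add: y'_def)
    also have "cos z * cos ((y t)\<^sup>2) + sin z * sin ((y t)\<^sup>2) = cos (z * sin t)"
      unfolding cos_diff[symmetric] ysq by simp
    finally show "(K has_vector_derivative cos (z * sin t) * cos (pi / 4 - t / 2)) (at t within {0..pi/2})"
      by (simp add: has_real_derivative_iff_has_vector_derivative mult.commute)
  qed simp
  thus ?thesis by (simp add: integral_unique K_def y0 y1 fresnel_cos_def[of 0] fresnel_sin_def[of 0])
qed

text \<open>The remaining amplitude \<open>1 - cos (pi / 4 - t / 2)\<close> vanishes at the
  stationary point \<open>t = pi / 2\<close>, so it can be divided by the phase derivative
  \<open>cos t\<close>, and one integration by parts gains \<open>1 / z\<close>.\<close>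

lemma bessel_j0_fresnel:
  obtains C where "\<And>z. z > 0 \<Longrightarrow>
    \<bar>pi / 2 * bessel_j0 z - sqrt 2 / sqrt z * (cos z * fresnel_cos (sqrt z) + sin z * fresnel_sin (sqrt z))\<bar> \<le> C / z"
proof -
  \<comment> \<open>With \<open>s = pi / 8 - t / 4\<close> one has
    \<open>cos t = sin (4 * s)\<close>, and the amplitude is \<open>2 * (sin s)^2\<close>; this is
    their quotient after cancelling \<open>sin s\<close>, so it is smooth at
    \<open>t = pi / 2\<close>.\<close>
  define \<rho> where "\<rho> t = tan (pi / 8 - t / 4) / (2 * cos (pi / 4 - t / 2))" for t :: real
  define \<rho>' where "\<rho>' t = ((- 1 / 4) / (cos (pi / 8 - t / 4))\<^sup>2 * (2 * cos (pi / 4 - t / 2))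
      - tan (pi / 8 - t / 4) * sin (pi / 4 - t / 2)) / (2 * cos (pi / 4 - t / 2))\<^sup>2" for t :: real
  have c1: "cos (pi / 8 - t / 4) > 0" and c2: "cos (pi / 4 - t / 2) > 0" if "t \<in> {0..pi / 2}" for t
  proof -
    have "0 \<le> t" "t \<le> pi / 2" using that by auto
    thus "cos (pi / 8 - t / 4) > 0" "cos (pi / 4 - t / 2) > 0"
      using pi_gt_zero by (intro cos_gt_zero_pi; linarith)+
  qed
  have d\<rho>: "(\<rho> has_real_derivative \<rho>' t) (at t)" if "t \<in> {0..pi / 2}" for t
  proof -
    have "((\<lambda>t. tan (pi / 8 - t / 4)) has_real_derivative (- 1 / 4) / (cos (pi / 8 - t / 4))\<^sup>2) (at t)"
      using c1[OF that] by (auto intro!: derivative_eq_intros simp: field_simps)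
    moreover have "((\<lambda>t. 2 * cos (pi / 4 - t / 2)) has_real_derivative sin (pi / 4 - t / 2)) (at t)"
      by (auto intro!: derivative_eq_intros)
    ultimately show ?thesis
      unfolding \<rho>_def[abs_def] \<rho>'_def power2_eq_square[of "2 * cos (pi / 4 - t / 2)"]
      using c2[OF that] by (intro DERIV_divide) auto
  qed
  have c\<rho>': "continuous_on {0..pi / 2} \<rho>'"
    unfolding \<rho>'_def using c1 c2 by (intro continuous_intros) (auto simp: less_imp_neq[symmetric])
  have \<rho>: "cos t * \<rho> t = 1 - cos (pi / 4 - t / 2)" if "t \<in> {0..pi / 2}" for t
  proof -
    define s where "s = pi / 8 - t / 4"
    have s2: "pi / 4 - t / 2 = 2 * s" by (simp add: s_def)
    have "cos t = sin (2 * (2 * s))" by (simp add: s_def sin_cos_eq algebra_simps)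
    also have "\<dots> = 2 * sin (2 * s) * cos (2 * s)" by (rule sin_double)
    finally have "cos t * \<rho> t = tan s * sin (2 * s)"
      using c2[OF that] unfolding \<rho>_def s2 s_def[symmetric] by simp
    also have "\<dots> = 2 * (sin s)\<^sup>2"
      using c1[OF that] unfolding s_def[symmetric] tan_def sin_double by (simp add: power2_eq_square)
    finally show ?thesis unfolding s2 cos_double_sin by simp
  qed
  define V where "V = integral {0..pi / 2} (\<lambda>t. \<bar>\<rho>' t\<bar>)"
  show thesis
  proof (rule that)
    fix z :: real assume z: "z > 0"
    have "\<bar>integral {0..pi / 2} (\<lambda>t. (cos (z * sin t) * cos t) * \<rho> t)\<bar>
        \<le> 1 / z * (\<bar>\<rho> 0\<bar> + \<bar>\<rho> (pi / 2)\<bar> + V)"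
    proof (rule oscillatory_integral_bound)
      show "((\<lambda>t. sin (z * sin t) / z) has_real_derivative cos (z * sin t) * cos t) (at t)" for t
        using z by (auto intro!: derivative_eq_intros)
      show "\<bar>sin (z * sin t) / z\<bar> \<le> 1 / z" for t
        using z abs_sin_le_one[of "z * sin t"] by (simp add: divide_right_mono)
    qed (use d\<rho> c\<rho>' in \<open>auto intro!: continuous_intros simp: V_def\<close>)
    also have "integral {0..pi / 2} (\<lambda>t. (cos (z * sin t) * cos t) * \<rho> t)
        = integral {0..pi / 2} (\<lambda>t. cos (z * sin t) - cos (z * sin t) * cos (pi / 4 - t / 2))"
      by (intro integral_cong) (simp add: \<rho> mult.assoc right_diff_distrib)
    also have "\<dots> = integral {0..pi / 2} (\<lambda>t. cos (z * sin t))
        - integral {0..pi / 2} (\<lambda>t. cos (z * sin t) * cos (pi / 4 - t / 2))"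
      by (intro Henstock_Kurzweil_Integration.integral_diff integrable_continuous_real)
         (auto intro!: continuous_intros)
    also have "integral {0..pi / 2} (\<lambda>t. cos (z * sin t)) = pi / 2 * bessel_j0 z"
      by (simp add: bessel_j0_def bessel_eq_mean_cos)
    finally show "\<bar>pi / 2 * bessel_j0 z - sqrt 2 / sqrt z * (cos z * fresnel_cos (sqrt z) + sin z * fresnel_sin (sqrt z))\<bar>
        \<le> (\<bar>\<rho> 0\<bar> + \<bar>\<rho> (pi / 2)\<bar> + V) / z"
      unfolding bessel_j0_main_integral[OF z] by simp
  qed
qed

lemma tendsto_0_mult_bounded:
  fixes f g :: "real \<Rightarrow> real"
  assumes "(f \<longlongrightarrow> 0) F" "\<forall>\<^sub>F z in F. \<bar>g z\<bar> \<le> K"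
  shows "((\<lambda>z. f z * g z) \<longlongrightarrow> 0) F"
proof (rule Lim_null_comparison)
  show "\<forall>\<^sub>F z in F. norm (f z * g z) \<le> K * \<bar>f z\<bar>"
    using assms(2)
  proof eventually_elim
    case (elim z)
    have "norm (f z * g z) = \<bar>g z\<bar> * \<bar>f z\<bar>" by (simp add: abs_mult)
    also have "\<dots> \<le> K * \<bar>f z\<bar>" by (intro mult_right_mono elim) auto
    finally show ?case .
  qed
  show "((\<lambda>z. K * \<bar>f z\<bar>) \<longlongrightarrow> 0) F"
    using tendsto_mult[OF tendsto_const[of K] tendsto_rabs[OF assms(1)]] by simp
qed

text \<open>The square of the main term is a combination of \<open>P\<close>, \<open>Q\<close> and
  \<open>R\<close> in the double angle. Since \<open>R = sqrt (P^2 + Q^2)\<close>, the limits 0 of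
  \<open>P\<close> and \<open>pi / 4\<close> of \<open>Q\<close> determine that of \<open>R\<close>,
  without separating the two Fresnel integrals.\<close>

lemma bessel_j0_square_limit:
  "((\<lambda>z. z * (bessel_j0 z)\<^sup>2 - (1 + sin (2 * z)) / pi) \<longlongrightarrow> 0) at_top"
proof -
  define c where "c z = fresnel_cos (sqrt z)" for z
  define s where "s z = fresnel_sin (sqrt z)" for z
  define P where "P z = (c z)\<^sup>2 - (s z)\<^sup>2" for z
  define Q where "Q z = 2 * c z * s z" for z
  define R where "R z = (c z)\<^sup>2 + (s z)\<^sup>2" for z
  have sq: "filterlim sqrt at_top (at_top :: real filter)" by real_asymp
  have P: "(P \<longlongrightarrow> 0) at_top"
  proof (rule Lim_transform_eventually)
    show "((\<lambda>z. fresnel_aux sin (sqrt z)) \<longlongrightarrow> 0) at_top"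
      by (rule filterlim_compose[OF fresnel_aux_tendsto_0(1) sq])
    show "\<forall>\<^sub>F z in at_top. fresnel_aux sin (sqrt z) = P z"
      using eventually_ge_at_top[of 0] by eventually_elim (simp add: P_def c_def s_def fresnel_squares)
  qed
  have Q: "(Q \<longlongrightarrow> pi / 4) at_top"
  proof (rule Lim_transform_eventually)
    have "((\<lambda>z. pi / 4 - fresnel_aux cos (sqrt z)) \<longlongrightarrow> pi / 4 - 0) at_top"
      by (intro tendsto_diff tendsto_const filterlim_compose[OF fresnel_aux_tendsto_0(2) sq])
    thus "((\<lambda>z. pi / 4 - fresnel_aux cos (sqrt z)) \<longlongrightarrow> pi / 4) at_top" by simp
    show "\<forall>\<^sub>F z in at_top. pi / 4 - fresnel_aux cos (sqrt z) = Q z"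
      using eventually_ge_at_top[of 0] by eventually_elim (simp add: Q_def c_def s_def fresnel_squares)
  qed
  have Req: "R = (\<lambda>z. sqrt ((P z)\<^sup>2 + (Q z)\<^sup>2))"
    by (rule ext, rule real_sqrt_unique[symmetric]) (simp_all add: R_def P_def Q_def power2_eq_square algebra_simps)
  have "((\<lambda>z. sqrt ((P z)\<^sup>2 + (Q z)\<^sup>2)) \<longlongrightarrow> sqrt (0\<^sup>2 + (pi / 4)\<^sup>2)) at_top"
    by (intro tendsto_intros P Q)
  hence R: "(R \<longlongrightarrow> pi / 4) at_top" unfolding Req by simp
  define Y where "Y z = sqrt 2 * (cos z * c z + sin z * s z)" for z
  define X where "X z = sqrt z * (pi / 2 * bessel_j0 z)" for z
  have Y2: "(Y z)\<^sup>2 = R z + P z * cos (2 * z) + Q z * sin (2 * z)" for z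
  proof -
    have "(Y z)\<^sup>2 = 2 * ((cos z * c z + sin z * s z)\<^sup>2)" by (simp add: Y_def power_mult_distrib)
    also have "2 * ((C * c + S * s)\<^sup>2) = (C\<^sup>2 + S\<^sup>2) * (c\<^sup>2 + s\<^sup>2) + (c\<^sup>2 - s\<^sup>2) * (C\<^sup>2 - S\<^sup>2) + 2 * c * s * (2 * S * C)"
      for C S c s :: real by (simp add: power2_eq_square algebra_simps)
    also have "((cos z)\<^sup>2 + (sin z)\<^sup>2) * ((c z)\<^sup>2 + (s z)\<^sup>2) + ((c z)\<^sup>2 - (s z)\<^sup>2) * ((cos z)\<^sup>2 - (sin z)\<^sup>2)
        + 2 * c z * s z * (2 * sin z * cos z) = R z + P z * cos (2 * z) + Q z * sin (2 * z)"
      unfolding R_def P_def Q_def cos_double sin_double by simp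
    finally show ?thesis .
  qed
  have Ylim: "((\<lambda>z. (Y z)\<^sup>2 - pi / 4 * (1 + sin (2 * z))) \<longlongrightarrow> 0) at_top"
  proof -
    have "((\<lambda>z. (R z - pi / 4) + P z * cos (2 * z) + (Q z - pi / 4) * sin (2 * z)) \<longlongrightarrow> 0 + 0 + 0) at_top"
      using R Q by (intro tendsto_add tendsto_0_mult_bounded[OF P, of _ 1] tendsto_0_mult_bounded[of _ _ _ 1])
        (auto intro: LIM_zero)
    thus ?thesis by (simp add: Y2 algebra_simps)
  qed
  have "\<forall>\<^sub>F z in at_top. \<bar>(Y z)\<^sup>2 - pi / 4 * (1 + sin (2 * z))\<bar> < 1"
    using tendstoD[OF Ylim, of 1] by simp
  hence Ybd: "\<forall>\<^sub>F z in at_top. \<bar>Y z\<bar> \<le> 3"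
  proof eventually_elim
    case (elim z)
    have "0 \<le> 1 + sin (2 * z)" using sin_ge_minus_one[of "2 * z"] by linarith
    hence "pi / 4 * (1 + sin (2 * z)) \<le> 1 * 2"
      using pi_less_4 sin_le_one[of "2 * z"] by (intro mult_mono) auto
    hence "(Y z)\<^sup>2 \<le> 3\<^sup>2" using elim by simp
    thus ?case using abs_le_square_iff[of "Y z" 3] by simp
  qed
  obtain C where C: "\<And>z. z > 0 \<Longrightarrow>
    \<bar>pi / 2 * bessel_j0 z - sqrt 2 / sqrt z * (cos z * fresnel_cos (sqrt z) + sin z * fresnel_sin (sqrt z))\<bar> \<le> C / z"
    using bessel_j0_fresnel by blast
  have XY: "((\<lambda>z. X z - Y z) \<longlongrightarrow> 0) at_top"
  proof (rule Lim_null_comparison)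
    show "\<forall>\<^sub>F z in at_top. norm (X z - Y z) \<le> C / sqrt z"
      using eventually_gt_at_top[of 0]
    proof eventually_elim
      case (elim z)
      have "X z - Y z = sqrt z * (pi / 2 * bessel_j0 z - sqrt 2 / sqrt z * (cos z * c z + sin z * s z))"
        using elim by (simp add: X_def Y_def right_diff_distrib)
      hence "\<bar>X z - Y z\<bar> = sqrt z * \<bar>pi / 2 * bessel_j0 z - sqrt 2 / sqrt z * (cos z * c z + sin z * s z)\<bar>"
        using elim by (simp add: abs_mult)
      also have "\<dots> \<le> sqrt z * (C / z)"
        using C[OF elim] elim unfolding c_def s_def by (intro mult_left_mono) auto
      also have "\<dots> = C / sqrt z" using elim by (simp add: field_simps)
      finally show ?case by simp
    qed
    show "((\<lambda>z. C / sqrt z) \<longlongrightarrow> 0) at_top" by real_asymp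
  qed
  have "((\<lambda>z. (X z - Y z) * (X z - Y z) + (X z - Y z) * (2 * Y z)
          + ((Y z)\<^sup>2 - pi / 4 * (1 + sin (2 * z)))) \<longlongrightarrow> 0 * 0 + 0 + 0) at_top"
  proof (intro tendsto_add tendsto_mult XY Ylim tendsto_0_mult_bounded[OF XY, of _ 6])
    show "\<forall>\<^sub>F z in at_top. \<bar>2 * Y z\<bar> \<le> 6" using Ybd by eventually_elim simp
  qed
  hence "((\<lambda>z. (X z)\<^sup>2 - pi / 4 * (1 + sin (2 * z))) \<longlongrightarrow> 0) at_top"
    by (simp add: power2_eq_square algebra_simps)
  hence lim: "((\<lambda>z. 4 / pi\<^sup>2 * ((X z)\<^sup>2 - pi / 4 * (1 + sin (2 * z)))) \<longlongrightarrow> 4 / pi\<^sup>2 * 0) at_top"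
    by (intro tendsto_mult tendsto_const)
  show ?thesis
  proof (rule Lim_transform_eventually)
    show "((\<lambda>z. 4 / pi\<^sup>2 * ((X z)\<^sup>2 - pi / 4 * (1 + sin (2 * z)))) \<longlongrightarrow> 0) at_top" using lim by simp
    show "\<forall>\<^sub>F z in at_top. 4 / pi\<^sup>2 * ((X z)\<^sup>2 - pi / 4 * (1 + sin (2 * z)))
        = z * (bessel_j0 z)\<^sup>2 - (1 + sin (2 * z)) / pi"
      using eventually_ge_at_top[of 0]
    proof eventually_elim
      case (elim z)
      have X2: "(X z)\<^sup>2 = pi\<^sup>2 / 4 * (z * (bessel_j0 z)\<^sup>2)"
        using elim by (simp add: X_def power_mult_distrib power_divide)
      show ?case unfolding X2 by (simp add: field_simps power2_eq_square)
    qed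
  qed
qed

section \<open>Bessel asymptotics\<close>

lemma square_diff_bound:
  fixes a b :: real
  assumes "\<bar>a - b\<bar> \<le> c / z" "\<bar>b\<bar> \<le> K" "z \<ge> 1"
  shows "\<bar>a\<^sup>2 - b\<^sup>2\<bar> \<le> c * (c + 2 * K) / z"
proof -
  have "0 \<le> c / z" using assms(1) by linarith
  hence c: "c \<ge> 0" using assms(3) by (simp add: zero_le_divide_iff)
  have "a + b = (a - b) + 2 * b" by simp
  hence "\<bar>a + b\<bar> \<le> c / z + 2 * K" using assms(1,2) by linarith
  also have "c / z \<le> c" using c assms(3) by (simp add: divide_le_eq mult_le_cancel_left1)
  finally have "\<bar>a + b\<bar> \<le> c + 2 * K" by simp
  moreover have "\<bar>a\<^sup>2 - b\<^sup>2\<bar> = \<bar>a - b\<bar> * \<bar>a + b\<bar>"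
    unfolding abs_mult[symmetric] by (simp add: power2_eq_square algebra_simps)
  moreover have "\<bar>a - b\<bar> * \<bar>a + b\<bar> \<le> c / z * (c + 2 * K)"
    using assms(1) calculation(1) by (intro mult_mono') auto
  ultimately show ?thesis by simp
qed

text \<open>A periodic function repeats each of its values along a sequence tending to
  infinity.\<close>

lemma periodic_tendsto_0:
  fixes T :: "real \<Rightarrow> real"
  assumes "(T \<longlongrightarrow> 0) at_top" "\<And>x. T (x + p) = T x" "p > 0"
  shows "T x = 0"
proof -
  have "T (x + real n * p) = T x" for n
  proof (induction n)
    case (Suc n)
    have "T (x + real (Suc n) * p) = T ((x + real n * p) + p)" by (simp add: algebra_simps)
    thus ?case using assms(2) Suc by simp
  qed simp
  moreover have "filterlim (\<lambda>n. x + real n * p) at_top sequentially"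
    using assms(3) by real_asymp
  hence "(\<lambda>n. T (x + real n * p)) \<longlonglongrightarrow> 0" by (rule filterlim_compose[OF assms(1)])
  ultimately show ?thesis by (simp add: LIMSEQ_const_iff)
qed

text \<open>The function \<open>v z = sqrt z * J\<^sub>0(z)\<close> satisfies \<open>v'' = - (1 + 1 / (4 z\<^sup>2)) v\<close>, so that
  \<open>v cos - v' sin\<close> and \<open>v sin + v' cos\<close> converge at rate \<open>1 / z\<close>; the limits are then read off
  from the limit of \<open>v\<^sup>2\<close>.\<close>

lemma bessel_j_asymptotics:
  obtains C where
    "\<And>z. z \<ge> 1 \<Longrightarrow> \<bar>z * (bessel_j0 z)\<^sup>2 - (1 + sin (2 * z)) / pi\<bar> \<le> C / z"
    "\<And>z. z \<ge> 1 \<Longrightarrow> \<bar>z * (bessel_j1 z)\<^sup>2 - (1 - sin (2 * z)) / pi\<bar> \<le> C / z"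
proof -
  define v where "v z = sqrt z * bessel_j0 z" for z
  define w where "w z = sqrt z * bessel_j1 z + bessel_j0 z / (2 * sqrt z)" for z
  have v': "(v has_real_derivative w z) (at z)" if "z \<ge> 1" for z
    unfolding v_def[abs_def] w_def using that
    by (auto intro!: derivative_eq_intros bessel_j0_has_derivative simp: field_simps)
  have w': "(w has_real_derivative - v z - v z / (4 * z\<^sup>2)) (at z)" if z: "z \<ge> 1" for z
  proof -
    define r where "r = sqrt z"
    have r: "r > 0" "r\<^sup>2 = z" using z by (auto simp: r_def)
    have "((\<lambda>z. bessel_j0 z / (2 * sqrt z)) has_real_derivative
        (bessel_j1 z * (2 * r) - bessel_j0 z * (1 / r)) / ((2 * r) * (2 * r))) (at z)"
    proof -
      have "((\<lambda>z. 2 * sqrt z) has_real_derivative 1 / r) (at z)"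
        using z by (auto intro!: derivative_eq_intros simp: r_def field_simps)
      thus ?thesis unfolding r_def using z by (intro DERIV_divide bessel_j0_has_derivative) auto
    qed
    moreover have "((\<lambda>z. sqrt z * bessel_j1 z) has_real_derivative
        1 / (2 * r) * bessel_j1 z + (- bessel_j0 z - bessel_j1 z / z) * r) (at z)"
    proof -
      have "(sqrt has_real_derivative 1 / (2 * r)) (at z)"
        using z DERIV_real_sqrt[of z] by (simp add: r_def field_simps)
      thus ?thesis unfolding r_def using z by (intro DERIV_mult bessel_j1_has_derivative) auto
    qed
    ultimately have "(w has_real_derivative
        (1 / (2 * r) * bessel_j1 z + (- bessel_j0 z - bessel_j1 z / z) * r)
        + (bessel_j1 z * (2 * r) - bessel_j0 z * (1 / r)) / ((2 * r) * (2 * r))) (at z)"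
      unfolding w_def[abs_def] by (intro DERIV_add)
    also have "(1 / (2 * r) * bessel_j1 z + (- bessel_j0 z - bessel_j1 z / z) * r)
        + (bessel_j1 z * (2 * r) - bessel_j0 z * (1 / r)) / ((2 * r) * (2 * r)) = - v z - v z / (4 * z\<^sup>2)"
      unfolding v_def r_def[symmetric] r(2)[symmetric] using r(1)
      by (simp add: field_simps power2_eq_square)
    finally show ?thesis .
  qed
  \<comment> \<open>The weight \<open>exp (1 / (4 * z))\<close> turns the derivative of the energy
    into minus a square, so the energy, and with it \<open>v\<close>, stays bounded.\<close>
  define e where "e z = (v z)\<^sup>2 + (w z)\<^sup>2" for z
  define B where "B = e 1 * exp (1 / 4)"
  have eB: "e z \<le> B" if z: "z \<ge> 1" for z
  proof -
    have "e z * exp (1 / (4 * z)) \<le> e 1 * exp (1 / (4 * 1))"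
    proof (rule DERIV_nonpos_imp_nonincreasing[OF z])
      fix x :: real assume "1 \<le> x" "x \<le> z"
      have "(e has_real_derivative - (v x * w x) / (2 * x\<^sup>2)) (at x)"
        unfolding e_def[abs_def] using \<open>1 \<le> x\<close>
        by (auto intro!: derivative_eq_intros v' w' simp: field_simps)
      moreover have "((\<lambda>x. exp (1 / (4 * x))) has_real_derivative exp (1 / (4 * x)) * (- 1 / (4 * x\<^sup>2))) (at x)"
        using \<open>1 \<le> x\<close> by (auto intro!: derivative_eq_intros simp: power2_eq_square field_simps)
      ultimately have "((\<lambda>x. e x * exp (1 / (4 * x))) has_real_derivative
          - (v x * w x) / (2 * x\<^sup>2) * exp (1 / (4 * x)) + exp (1 / (4 * x)) * (- 1 / (4 * x\<^sup>2)) * e x) (at x)"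
        by (rule DERIV_mult)
      also have "- (v x * w x) / (2 * x\<^sup>2) * exp (1 / (4 * x)) + exp (1 / (4 * x)) * (- 1 / (4 * x\<^sup>2)) * e x
          = - (exp (1 / (4 * x)) * (v x + w x)\<^sup>2 / (4 * x\<^sup>2))"
        using \<open>1 \<le> x\<close> by (simp add: e_def power2_eq_square field_simps)
      finally show "\<exists>y. ((\<lambda>x. e x * exp (1 / (4 * x))) has_real_derivative y) (at x) \<and> y \<le> 0" by force
    qed
    moreover have "e z * 1 \<le> e z * exp (1 / (4 * z))"
      using z by (intro mult_left_mono) (auto simp: e_def)
    ultimately show ?thesis by (simp add: B_def)
  qed
  define b where "b = sqrt B"
  have vb: "\<bar>v z\<bar> \<le> b" if "z \<ge> 1" for z
  proof -
    have "(v z)\<^sup>2 \<le> B" using eB[OF that] unfolding e_def by (smt (verit) zero_le_power2)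
    hence "sqrt ((v z)\<^sup>2) \<le> sqrt B" by (rule real_sqrt_le_mono)
    thus ?thesis by (simp add: b_def)
  qed
  have b0: "b \<ge> 0" using vb[of 1] by linarith
  have small: "\<bar>v z * t / (4 * z\<^sup>2)\<bar> \<le> b / z ^ Suc 1" if "z \<ge> 1" "\<bar>t\<bar> \<le> 1" for z t
  proof -
    have "\<bar>v z\<bar> * \<bar>t\<bar> \<le> b * 1" using vb[OF that(1)] that b0 by (intro mult_mono) auto
    hence "\<bar>v z * t\<bar> / (4 * z\<^sup>2) \<le> b / (4 * z\<^sup>2)" by (intro divide_right_mono) (auto simp: abs_mult)
    also have "\<dots> \<le> b / z\<^sup>2" using b0 that by (intro divide_left_mono) auto
    finally show ?thesis by (simp add: power2_eq_square)
  qed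
  obtain \<alpha> where \<alpha>: "\<And>z. z \<ge> 1 \<Longrightarrow> \<bar>(v z * cos z - w z * sin z) - \<alpha>\<bar> \<le> b / z ^ 1"
  proof (rule limit_of_small_derivative)
    show "((\<lambda>z. v z * cos z - w z * sin z) has_real_derivative v z * sin z / (4 * z\<^sup>2)) (at z)" if "z \<ge> 1" for z
      using that by (auto intro!: derivative_eq_intros v' w' simp: field_simps)
    show "\<bar>v z * sin z / (4 * z\<^sup>2)\<bar> \<le> b / z ^ Suc 1" if "z \<ge> 1" for z
      using that by (intro small) auto
  qed auto
  obtain \<beta> where \<beta>: "\<And>z. z \<ge> 1 \<Longrightarrow> \<bar>(v z * sin z + w z * cos z) - \<beta>\<bar> \<le> b / z ^ 1"
  proof (rule limit_of_small_derivative)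
    show "((\<lambda>z. v z * sin z + w z * cos z) has_real_derivative v z * (- cos z) / (4 * z\<^sup>2)) (at z)" if "z \<ge> 1" for z
      using that by (auto intro!: derivative_eq_intros v' w' simp: field_simps)
    show "\<bar>v z * (- cos z) / (4 * z\<^sup>2)\<bar> \<le> b / z ^ Suc 1" if "z \<ge> 1" for z
      using that by (intro small) auto
  qed auto
  have combine: "\<bar>x * c + y * s\<bar> \<le> 2 * b / z" if "\<bar>x\<bar> \<le> b / z" "\<bar>y\<bar> \<le> b / z" "\<bar>c\<bar> \<le> 1" "\<bar>s\<bar> \<le> 1" for x y c s z :: real
  proof -
    have "\<bar>x * c\<bar> \<le> b / z * 1" "\<bar>y * s\<bar> \<le> b / z * 1"
      unfolding abs_mult using that by (intro mult_mono; linarith)+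
    thus ?thesis by linarith
  qed
  have rot: "V = (V * cos z - W * sin z) * cos z + (V * sin z + W * cos z) * sin z"
    "W = (V * cos z - W * sin z) * (- sin z) + (V * sin z + W * cos z) * cos z" for V W z :: real
  proof -
    have "V * (C\<^sup>2 + S\<^sup>2) = (V * C - W * S) * C + (V * S + W * C) * S"
      "W * (C\<^sup>2 + S\<^sup>2) = (V * C - W * S) * (- S) + (V * S + W * C) * C" for C S
      by (simp_all add: power2_eq_square algebra_simps)
    from this[of "cos z" "sin z"]
    show "V = (V * cos z - W * sin z) * cos z + (V * sin z + W * cos z) * sin z"
      "W = (V * cos z - W * sin z) * (- sin z) + (V * sin z + W * cos z) * cos z" by simp_all
  qed
  have vA: "\<bar>v z - (\<alpha> * cos z + \<beta> * sin z)\<bar> \<le> 2 * b / z" if z: "z \<ge> 1" for z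
  proof -
    have "v z - (\<alpha> * cos z + \<beta> * sin z)
        = ((v z * cos z - w z * sin z) - \<alpha>) * cos z + ((v z * sin z + w z * cos z) - \<beta>) * sin z"
      using rot(1)[of "v z" z "w z"] unfolding left_diff_distrib by linarith
    thus ?thesis using combine[of "(v z * cos z - w z * sin z) - \<alpha>" z "(v z * sin z + w z * cos z) - \<beta>" "cos z" "sin z"]
        \<alpha>[OF z] \<beta>[OF z] by simp
  qed
  have wA: "\<bar>w z - (\<beta> * cos z - \<alpha> * sin z)\<bar> \<le> 2 * b / z" if z: "z \<ge> 1" for z
  proof -
    have "w z - (\<beta> * cos z - \<alpha> * sin z)
        = ((v z * cos z - w z * sin z) - \<alpha>) * (- sin z) + ((v z * sin z + w z * cos z) - \<beta>) * cos z"
      using rot(2)[of "w z" "v z" z] unfolding left_diff_distrib mult_minus_right by linarith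
    thus ?thesis using combine[of "(v z * cos z - w z * sin z) - \<alpha>" z "(v z * sin z + w z * cos z) - \<beta>" "- sin z" "cos z"]
        \<alpha>[OF z] \<beta>[OF z] by simp
  qed
  define K where "K = \<bar>\<alpha>\<bar> + \<bar>\<beta>\<bar>"
  have K: "\<bar>\<alpha> * c + \<beta> * s\<bar> \<le> K" "\<bar>\<beta> * c - \<alpha> * s\<bar> \<le> K" if "\<bar>c\<bar> \<le> 1" "\<bar>s\<bar> \<le> 1" for c s
  proof -
    have "\<bar>x * y\<bar> \<le> \<bar>x\<bar>" if "\<bar>y\<bar> \<le> 1" for x y :: real
      using mult_left_mono[OF that, of "\<bar>x\<bar>"] by (simp add: abs_mult)
    from this[OF that(1), of \<alpha>] this[OF that(1), of \<beta>] this[OF that(2), of \<alpha>] this[OF that(2), of \<beta>]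
    show "\<bar>\<alpha> * c + \<beta> * s\<bar> \<le> K" "\<bar>\<beta> * c - \<alpha> * s\<bar> \<le> K" unfolding K_def by linarith+
  qed
  define C1 where "C1 = 2 * b * (2 * b + 2 * K)"
  have v2: "\<bar>(v z)\<^sup>2 - (\<alpha> * cos z + \<beta> * sin z)\<^sup>2\<bar> \<le> C1 / z" if "z \<ge> 1" for z
    unfolding C1_def using that by (intro square_diff_bound vA K) auto
  have v_sq: "(v z)\<^sup>2 = z * (bessel_j0 z)\<^sup>2" if "z \<ge> 1" for z
    using that by (simp add: v_def power_mult_distrib)
  \<comment> \<open>The predicted square minus the limit from stationary phase is periodic and tends
    to 0, hence vanishes identically. Its values at \<open>0\<close>, \<open>pi / 2\<close> and
    \<open>pi / 4\<close> give \<open>\<alpha>^2\<close>, \<open>\<beta>^2\<close> and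
    \<open>(\<alpha> + \<beta>)^2\<close>, and so \<open>\<alpha> = \<beta>\<close>; the common sign
    drops out of the squares.\<close>
  define T where "T z = (\<alpha> * cos z + \<beta> * sin z)\<^sup>2 - (1 + sin (2 * z)) / pi" for z
  have T0: "T z = 0" for z
  proof (rule periodic_tendsto_0[of T "2 * pi"])
    show "T (x + 2 * pi) = T x" for x
    proof -
      have "sin (2 * (x + 2 * pi)) = sin (2 * x)"
        using sin_periodic[of "2 * x + 2 * pi"] sin_periodic[of "2 * x"] by (simp add: algebra_simps)
      thus ?thesis by (simp add: T_def)
    qed
    have lim: "((\<lambda>z. (v z)\<^sup>2 - (\<alpha> * cos z + \<beta> * sin z)\<^sup>2) \<longlongrightarrow> 0) at_top"
    proof (rule Lim_null_comparison)
      show "\<forall>\<^sub>F z in at_top. norm ((v z)\<^sup>2 - (\<alpha> * cos z + \<beta> * sin z)\<^sup>2) \<le> C1 / z"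
        using eventually_ge_at_top[of 1] by eventually_elim (simp add: v2)
      show "((\<lambda>z. C1 / z) \<longlongrightarrow> 0) at_top" by real_asymp
    qed
    have "((\<lambda>z. (z * (bessel_j0 z)\<^sup>2 - (1 + sin (2 * z)) / pi)
        - ((v z)\<^sup>2 - (\<alpha> * cos z + \<beta> * sin z)\<^sup>2)) \<longlongrightarrow> 0 - 0) at_top"
      by (intro tendsto_diff bessel_j0_square_limit lim)
    moreover have "\<forall>\<^sub>F z in at_top. (z * (bessel_j0 z)\<^sup>2 - (1 + sin (2 * z)) / pi)
        - ((v z)\<^sup>2 - (\<alpha> * cos z + \<beta> * sin z)\<^sup>2) = T z"
      using eventually_ge_at_top[of 1] by eventually_elim (simp add: v_sq T_def)
    ultimately show "(T \<longlongrightarrow> 0) at_top" using Lim_transform_eventually by force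
  qed (use pi_gt_zero in simp)
  have "\<alpha>\<^sup>2 = 1 / pi" using T0[of 0] by (simp add: T_def)
  have "\<beta>\<^sup>2 = 1 / pi" using T0[of "pi / 2"] by (simp add: T_def)
  have "(\<alpha> + \<beta>)\<^sup>2 = 4 / pi"
  proof -
    have "((\<alpha> + \<beta>) * (sqrt 2 / 2))\<^sup>2 = 2 / pi"
      using T0[of "pi / 4"] by (simp add: T_def sin_45 cos_45 distrib_right add_divide_distrib)
    thus ?thesis by (simp add: power_mult_distrib power_divide)
  qed
  hence "(\<alpha> - \<beta>)\<^sup>2 = 0"
    using \<open>\<alpha>\<^sup>2 = 1 / pi\<close> \<open>\<beta>\<^sup>2 = 1 / pi\<close> by (simp add: power2_eq_square algebra_simps)
  hence \<beta>\<alpha>: "\<beta> = \<alpha>" by simp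
  have trig: "(\<alpha> * cos z + \<beta> * sin z)\<^sup>2 = (1 + sin (2 * z)) / pi" "(\<beta> * cos z - \<alpha> * sin z)\<^sup>2 = (1 - sin (2 * z)) / pi" for z
  proof -
    show "(\<alpha> * cos z + \<beta> * sin z)\<^sup>2 = (1 + sin (2 * z)) / pi" using T0[of z] by (simp add: T_def)
    have "(\<alpha> * C - \<alpha> * S)\<^sup>2 = \<alpha>\<^sup>2 * ((C\<^sup>2 + S\<^sup>2) - 2 * S * C)" for C S
      by (simp add: power2_eq_square algebra_simps)
    hence "(\<beta> * cos z - \<alpha> * sin z)\<^sup>2 = \<alpha>\<^sup>2 * (((cos z)\<^sup>2 + (sin z)\<^sup>2) - 2 * sin z * cos z)"
      unfolding \<beta>\<alpha> .
    thus "(\<beta> * cos z - \<alpha> * sin z)\<^sup>2 = (1 - sin (2 * z)) / pi"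
      using \<open>\<alpha>\<^sup>2 = 1 / pi\<close> by (simp add: sin_double)
  qed
  \<comment> \<open>\<open>w z\<close> differs from \<open>sqrt z * bessel_j1 z\<close> by
    \<open>v z / (2 * z)\<close>, which raises the constant \<open>2 * b\<close> to
    \<open>3 * b\<close>.\<close>
  define C2 where "C2 = 3 * b * (3 * b + 2 * K)"
  have w2: "\<bar>z * (bessel_j1 z)\<^sup>2 - (1 - sin (2 * z)) / pi\<bar> \<le> C2 / z" if z: "z \<ge> 1" for z
  proof -
    have s: "sqrt z * bessel_j1 z = w z - v z / (2 * z)"
      using z by (simp add: w_def v_def field_simps)
    have "\<bar>v z / (2 * z)\<bar> \<le> b / z"
    proof -
      have "\<bar>v z / (2 * z)\<bar> = \<bar>v z\<bar> / (2 * z)" using z by simp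
      also have "\<dots> \<le> b / (2 * z)" using z vb[OF z] by (intro divide_right_mono) auto
      also have "\<dots> \<le> b / z" using z b0 by (intro divide_left_mono) auto
      finally show ?thesis .
    qed
    hence "\<bar>sqrt z * bessel_j1 z - (\<beta> * cos z - \<alpha> * sin z)\<bar> \<le> b / z + 2 * b / z"
      unfolding s using wA[OF z] by linarith
    hence "\<bar>sqrt z * bessel_j1 z - (\<beta> * cos z - \<alpha> * sin z)\<bar> \<le> 3 * b / z"
      by (simp add: add_divide_distrib[symmetric])
    hence "\<bar>(sqrt z * bessel_j1 z)\<^sup>2 - (\<beta> * cos z - \<alpha> * sin z)\<^sup>2\<bar> \<le> C2 / z"
      unfolding C2_def using z by (intro square_diff_bound K) auto
    thus ?thesis unfolding trig using z by (simp add: power_mult_distrib)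
  qed
  show thesis
  proof (rule that)
    fix z :: real assume z: "z \<ge> 1"
    have "C1 / z \<le> max C1 C2 / z" "C2 / z \<le> max C1 C2 / z" using z by (intro divide_right_mono; simp)+
    thus "\<bar>z * (bessel_j0 z)\<^sup>2 - (1 + sin (2 * z)) / pi\<bar> \<le> max C1 C2 / z"
      "\<bar>z * (bessel_j1 z)\<^sup>2 - (1 - sin (2 * z)) / pi\<bar> \<le> max C1 C2 / z"
      using v2[OF z] w2[OF z] v_sq[OF z] trig by simp_all
  qed
qed

text \<open>With \<open>z = 2 sqrt \<theta>\<close>, the closed form of \<open>\<theta> * arcsine_mean (\<lambda>x. bessel_quotient (\<theta> * x))\<close>
  is \<open>z Q / 2 - J\<^sub>0\<^sup>2 / 4\<close>, where \<open>Q\<close> below has the small derivative \<open>- J\<^sub>0\<^sup>2 / (2 z\<^sup>2)\<close>.\<close>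

lemma bessel_j_energy_asymptotics:
  obtains C where "\<And>z. z \<ge> 1 \<Longrightarrow>
    \<bar>z\<^sup>2 / 2 * ((bessel_j0 z)\<^sup>2 + (bessel_j1 z)\<^sup>2) + z / 2 * bessel_j0 z * bessel_j1 z
      - (z / pi + 1 / (8 * pi * z) - (1 + sin (2 * z)) / (4 * pi * z))\<bar> \<le> C / z\<^sup>2"
proof -
  obtain C where C0: "\<And>z. z \<ge> 1 \<Longrightarrow> \<bar>z * (bessel_j0 z)\<^sup>2 - (1 + sin (2 * z)) / pi\<bar> \<le> C / z"
    and C1: "\<And>z. z \<ge> 1 \<Longrightarrow> \<bar>z * (bessel_j1 z)\<^sup>2 - (1 - sin (2 * z)) / pi\<bar> \<le> C / z"
    using bessel_j_asymptotics by blast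
  have Cpos: "C \<ge> 0" using C0[of 1] by simp
  define Q where "Q z = z * ((bessel_j0 z)\<^sup>2 + (bessel_j1 z)\<^sup>2) + bessel_j0 z * bessel_j1 z
      + (bessel_j0 z)\<^sup>2 / (2 * z)" for z
  have Q': "(Q has_real_derivative - (bessel_j0 z)\<^sup>2 / (2 * z\<^sup>2)) (at z)" if "z \<ge> 1" for z
    unfolding Q_def[abs_def] using that
    by (auto intro!: derivative_eq_intros bessel_j0_has_derivative bessel_j1_has_derivative
        simp: field_simps power2_eq_square)
  \<comment> \<open>\<open>Q'\<close> is only \<open>O(z^-3)\<close>, one power short after the
    multiplication by \<open>z / 2\<close>. The subtracted terms are a primitive, up to
    \<open>O(z^-4)\<close> in the derivative, of its leading part
    \<open>- (1 + sin (2 * z)) / (2 * pi * z ^ 3)\<close>.\<close>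
  define H where "H z = Q z - 1 / (4 * pi * z\<^sup>2) - cos (2 * z) / (4 * pi * z ^ 3)" for z
  define H' where "H' z = - (bessel_j0 z)\<^sup>2 / (2 * z\<^sup>2) + 1 / (2 * pi * z ^ 3)
      + (sin (2 * z) / (2 * pi * z ^ 3) + 3 * cos (2 * z) / (4 * pi * z ^ 4))" for z
  have H': "(H has_real_derivative H' z) (at z)" if z: "z \<ge> 1" for z
  proof -
    have "((\<lambda>z. 1 / (4 * pi * z\<^sup>2)) has_real_derivative - (1 / (2 * pi * z ^ 3))) (at z)"
      using z by (auto intro!: derivative_eq_intros simp: field_simps eval_nat_numeral)
    moreover have "((\<lambda>z. cos (2 * z) / (4 * pi * z ^ 3)) has_real_derivative
        - (sin (2 * z) / (2 * pi * z ^ 3) + 3 * cos (2 * z) / (4 * pi * z ^ 4))) (at z)"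
      using z by (auto intro!: derivative_eq_intros simp: field_simps eval_nat_numeral)
    ultimately have "(H has_real_derivative - (bessel_j0 z)\<^sup>2 / (2 * z\<^sup>2) - - (1 / (2 * pi * z ^ 3))
        - - (sin (2 * z) / (2 * pi * z ^ 3) + 3 * cos (2 * z) / (4 * pi * z ^ 4))) (at z)"
      unfolding H_def[abs_def] by (intro DERIV_diff Q' z)
    also have "- (bessel_j0 z)\<^sup>2 / (2 * z\<^sup>2) - - (1 / (2 * pi * z ^ 3))
        - - (sin (2 * z) / (2 * pi * z ^ 3) + 3 * cos (2 * z) / (4 * pi * z ^ 4)) = H' z"
      unfolding H'_def by linarith
    finally show ?thesis .
  qed
  define M where "M = C / 2 + 3 / (4 * pi)"
  have M: "\<bar>H' z\<bar> \<le> M / z ^ Suc 3" if z: "z \<ge> 1" for z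
  proof -
    have "H' z = 3 * cos (2 * z) / (4 * pi * z ^ 4) - (z * (bessel_j0 z)\<^sup>2 - (1 + sin (2 * z)) / pi) / (2 * z ^ 3)"
      using z by (simp add: H'_def field_simps eval_nat_numeral)
    also have "\<bar>\<dots>\<bar> \<le> \<bar>3 * cos (2 * z) / (4 * pi * z ^ 4)\<bar> + \<bar>(z * (bessel_j0 z)\<^sup>2 - (1 + sin (2 * z)) / pi) / (2 * z ^ 3)\<bar>"
      by (rule abs_triangle_ineq4)
    also have "\<dots> = \<bar>z * (bessel_j0 z)\<^sup>2 - (1 + sin (2 * z)) / pi\<bar> / (2 * z ^ 3) + 3 * \<bar>cos (2 * z)\<bar> / (4 * pi * z ^ 4)"
      using z by (simp add: abs_mult)
    also have "\<dots> \<le> (C / z) / (2 * z ^ 3) + 3 * 1 / (4 * pi * z ^ 4)"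
      using z by (intro add_mono divide_right_mono C0 mult_left_mono) auto
    also have "\<dots> = M / z ^ Suc 3"
      using z by (simp add: M_def field_simps eval_nat_numeral)
    finally show ?thesis .
  qed
  obtain L where L: "\<And>z. z \<ge> 1 \<Longrightarrow> \<bar>H z - L\<bar> \<le> M / z ^ 3"
    using limit_of_small_derivative[of H H' M 3] H' M by auto
  \<comment> \<open>This crude rate only identifies the limit \<open>L\<close>; the sharp rate comes
    from the bound on \<open>H'\<close>.\<close>
  have Hb: "\<bar>H z - 2 / pi\<bar> \<le> (2 * C + (2 / pi + C) * 2 + 1) / z" if z: "z \<ge> 1" for z
  proof -
    have b0: "z * (bessel_j0 z)\<^sup>2 \<le> 2 / pi + C" and b1: "z * (bessel_j1 z)\<^sup>2 \<le> 2 / pi + C"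
    proof -
      have "C / z \<le> C" using z Cpos by (simp add: divide_le_eq mult_le_cancel_left1)
      moreover have "(1 + sin (2 * z)) / pi \<le> 2 / pi" "(1 - sin (2 * z)) / pi \<le> 2 / pi"
        using sin_le_one[of "2 * z"] sin_ge_minus_one[of "2 * z"] by (intro divide_right_mono; simp; linarith)+
      ultimately show "z * (bessel_j0 z)\<^sup>2 \<le> 2 / pi + C" "z * (bessel_j1 z)\<^sup>2 \<le> 2 / pi + C"
        using C0[OF z] C1[OF z] by linarith+
    qed
    have d0: "(bessel_j0 z)\<^sup>2 \<le> (2 / pi + C) / z" and d1: "(bessel_j1 z)\<^sup>2 \<le> (2 / pi + C) / z"
      using b0 b1 z by (simp_all add: pos_le_divide_eq mult.commute)
    have "2 * \<bar>bessel_j0 z * bessel_j1 z\<bar> \<le> (bessel_j0 z)\<^sup>2 + (bessel_j1 z)\<^sup>2"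
      using sum_squares_bound[of "\<bar>bessel_j0 z\<bar>" "\<bar>bessel_j1 z\<bar>"] by (simp add: abs_mult)
    hence p: "\<bar>bessel_j0 z * bessel_j1 z\<bar> \<le> (2 / pi + C) / z" using d0 d1 by linarith
    have q: "\<bar>(bessel_j0 z)\<^sup>2 / (2 * z)\<bar> \<le> (2 / pi + C) / z"
    proof -
      have "(bessel_j0 z)\<^sup>2 / (2 * z) \<le> (bessel_j0 z)\<^sup>2 / 1" using z by (intro divide_left_mono) auto
      thus ?thesis using d0 z by simp
    qed
    have r: "\<bar>1 / (4 * pi * z\<^sup>2)\<bar> \<le> (1 / 2) / z" "\<bar>cos (2 * z) / (4 * pi * z ^ 3)\<bar> \<le> (1 / 2) / z"
    proof -
      have pz: "2 * z \<le> 4 * pi * z\<^sup>2" "2 * z \<le> 4 * pi * z ^ 3"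
      proof -
        have "2 * z \<le> 4 * pi * z" using z pi_gt3 by (intro mult_right_mono) auto
        moreover have "z \<le> z\<^sup>2" "z \<le> z ^ 3" using z power_increasing[of 1 2 z] power_increasing[of 1 3 z] by auto
        hence "4 * pi * z \<le> 4 * pi * z\<^sup>2" "4 * pi * z \<le> 4 * pi * z ^ 3" by (intro mult_left_mono; simp)+
        ultimately show "2 * z \<le> 4 * pi * z\<^sup>2" "2 * z \<le> 4 * pi * z ^ 3" by linarith+
      qed
      have "1 / (4 * pi * z\<^sup>2) \<le> 1 / (2 * z)" using z pz by (intro divide_left_mono) auto
      thus "\<bar>1 / (4 * pi * z\<^sup>2)\<bar> \<le> (1 / 2) / z" by simp
      have "\<bar>cos (2 * z)\<bar> / (4 * pi * z ^ 3) \<le> 1 / (2 * z)" using z pz by (intro frac_le) auto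
      thus "\<bar>cos (2 * z) / (4 * pi * z ^ 3)\<bar> \<le> (1 / 2) / z" using z by simp
    qed
    have "H z - 2 / pi = (z * (bessel_j0 z)\<^sup>2 - (1 + sin (2 * z)) / pi) + (z * (bessel_j1 z)\<^sup>2 - (1 - sin (2 * z)) / pi)
        + bessel_j0 z * bessel_j1 z + (bessel_j0 z)\<^sup>2 / (2 * z) - 1 / (4 * pi * z\<^sup>2) - cos (2 * z) / (4 * pi * z ^ 3)"
      by (simp add: H_def Q_def add_divide_distrib diff_divide_distrib distrib_left)
    hence "\<bar>H z - 2 / pi\<bar> \<le> C / z + C / z + (2 / pi + C) / z + (2 / pi + C) / z + (1 / 2) / z + (1 / 2) / z"
      using C0[OF z] C1[OF z] p q r by linarith
    also have "\<dots> = (2 * C + (2 / pi + C) * 2 + 1) / z"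
      by (simp add: add_divide_distrib[symmetric] mult_2_right)
    finally show ?thesis .
  qed
  have "L = 2 / pi"
  proof (rule tendsto_unique[of at_top H])
    show "(H \<longlongrightarrow> L) at_top"
    proof (rule LIM_zero_cancel, rule Lim_null_comparison)
      show "\<forall>\<^sub>F z in at_top. norm (H z - L) \<le> M / z ^ 3"
        using eventually_ge_at_top[of 1] by eventually_elim (simp add: L)
      show "((\<lambda>z. M / z ^ 3) \<longlongrightarrow> 0) at_top" by real_asymp
    qed
    show "(H \<longlongrightarrow> 2 / pi) at_top"
    proof (rule LIM_zero_cancel, rule Lim_null_comparison)
      show "\<forall>\<^sub>F z in at_top. norm (H z - 2 / pi) \<le> (2 * C + (2 / pi + C) * 2 + 1) / z"
        using eventually_ge_at_top[of 1] by eventually_elim (simp add: Hb del: distrib_right_numeral)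
      show "((\<lambda>z. (2 * C + (2 / pi + C) * 2 + 1) / z) \<longlongrightarrow> 0) at_top"
        by (intro tendsto_divide_0[OF tendsto_const] filterlim_at_top_imp_at_infinity filterlim_ident)
    qed
  qed simp
  show thesis
  proof (rule that)
    fix z :: real assume z: "z \<ge> 1"
    have "z\<^sup>2 / 2 * ((bessel_j0 z)\<^sup>2 + (bessel_j1 z)\<^sup>2) + z / 2 * bessel_j0 z * bessel_j1 z
      - (z / pi + 1 / (8 * pi * z) - (1 + sin (2 * z)) / (4 * pi * z))
      = z / 2 * (H z - L) + cos (2 * z) / (8 * pi * z\<^sup>2)
        - (z * (bessel_j0 z)\<^sup>2 - (1 + sin (2 * z)) / pi) / (4 * z)"
      unfolding \<open>L = 2 / pi\<close> H_def Q_def using z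
      by (simp add: field_simps eval_nat_numeral)
    also have "\<bar>\<dots>\<bar> \<le> z / 2 * (M / z ^ 3) + 1 / (8 * pi * z\<^sup>2) + (C / z) / (4 * z)"
    proof -
      have "\<bar>z / 2 * (H z - L)\<bar> \<le> z / 2 * (M / z ^ 3)"
        unfolding abs_mult using L[OF z] z by (intro mult_mono) auto
      moreover have "\<bar>cos (2 * z) / (8 * pi * z\<^sup>2)\<bar> \<le> 1 / (8 * pi * z\<^sup>2)"
        unfolding abs_divide by (intro frac_le) (use z in auto)
      moreover have "\<bar>(z * (bessel_j0 z)\<^sup>2 - (1 + sin (2 * z)) / pi) / (4 * z)\<bar> \<le> (C / z) / (4 * z)"
        unfolding abs_divide using C0[OF z] z by (intro frac_le) auto
      ultimately show ?thesis by linarith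
    qed
    also have "\<dots> = (M / 2 + 1 / (8 * pi) + C / 4) / z\<^sup>2"
      using z by (simp add: field_simps eval_nat_numeral)
    finally show "\<bar>z\<^sup>2 / 2 * ((bessel_j0 z)\<^sup>2 + (bessel_j1 z)\<^sup>2) + z / 2 * bessel_j0 z * bessel_j1 z
      - (z / pi + 1 / (8 * pi * z) - (1 + sin (2 * z)) / (4 * pi * z))\<bar> \<le> (M / 2 + 1 / (8 * pi) + C / 4) / z\<^sup>2" .
  qed
qed

section \<open>Laguerre polynomials\<close>

definition laguerre_coeff :: "nat \<Rightarrow> nat \<Rightarrow> real" where
  "laguerre_coeff n k = (-1) ^ k * real (n choose k) / fact k"

text \<open>A series with finitely many nonzero terms, so that the termwise differentiation used for
  the Bessel series applies verbatim.\<close>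

definition laguerre :: "nat \<Rightarrow> real \<Rightarrow> real" where
  "laguerre n x = (\<Sum>k. laguerre_coeff n k * x ^ k)"

definition laguerre' :: "nat \<Rightarrow> real \<Rightarrow> real" where
  "laguerre' n x = (\<Sum>k. diffs (laguerre_coeff n) k * x ^ k)"

definition laguerre'' :: "nat \<Rightarrow> real \<Rightarrow> real" where
  "laguerre'' n x = (\<Sum>k. diffs (diffs (laguerre_coeff n)) k * x ^ k)"

lemma laguerre_eq_sum: "laguerre n x = (\<Sum>k\<le>n. laguerre_coeff n k * x ^ k)"
  unfolding laguerre_def by (rule suminf_finite) (auto simp: laguerre_coeff_def)

lemma summable_laguerre: "summable (\<lambda>k. laguerre_coeff n k * x ^ k)"
  by (rule summable_finite[of "{..n}"]) (auto simp: laguerre_coeff_def)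

lemma summable_laguerre': "summable (\<lambda>k. diffs (laguerre_coeff n) k * x ^ k)"
  by (rule termdiff_converges_all) (rule summable_laguerre)

lemma summable_laguerre'': "summable (\<lambda>k. diffs (diffs (laguerre_coeff n)) k * x ^ k)"
  by (rule termdiff_converges_all) (rule summable_laguerre')

lemma laguerre_has_derivative: "(laguerre n has_real_derivative laguerre' n x) (at x)"
  unfolding laguerre_def[abs_def] laguerre'_def
  by (rule termdiffs_strong_converges_everywhere) (rule summable_laguerre)

lemma laguerre'_has_derivative: "(laguerre' n has_real_derivative laguerre'' n x) (at x)"
  unfolding laguerre'_def[abs_def] laguerre''_def
  by (rule termdiffs_strong_converges_everywhere) (rule summable_laguerre')

lemma laguerre_coeff_rec:
  "(real k + 1)\<^sup>2 * laguerre_coeff n (Suc k) = (real k - real n) * laguerre_coeff n k"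
proof -
  have "real (Suc k * (n choose Suc k)) = real ((n - k) * (n choose k))"
    using binomial_absorption[of k n] binomial_absorb_comp[of n k] by simp
  hence b: "(real k + 1) * real (n choose Suc k) = (real n - real k) * real (n choose k)"
    by (cases "k \<le> n") (auto simp: of_nat_diff algebra_simps)
  define K where "K = real k + 1"
  have K: "K \<noteq> 0" "(fact (Suc k) :: real) = K * fact k" by (simp_all add: K_def algebra_simps)
  have "(real k + 1)\<^sup>2 * laguerre_coeff n (Suc k)
      = - ((-1) ^ k * ((real k + 1) * real (n choose Suc k)) / fact k)"
    unfolding laguerre_coeff_def K(2) K_def[symmetric] using K(1) by (simp add: power2_eq_square)
  also have "\<dots> = (real k - real n) * laguerre_coeff n k"
    unfolding b by (simp add: laguerre_coeff_def field_simps)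
  finally show ?thesis .
qed

lemma laguerre_ode: "x * laguerre'' n x + (1 - x) * laguerre' n x + real n * laguerre n x = 0"
proof -
  let ?c = "laguerre_coeff n"
  let ?b = "\<lambda>k. real k * real (k + 1) * ?c (k + 1) * x ^ k"
  let ?d = "\<lambda>k. real k * ?c k * x ^ k"
  have "(\<lambda>k. x * (diffs (diffs ?c) k * x ^ k)) sums (x * laguerre'' n x)"
    unfolding laguerre''_def by (intro sums_mult summable_sums summable_laguerre'')
  hence "(\<lambda>k. ?b (Suc k)) sums (x * laguerre'' n x)" by (simp add: diffs_def mult_ac)
  hence 2: "?b sums (x * laguerre'' n x)" by (subst (asm) sums_Suc_iff) simp
  have 1: "(\<lambda>k. diffs ?c k * x ^ k) sums laguerre' n x"
    unfolding laguerre'_def by (intro summable_sums summable_laguerre')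
  have "(\<lambda>k. x * (diffs ?c k * x ^ k)) sums (x * laguerre' n x)" by (rule sums_mult[OF 1])
  hence "(\<lambda>k. ?d (Suc k)) sums (x * laguerre' n x)" by (simp add: diffs_def mult_ac)
  hence 3: "?d sums (x * laguerre' n x)" by (subst (asm) sums_Suc_iff) simp
  have 0: "(\<lambda>k. real n * (?c k * x ^ k)) sums (real n * laguerre n x)"
    unfolding laguerre_def by (intro sums_mult summable_sums summable_laguerre)
  have "(\<lambda>k. (?b k + (diffs ?c k * x ^ k - ?d k)) + real n * (?c k * x ^ k)) sums
      ((x * laguerre'' n x + (laguerre' n x - x * laguerre' n x)) + real n * laguerre n x)"
    by (intro sums_add sums_diff 0 1 2 3)
  moreover have "(?b k + (diffs ?c k * x ^ k - ?d k)) + real n * (?c k * x ^ k) = 0" for k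
  proof -
    have "(?b k + (diffs ?c k * x ^ k - ?d k)) + real n * (?c k * x ^ k)
        = ((real k + 1)\<^sup>2 * ?c (Suc k) - (real k - real n) * ?c k) * x ^ k"
      by (simp add: diffs_def algebra_simps power2_eq_square)
    thus ?thesis unfolding laguerre_coeff_rec by simp
  qed
  ultimately have "(\<lambda>k. 0) sums ((x * laguerre'' n x + (laguerre' n x - x * laguerre' n x)) + real n * laguerre n x)"
    by simp
  from sums_unique2[OF this sums_zero] show ?thesis by (simp add: algebra_simps)
qed

lemma laguerre_0: "laguerre n 0 = 1"
  using sums_unique2[OF summable_sums[OF summable_laguerre[of n 0]] powser_sums_zero]
  by (simp add: laguerre_def laguerre_coeff_def)

text \<open>The function \<open>w = exp (- x / 2) * laguerre n x\<close> solves \<open>x w'' + w' + (N - x / 4) w = 0\<close> with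
  \<open>N = n + 1 / 2\<close>; the approximation \<open>J\<^sub>0(2 sqrt (N x))\<close>, corrected by a multiple of \<open>J\<^sub>1\<close>, solves
  the same equation up to a residual that is small enough for an energy estimate of the error.\<close>

lemma laguerre_bessel_approximation:
  fixes n :: nat and x :: real
  defines "N \<equiv> real n + 1 / 2"
  assumes n: "n \<ge> 1" and x: "x \<in> {0..4}"
  shows "\<bar>exp (- x / 2) * laguerre n x - (bessel (N * x) - x\<^sup>2 / 12 * bessel' (N * x))\<bar> \<le> exp 4 / 4 * x / N"
proof -
  have N: "N \<ge> 1" using n by (simp add: N_def)
  define w where "w x = exp (- x / 2) * laguerre n x" for x
  define w' where "w' x = exp (- x / 2) * (laguerre' n x - laguerre n x / 2)" for x
  define w'' where "w'' x = exp (- x / 2) * (laguerre'' n x - laguerre' n x + laguerre n x / 4)" for x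
  have dw: "(w has_real_derivative w' x) (at x)" for x
    unfolding w_def[abs_def] w'_def
    by (auto intro!: derivative_eq_intros laguerre_has_derivative simp: algebra_simps)
  have dw': "(w' has_real_derivative w'' x) (at x)" for x
    unfolding w'_def[abs_def] w''_def
    by (auto intro!: derivative_eq_intros laguerre_has_derivative laguerre'_has_derivative
        simp: algebra_simps diff_divide_distrib)
  have w_ode: "x * w'' x + w' x + (N - x / 4) * w x = 0" for x
  proof -
    have "x * w'' x + w' x + (N - x / 4) * w x
        = exp (- x / 2) * (x * laguerre'' n x + (1 - x) * laguerre' n x + real n * laguerre n x)"
      by (simp add: w_def w'_def w''_def N_def algebra_simps)
    thus ?thesis unfolding laguerre_ode by simp
  qed
  define a where "a x = bessel (N * x)" for x
  define b where "b x = bessel' (N * x)" for x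
  define c where "c x = bessel'' (N * x)" for x
  have da: "(a has_real_derivative N * b x) (at x)" for x
    unfolding a_def[abs_def] b_def by (auto intro!: derivative_eq_intros)
  have db: "(b has_real_derivative N * c x) (at x)" for x
    unfolding b_def[abs_def] c_def by (auto intro!: derivative_eq_intros)
  have ode: "N * (x * c x) = - b x - a x" for x
    using bessel_ode[of "N * x"] by (simp add: a_def b_def c_def mult.assoc)
  \<comment> \<open>The coefficient \<open>x^2 / 12\<close> is chosen such that the terms with
    \<open>a\<close> cancel in the residual. The rest is a multiple of \<open>b\<close>, and
    \<open>bessel_energy_le\<close> bounds \<open>(b x)^2\<close> by
    \<open>1 / (N * x)\<close>.\<close>
  define u where "u x = a x - x\<^sup>2 / 12 * b x" for x
  define u' where "u' x = N * b x - x / 12 * b x + x / 12 * a x" for x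
  define u'' where "u'' x = N * (N * c x) - b x / 12 - x / 12 * (N * c x) + a x / 12 + x / 12 * (N * b x)" for x
  have du: "(u has_real_derivative u' x) (at x)" for x
  proof -
    have "(u has_real_derivative N * b x - x / 6 * b x - x / 12 * (N * (x * c x))) (at x)"
      unfolding u_def[abs_def] by (auto intro!: derivative_eq_intros da db simp: power2_eq_square field_simps)
    also have "N * b x - x / 6 * b x - x / 12 * (N * (x * c x)) = u' x"
      unfolding ode u'_def by (simp add: field_simps)
    finally show ?thesis .
  qed
  have du': "(u' has_real_derivative u'' x) (at x)" for x
    unfolding u'_def[abs_def] u''_def by (auto intro!: derivative_eq_intros da db simp: field_simps)
  have u_ode: "x * u'' x + u' x + (N - x / 4) * u x = - (b x * (x / 12 - x ^ 3 / 48))" for x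
  proof -
    have xu: "x * u'' x = N * (N * (x * c x)) - x / 12 * b x - x / 12 * (N * (x * c x)) + x / 12 * a x + x\<^sup>2 / 12 * (N * b x)"
      by (simp add: u''_def algebra_simps power2_eq_square)
    show ?thesis unfolding xu unfolding ode u'_def u_def
      by (simp add: field_simps power2_eq_square power3_eq_cube)
  qed
  define v where "v x = w x - u x" for x
  define v' where "v' x = w' x - u' x" for x
  define v'' where "v'' x = w'' x - u'' x" for x
  define \<rho> where "\<rho> x = b x * (x / 12 - x ^ 3 / 48)" for x
  have dv: "(v has_real_derivative v' x) (at x)" "(v' has_real_derivative v'' x) (at x)" for x
    unfolding v_def[abs_def] v'_def[abs_def] v''_def by (intro DERIV_diff dw dw' du du')+
  have v_ode: "x * v'' x = \<rho> x - v' x - (N - x / 4) * v x" for x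
  proof -
    have "x * v'' x + v' x + (N - x / 4) * v x
        = (x * w'' x + w' x + (N - x / 4) * w x) - (x * u'' x + u' x + (N - x / 4) * u x)"
      unfolding v_def v'_def v''_def by (simp add: right_diff_distrib)
    thus ?thesis unfolding w_ode u_ode \<rho>_def by linarith
  qed
  have \<rho>_bound: "2 * (\<rho> x)\<^sup>2 \<le> x / (8 * N)" if "x \<in> {0..4}" for x
  proof (cases "x = 0")
    case False
    hence x0: "x > 0" and x4: "x \<le> 4" using that by auto
    have "(bessel (N * x))\<^sup>2 + N * x * (bessel' (N * x))\<^sup>2 \<le> 1"
      using bessel_energy_le[of "N * x"] x0 N by simp
    hence "N * x * (b x)\<^sup>2 \<le> 1" unfolding b_def by (smt (verit) zero_le_power2)
    hence b2: "(b x)\<^sup>2 \<le> 1 / (N * x)" using x0 N by (simp add: field_simps)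
    have f: "\<bar>x / 12 - x ^ 3 / 48\<bar> \<le> x / 4"
    proof -
      have "x ^ 3 = x * x\<^sup>2" by (simp add: power3_eq_cube power2_eq_square)
      moreover have "x\<^sup>2 \<le> 4\<^sup>2" using x0 x4 by (intro power_mono) auto
      hence "x * x\<^sup>2 \<le> x * 16" using x0 by (intro mult_left_mono) auto
      moreover have "x * x\<^sup>2 \<ge> 0" using x0 by simp
      ultimately show ?thesis using x0 unfolding abs_le_iff by linarith
    qed
    have "(x / 12 - x ^ 3 / 48)\<^sup>2 \<le> (x / 4)\<^sup>2"
      using f x0 by (subst abs_le_square_iff[symmetric]) simp
    hence "(\<rho> x)\<^sup>2 \<le> 1 / (N * x) * (x / 4)\<^sup>2"
      unfolding \<rho>_def power_mult_distrib using b2 x0 N by (intro mult_mono) auto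
    also have "\<dots> = x / (16 * N)" using x0 N by (simp add: power2_eq_square)
    finally show ?thesis by simp
  qed (simp add: \<rho>_def)
  \<comment> \<open>In the derivative of this energy the terms with \<open>N * v * v'\<close>
    cancel; completing the square against \<open>- (v')^2\<close> absorbs the remaining mixed
    term.\<close>
  define E where "E x = x * (v' x)\<^sup>2 + N * (v x)\<^sup>2" for x
  have dE: "(E has_real_derivative (v' x)\<^sup>2 + 2 * v' x * (x * v'' x) + 2 * N * v x * v' x) (at x)" for x
    unfolding E_def[abs_def] by (auto intro!: derivative_eq_intros dv simp: algebra_simps power2_eq_square)
  \<comment> \<open>Gronwall's argument for \<open>E' \<le> 2 * E + t / (8 * N)\<close>. The start
    value is 0, since the weighted Laguerre polynomial and its approximation are both 1 at the
    origin.\<close>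
  define G where "G x = E x * exp (- 2 * x) - x\<^sup>2 / (16 * N)" for x
  have "G x \<le> G 0"
  proof (rule DERIV_nonpos_imp_nonincreasing[of 0 x G])
    show "0 \<le> x" using x by simp
    fix t assume "0 \<le> t" "t \<le> x"
    hence t: "t \<in> {0..4}" using x by auto
    define e where "e = (v' t)\<^sup>2 + 2 * v' t * (t * v'' t) + 2 * N * v t * v' t"
    have e: "e \<le> t / (8 * N) + 2 * E t"
    proof -
      have "e = - (v' t)\<^sup>2 + 2 * v' t * (\<rho> t + t / 4 * v t)"
        unfolding e_def v_ode by (simp add: field_simps power2_eq_square)
      also have "\<dots> \<le> (\<rho> t + t / 4 * v t)\<^sup>2"
        using zero_le_power2[of "v' t - (\<rho> t + t / 4 * v t)"] unfolding power2_diff by linarith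
      also have "\<dots> \<le> 2 * (\<rho> t)\<^sup>2 + 2 * (t / 4 * v t)\<^sup>2"
        using zero_le_power2[of "\<rho> t - t / 4 * v t"] unfolding power2_diff power2_sum by linarith
      also have "2 * (\<rho> t)\<^sup>2 \<le> t / (8 * N)" by (rule \<rho>_bound[OF t])
      also have "2 * (t / 4 * v t)\<^sup>2 \<le> 2 * E t"
      proof -
        have "(t / 4)\<^sup>2 \<le> 1\<^sup>2" using t by (intro power_mono) auto
        hence "(t / 4)\<^sup>2 * (v t)\<^sup>2 \<le> N * (v t)\<^sup>2" using N by (intro mult_right_mono) auto
        moreover have "0 \<le> t * (v' t)\<^sup>2" using t by simp
        ultimately have "(t / 4)\<^sup>2 * (v t)\<^sup>2 \<le> t * (v' t)\<^sup>2 + N * (v t)\<^sup>2" by (intro add_increasing)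
        thus ?thesis unfolding E_def power_mult_distrib by (intro mult_left_mono) auto
      qed
      finally show ?thesis by simp
    qed
    have "(G has_real_derivative (e - 2 * E t) * exp (- 2 * t) - t / (8 * N)) (at t)"
      unfolding e_def G_def[abs_def] using N by (auto intro!: derivative_eq_intros dE simp: algebra_simps)
    moreover have "(e - 2 * E t) * exp (- 2 * t) \<le> t / (8 * N) * 1"
      using e t N by (intro mult_mono) auto
    ultimately show "\<exists>y. (G has_real_derivative y) (at t) \<and> y \<le> 0"
      by force
  qed
  moreover have "E 0 = 0"
    by (simp add: E_def v_def w_def u_def a_def laguerre_0 bessel_0)
  ultimately have "E x * exp (- 2 * x) \<le> x\<^sup>2 / (16 * N)" by (simp add: G_def)
  hence G1: "E x * exp (- 2 * x) * exp (2 * x) \<le> x\<^sup>2 / (16 * N) * exp 8"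
  proof (rule mult_mono)
    show "exp (2 * x) \<le> exp 8" using x by simp
  qed (use N in auto)
  have G2: "E x * exp (- 2 * x) * exp (2 * x) = E x"
    by (simp add: mult.assoc exp_add[symmetric])
  have "E x \<le> exp 8 * x\<^sup>2 / (16 * N)" using G1[unfolded G2] by (simp add: mult.commute)
  moreover have "(v x)\<^sup>2 * N \<le> E x" using x by (simp add: E_def mult.commute)
  ultimately have "(v x)\<^sup>2 * N \<le> exp 8 * x\<^sup>2 / (16 * N)" by linarith
  hence "(v x)\<^sup>2 \<le> (exp 8 * x\<^sup>2 / (16 * N)) / N" using N
    by (subst pos_le_divide_eq; linarith)
  also have "\<dots> = (exp 4 / 4 * x / N)\<^sup>2"
    using exp_add[of 4 "4::real"] by (simp add: power2_eq_square mult_ac)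
  finally have "\<bar>v x\<bar> \<le> \<bar>exp 4 / 4 * x / N\<bar>" by (simp only: abs_le_square_iff)
  thus ?thesis using x N by (simp add: v_def w_def u_def a_def b_def)
qed

section \<open>Oscillatory means\<close>

text \<open>The class of amplitudes. It is closed under differentiation and, after subtraction of
  the value at a point, under division by the corresponding linear factor, as the integrations by
  parts require.\<close>

definition real_entire :: "(real \<Rightarrow> real) \<Rightarrow> bool" where
  "real_entire g \<longleftrightarrow> (\<exists>F. F holomorphic_on UNIV \<and> (\<forall>x. g x = Re (F (of_real x))))"

lemma real_entire_has_derivative:
  assumes "real_entire g"
  obtains g' where "real_entire g'" "\<And>x. (g has_real_derivative g' x) (at x)"
proof -
  obtain F where F: "F holomorphic_on UNIV" "\<And>x. g x = Re (F (of_real x))"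
    using assms by (auto simp: real_entire_def)
  have "((\<lambda>x. Re (F (of_real x))) has_vector_derivative Re (deriv F (of_real x))) (at x)" for x
  proof -
    have "(F has_field_derivative deriv F (of_real x)) (at (of_real x))"
      by (rule holomorphic_derivI[OF F(1)]) auto
    from has_vector_derivative_real_field[OF this] show ?thesis
      by (rule bounded_linear.has_vector_derivative[OF bounded_linear_Re])
  qed
  moreover have "g = (\<lambda>x. Re (F (of_real x)))" using F(2) by auto
  ultimately have "(g has_real_derivative Re (deriv F (of_real x))) (at x)" for x
    by (simp add: has_real_derivative_iff_has_vector_derivative)
  moreover have "real_entire (\<lambda>x. Re (deriv F (of_real x)))"
    unfolding real_entire_def using holomorphic_deriv[OF F(1)] by blast
  ultimately show ?thesis using that by blast
qed

lemma real_entire_continuous: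
  assumes "real_entire g"
  shows "continuous_on S g"
proof -
  obtain g' where "\<And>x. (g has_real_derivative g' x) (at x)"
    using real_entire_has_derivative[OF assms] by blast
  thus ?thesis by (meson DERIV_isCont continuous_at_imp_continuous_on)
qed

text \<open>The removable singularity theorem: the divided difference of an entire function is
  entire.\<close>

lemma real_entire_quotient:
  assumes "real_entire g"
  obtains h where "real_entire h" "\<And>x. g x = g c + (x - c) * h x"
proof -
  obtain F where F: "F holomorphic_on UNIV" "\<And>x. g x = Re (F (of_real x))"
    using assms by (auto simp: real_entire_def)
  let ?c = "of_real c :: complex"
  define H where "H z = (if z = ?c then deriv F ?c else (F z - F ?c) / (z - ?c))" for z
  have H: "H holomorphic_on UNIV"
    unfolding H_def[abs_def] by (rule pole_lemma[OF F(1)]) simp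
  have FH: "F z = F ?c + (z - ?c) * H z" for z by (simp add: H_def)
  show ?thesis
  proof (rule that)
    show "real_entire (\<lambda>x. Re (H (of_real x)))" unfolding real_entire_def using H by blast
    show "g x = g c + (x - c) * Re (H (of_real x))" for x
    proof -
      have "F (of_real x) = F ?c + of_real (x - c) * H (of_real x)"
        using FH[of "of_real x"] by simp
      thus ?thesis by (simp add: F(2))
    qed
  qed
qed

lemma real_entire_polynomial_mult:
  assumes "real_entire g" "P holomorphic_on UNIV" "\<And>x. P (of_real x) = of_real (p x)"
  shows "real_entire (\<lambda>x. p x * g x)"
proof -
  obtain F where F: "F holomorphic_on UNIV" "\<And>x. g x = Re (F (of_real x))"
    using assms(1) by (auto simp: real_entire_def)
  have "(\<lambda>z. P z * F z) holomorphic_on UNIV" by (intro holomorphic_intros assms F)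
  moreover have "p x * g x = Re (P (of_real x) * F (of_real x))" for x by (simp add: assms(3) F(2))
  ultimately show ?thesis unfolding real_entire_def by (intro exI[of _ "\<lambda>z. P z * F z"]) auto
qed

lemma real_entire_diff:
  assumes "real_entire g" "real_entire h"
  shows "real_entire (\<lambda>x. g x - h x)"
proof -
  obtain F where F: "F holomorphic_on UNIV" "\<And>x. g x = Re (F (of_real x))"
    using assms(1) by (auto simp: real_entire_def)
  obtain H where H: "H holomorphic_on UNIV" "\<And>x. h x = Re (H (of_real x))"
    using assms(2) by (auto simp: real_entire_def)
  have "(\<lambda>z. F z - H z) holomorphic_on UNIV" by (intro holomorphic_intros F H)
  thus ?thesis unfolding real_entire_def using F(2) H(2) by (intro exI[of _ "\<lambda>z. F z - H z"]) auto
qed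

lemma real_entire_exp: "real_entire (\<lambda>x. exp (x / 2))"
  unfolding real_entire_def
proof (intro exI[of _ "\<lambda>z. exp (z / 2)"] conjI allI)
  show "exp (x / 2) = Re (exp (complex_of_real x / 2))" for x
    using exp_of_real[of "x / 2"] by (metis Re_complex_of_real of_real_divide of_real_numeral)
qed (auto intro!: holomorphic_intros)

lemma real_entire_const: "real_entire (\<lambda>x. c)"
  unfolding real_entire_def by (rule exI[of _ "\<lambda>_. of_real c"]) auto

text \<open>The order of quantifiers matters: \<open>B\<close> depends on \<open>g\<close> alone and
  thus serves for \<open>bessel (\<theta> * x)\<close> with all \<open>\<theta> \<ge> 0\<close> at
  once.\<close>

lemma arcsine_mean_bounded:
  assumes "continuous_on {0..4} g"
  obtains B where "B \<ge> 0"
    "\<And>f. continuous_on {0..4} f \<Longrightarrow> (\<And>x. x \<in> {0..4} \<Longrightarrow> \<bar>f x\<bar> \<le> 1) \<Longrightarrow> \<bar>arcsine_mean (\<lambda>x. g x * f x)\<bar> \<le> B"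
proof -
  have "bounded (g ` {0..4})" by (intro compact_imp_bounded compact_continuous_image assms) auto
  then obtain B where "\<forall>y\<in>g ` {0..4}. norm y \<le> B" unfolding bounded_iff by blast
  hence B: "\<And>x. x \<in> {0..4} \<Longrightarrow> \<bar>g x\<bar> \<le> B" by auto
  have "B \<ge> 0" using B[of 0] by simp
  show ?thesis
  proof (rule that[OF \<open>B \<ge> 0\<close>], rule arcsine_mean_abs_le)
    fix f :: "real \<Rightarrow> real" assume f: "continuous_on {0..4} f" "\<And>x. x \<in> {0..4} \<Longrightarrow> \<bar>f x\<bar> \<le> 1"
    show "continuous_on {0..4} (\<lambda>x. g x * f x)" by (intro continuous_intros assms f)
    show "\<bar>g x * f x\<bar> \<le> B" if "x \<in> {0..4}" for x
      unfolding abs_mult using mult_mono[OF B[OF that] f(2)[OF that]] \<open>B \<ge> 0\<close> by simp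
  qed
qed

text \<open>Classically \<open>J0(z) * J1(z) = O(1 / z)\<close>. At
  \<open>z = 2 * sqrt \<theta>\<close> the function \<open>bessel'\<close> contributes a further
  factor \<open>1 / sqrt \<theta>\<close>.\<close>

lemma bessel_product_bound:
  obtains C where "\<And>\<theta>. \<theta> \<ge> 1 \<Longrightarrow> \<bar>bessel \<theta> * bessel' \<theta>\<bar> \<le> C / \<theta>"
proof -
  obtain C where C0: "\<And>z. z \<ge> 1 \<Longrightarrow> \<bar>z * (bessel_j0 z)\<^sup>2 - (1 + sin (2 * z)) / pi\<bar> \<le> C / z"
    and C1: "\<And>z. z \<ge> 1 \<Longrightarrow> \<bar>z * (bessel_j1 z)\<^sup>2 - (1 - sin (2 * z)) / pi\<bar> \<le> C / z"
    using bessel_j_asymptotics by blast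
  have Cpos: "C \<ge> 0" using C0[of 1] by simp
  show thesis
  proof (rule that)
    fix \<theta> :: real assume \<theta>: "\<theta> \<ge> 1"
    define s where "s = sqrt \<theta>"
    have s: "s \<ge> 1" "s\<^sup>2 = \<theta>" using \<theta> by (auto simp: s_def)
    define z where "z = 2 * s"
    have z: "z \<ge> 1" using s by (simp add: z_def)
    have "C / z \<le> C" using z Cpos by (simp add: divide_le_eq mult_le_cancel_left1)
    moreover have "(1 + sin (2 * z)) / pi \<le> 2 / pi" "(1 - sin (2 * z)) / pi \<le> 2 / pi"
      using sin_le_one[of "2 * z"] sin_ge_minus_one[of "2 * z"] by (intro divide_right_mono; simp; linarith)+
    ultimately have "z * (bessel_j0 z)\<^sup>2 \<le> 2 / pi + C" "z * (bessel_j1 z)\<^sup>2 \<le> 2 / pi + C"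
      using C0[OF z] C1[OF z] by linarith+
    moreover have "z * (2 * \<bar>bessel_j0 z * bessel_j1 z\<bar>) \<le> z * ((bessel_j0 z)\<^sup>2 + (bessel_j1 z)\<^sup>2)"
      using sum_squares_bound[of "\<bar>bessel_j0 z\<bar>" "\<bar>bessel_j1 z\<bar>"] z by (intro mult_left_mono) (auto simp: abs_mult)
    ultimately have *: "z * \<bar>bessel_j0 z * bessel_j1 z\<bar> \<le> 2 / pi + C" by (simp add: distrib_left)
    have "bessel_j0 z = bessel \<theta>" "bessel_j1 z = s * bessel' \<theta>"
      unfolding bessel_j0_def bessel_j1_def z_def s(2)[symmetric] by (simp_all add: power_mult_distrib)
    with * have "2 * \<theta> * \<bar>bessel \<theta> * bessel' \<theta>\<bar> \<le> 2 / pi + C"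
      using s unfolding z_def s(2)[symmetric] by (simp add: abs_mult power2_eq_square mult_ac)
    hence "\<bar>bessel \<theta> * bessel' \<theta>\<bar> \<le> ((2 / pi + C) / 2) / \<theta>"
      using \<theta> by (simp add: field_simps)
    thus "\<bar>bessel \<theta> * bessel' \<theta>\<bar> \<le> ((2 / pi + C) / 2) / \<theta>" .
  qed
qed

section \<open>Decay of Bessel means with entire amplitude\<close>

lemma bessel_scaled_abs_le_1: "\<theta> \<ge> 0 \<Longrightarrow> x \<in> {0..4} \<Longrightarrow> \<bar>bessel (\<theta> * x)\<bar> \<le> 1"
  by (rule bessel_abs_le_1) simp

text \<open>Integration by parts gains a factor \<open>1 / \<theta>\<close> once the value of the amplitude at the endpoint
  \<open>x = 4\<close> has been split off; for constant amplitude the mean is known exactly.\<close>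

lemma arcsine_mean_entire_bessel':
  assumes "real_entire g"
  obtains C where "\<And>\<theta>. \<theta> \<ge> 1 \<Longrightarrow> \<bar>arcsine_mean (\<lambda>x. g x * (x * bessel' (\<theta> * x)))\<bar> \<le> C / \<theta>"
proof -
  \<comment> \<open>Splitting off \<open>g 4\<close> supplies the factor \<open>4 - x\<close> for
    \<open>arcsine_mean_by_parts\<close>; the factor \<open>x\<close> is already present.\<close>
  obtain h where h: "real_entire h" "\<And>x. g x = g 4 + (x - 4) * h x"
    using real_entire_quotient[OF assms] by blast
  obtain h' where h': "real_entire h'" "\<And>x. (h has_real_derivative h' x) (at x)"
    using real_entire_has_derivative[OF h(1)] by blast
  note ch = real_entire_continuous[OF h(1)] and ch' = real_entire_continuous[OF h'(1)]
  obtain C0 where C0: "\<And>\<theta>. \<theta> \<ge> 1 \<Longrightarrow> \<bar>bessel \<theta> * bessel' \<theta>\<bar> \<le> C0 / \<theta>"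
    using bessel_product_bound by blast
  have "continuous_on {0..4} (\<lambda>x. (x - 2) * h x)" by (intro continuous_intros ch)
  then obtain B1 where B1: "\<And>f. continuous_on {0..4} f \<Longrightarrow> (\<And>x. x \<in> {0..4} \<Longrightarrow> \<bar>f x\<bar> \<le> 1) \<Longrightarrow>
      \<bar>arcsine_mean (\<lambda>x. (x - 2) * h x * f x)\<bar> \<le> B1" using arcsine_mean_bounded by blast
  have "continuous_on {0..4} (\<lambda>x. x * (4 - x) * h' x)" by (intro continuous_intros ch')
  then obtain B2 where B2: "\<And>f. continuous_on {0..4} f \<Longrightarrow> (\<And>x. x \<in> {0..4} \<Longrightarrow> \<bar>f x\<bar> \<le> 1) \<Longrightarrow>
      \<bar>arcsine_mean (\<lambda>x. x * (4 - x) * h' x * f x)\<bar> \<le> B2" using arcsine_mean_bounded by blast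
  show thesis
  proof (rule that)
    fix \<theta> :: real assume \<theta>: "\<theta> \<ge> 1"
    have cb: "continuous_on {0..4} (\<lambda>x. bessel (\<theta> * x))" by (intro continuous_intros)
    have b1: "\<bar>bessel (\<theta> * x)\<bar> \<le> 1" if "x \<in> {0..4}" for x
      using that \<theta> by (intro bessel_scaled_abs_le_1) auto
    have "arcsine_mean (\<lambda>x. x * (4 - x) * (h' x * bessel (\<theta> * x) + \<theta> * (h x * bessel' (\<theta> * x))))
        = arcsine_mean (\<lambda>x. (x - 2) * (h x * bessel (\<theta> * x)))"
    proof (rule arcsine_mean_by_parts)
      show "((\<lambda>x. h x * bessel (\<theta> * x)) has_real_derivative h' x * bessel (\<theta> * x) + \<theta> * (h x * bessel' (\<theta> * x))) (at x)" for x
        by (auto intro!: derivative_eq_intros h')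
      show "continuous_on {0..4} (\<lambda>x. h' x * bessel (\<theta> * x) + \<theta> * (h x * bessel' (\<theta> * x)))"
        by (intro continuous_intros ch ch')
    qed
    also have "arcsine_mean (\<lambda>x. x * (4 - x) * (h' x * bessel (\<theta> * x) + \<theta> * (h x * bessel' (\<theta> * x))))
        = arcsine_mean (\<lambda>x. x * (4 - x) * h' x * bessel (\<theta> * x) + \<theta> * (x * (4 - x) * h x * bessel' (\<theta> * x)))"
      by (rule arcsine_mean_cong) (simp add: algebra_simps)
    also have "\<dots> = arcsine_mean (\<lambda>x. x * (4 - x) * h' x * bessel (\<theta> * x))
        + \<theta> * arcsine_mean (\<lambda>x. x * (4 - x) * h x * bessel' (\<theta> * x))"
      by (subst arcsine_mean_add) (auto intro!: continuous_intros ch ch' simp: arcsine_mean_cmult)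
    also have "arcsine_mean (\<lambda>x. (x - 2) * (h x * bessel (\<theta> * x))) = arcsine_mean (\<lambda>x. (x - 2) * h x * bessel (\<theta> * x))"
      by (simp add: mult.assoc)
    finally have "\<theta> * arcsine_mean (\<lambda>x. x * (4 - x) * h x * bessel' (\<theta> * x))
        = arcsine_mean (\<lambda>x. (x - 2) * h x * bessel (\<theta> * x)) - arcsine_mean (\<lambda>x. x * (4 - x) * h' x * bessel (\<theta> * x))"
      by simp
    hence "\<bar>\<theta> * arcsine_mean (\<lambda>x. x * (4 - x) * h x * bessel' (\<theta> * x))\<bar> \<le> B1 + B2"
      using B1[OF cb b1] B2[OF cb b1] by linarith
    hence osc: "\<bar>arcsine_mean (\<lambda>x. x * (4 - x) * h x * bessel' (\<theta> * x))\<bar> \<le> (B1 + B2) / \<theta>"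
      using \<theta> by (simp add: abs_mult field_simps)
    have "arcsine_mean (\<lambda>x. g x * (x * bessel' (\<theta> * x)))
        = arcsine_mean (\<lambda>x. g 4 * (x * bessel' (\<theta> * x)) - x * (4 - x) * h x * bessel' (\<theta> * x))"
    proof (rule arcsine_mean_cong)
      show "g x * (x * bessel' (\<theta> * x)) = g 4 * (x * bessel' (\<theta> * x)) - x * (4 - x) * h x * bessel' (\<theta> * x)" for x
        by (subst h(2)) (simp add: algebra_simps)
    qed
    also have "\<dots> = g 4 * (2 * bessel \<theta> * bessel' \<theta>) - arcsine_mean (\<lambda>x. x * (4 - x) * h x * bessel' (\<theta> * x))"
      by (subst arcsine_mean_diff) (auto intro!: continuous_intros ch simp: arcsine_mean_cmult arcsine_mean_x_bessel')
    finally have eq: "arcsine_mean (\<lambda>x. g x * (x * bessel' (\<theta> * x)))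
        = (2 * g 4) * (bessel \<theta> * bessel' \<theta>) - arcsine_mean (\<lambda>x. x * (4 - x) * h x * bessel' (\<theta> * x))"
      by (simp add: mult_ac)
    have "\<bar>(2 * g 4) * (bessel \<theta> * bessel' \<theta>)\<bar> \<le> \<bar>2 * g 4\<bar> * (C0 / \<theta>)"
      unfolding abs_mult[of "2 * g 4"] by (intro mult_left_mono C0 \<theta>) auto
    hence "\<bar>arcsine_mean (\<lambda>x. g x * (x * bessel' (\<theta> * x)))\<bar> \<le> \<bar>2 * g 4\<bar> * (C0 / \<theta>) + (B1 + B2) / \<theta>"
      unfolding eq using osc by linarith
    also have "\<dots> = (\<bar>2 * g 4\<bar> * C0 + (B1 + B2)) / \<theta>" by (simp add: add_divide_distrib)
    finally show "\<bar>arcsine_mean (\<lambda>x. g x * (x * bessel' (\<theta> * x)))\<bar> \<le> (\<bar>2 * g 4\<bar> * C0 + (B1 + B2)) / \<theta>" .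
  qed
qed

text \<open>By Bessel's equation \<open>- bessel (\<theta> * x)\<close> is the derivative in
  \<open>x\<close> of \<open>x * bessel' (\<theta> * x)\<close>. Integration by parts thus leads to
  another entire amplitude times \<open>x * bessel'\<close>, and
  \<open>arcsine_mean_entire_bessel'\<close> provides the decay.\<close>

lemma arcsine_mean_entire_bessel:
  assumes "real_entire g"
  obtains C where "\<And>\<theta>. \<theta> \<ge> 1 \<Longrightarrow> \<bar>arcsine_mean (\<lambda>x. x * (4 - x) * g x * bessel (\<theta> * x))\<bar> \<le> C / \<theta>"
proof -
  obtain g' where g': "real_entire g'" "\<And>x. (g has_real_derivative g' x) (at x)"
    using real_entire_has_derivative[OF assms] by blast
  note cg = real_entire_continuous[OF assms] and cg' = real_entire_continuous[OF g'(1)]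
  define h where "h x = x * (4 - x) * g' x - (x - 2) * g x" for x
  have "real_entire h"
    unfolding h_def[abs_def]
  proof (intro real_entire_diff)
    show "real_entire (\<lambda>x. x * (4 - x) * g' x)"
      by (rule real_entire_polynomial_mult[OF g'(1), of "\<lambda>z. z * (4 - z)"]) (auto intro!: holomorphic_intros)
    show "real_entire (\<lambda>x. (x - 2) * g x)"
      by (rule real_entire_polynomial_mult[OF assms, of "\<lambda>z. z - 2"]) (auto intro!: holomorphic_intros)
  qed
  then obtain C where C: "\<And>\<theta>. \<theta> \<ge> 1 \<Longrightarrow> \<bar>arcsine_mean (\<lambda>x. h x * (x * bessel' (\<theta> * x)))\<bar> \<le> C / \<theta>"
    using arcsine_mean_entire_bessel' by blast
  show thesis
  proof (rule that)
    fix \<theta> :: real assume \<theta>: "\<theta> \<ge> 1"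
    have "arcsine_mean (\<lambda>x. x * (4 - x) * (g' x * (x * bessel' (\<theta> * x)) - g x * bessel (\<theta> * x)))
        = arcsine_mean (\<lambda>x. (x - 2) * (g x * (x * bessel' (\<theta> * x))))"
    proof (rule arcsine_mean_by_parts)
      fix x
      have "((\<lambda>x. g x * (x * bessel' (\<theta> * x))) has_real_derivative
          g' x * (x * bessel' (\<theta> * x)) + g x * (\<theta> * x * bessel'' (\<theta> * x) + bessel' (\<theta> * x))) (at x)"
        by (auto intro!: derivative_eq_intros g' simp: algebra_simps)
      also have "\<theta> * x * bessel'' (\<theta> * x) + bessel' (\<theta> * x) = - bessel (\<theta> * x)"
        using bessel_ode[of "\<theta> * x"] by linarith
      finally show "((\<lambda>x. g x * (x * bessel' (\<theta> * x))) has_real_derivative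
          g' x * (x * bessel' (\<theta> * x)) - g x * bessel (\<theta> * x)) (at x)" by simp
    next
      show "continuous_on {0..4} (\<lambda>x. g' x * (x * bessel' (\<theta> * x)) - g x * bessel (\<theta> * x))"
        by (intro continuous_intros cg cg')
    qed
    also have "arcsine_mean (\<lambda>x. x * (4 - x) * (g' x * (x * bessel' (\<theta> * x)) - g x * bessel (\<theta> * x)))
        = arcsine_mean (\<lambda>x. x * (4 - x) * g' x * (x * bessel' (\<theta> * x)) - x * (4 - x) * g x * bessel (\<theta> * x))"
      by (rule arcsine_mean_cong) (simp add: algebra_simps)
    also have "\<dots> = arcsine_mean (\<lambda>x. x * (4 - x) * g' x * (x * bessel' (\<theta> * x))) - arcsine_mean (\<lambda>x. x * (4 - x) * g x * bessel (\<theta> * x))"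
      by (intro arcsine_mean_diff continuous_intros cg cg')
    finally have "arcsine_mean (\<lambda>x. x * (4 - x) * g x * bessel (\<theta> * x))
        = arcsine_mean (\<lambda>x. x * (4 - x) * g' x * (x * bessel' (\<theta> * x))) - arcsine_mean (\<lambda>x. (x - 2) * (g x * (x * bessel' (\<theta> * x))))"
      by simp
    also have "\<dots> = arcsine_mean (\<lambda>x. x * (4 - x) * g' x * (x * bessel' (\<theta> * x)) - (x - 2) * (g x * (x * bessel' (\<theta> * x))))"
      by (intro arcsine_mean_diff[symmetric] continuous_intros cg cg')
    also have "\<dots> = arcsine_mean (\<lambda>x. h x * (x * bessel' (\<theta> * x)))"
      by (rule arcsine_mean_cong) (simp add: h_def algebra_simps)
    finally show "\<bar>arcsine_mean (\<lambda>x. x * (4 - x) * g x * bessel (\<theta> * x))\<bar> \<le> C / \<theta>" using C[OF \<theta>] by simp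
  qed
qed

section \<open>The asymptotic expansion\<close>

definition durfee_poly :: "nat \<Rightarrow> real \<Rightarrow> real" where
  "durfee_poly n x = (\<Sum>k<n. (-1) ^ k * real (n choose Suc k) / fact (Suc k) * x ^ k)"

lemma expected_durfee_eq_mean:
  assumes "n \<ge> 1"
  shows "expected_durfee n = arcsine_mean (durfee_poly n)"
proof -
  have "arcsine_mean (durfee_poly n)
      = (\<Sum>k<n. arcsine_mean (\<lambda>x. (-1) ^ k * real (n choose Suc k) / fact (Suc k) * x ^ k))"
    unfolding durfee_poly_def[abs_def] by (intro arcsine_mean_sum continuous_intros) auto
  also have "\<dots> = expected_durfee n"
    unfolding expected_durfee_binomial_sum[OF assms] arcsine_mean_cmult arcsine_mean_power
    by (intro sum.cong refl) (simp add: mult_ac)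
  finally show ?thesis ..
qed

lemma durfee_poly_laguerre: "x * durfee_poly n x = 1 - laguerre n x"
proof -
  have "laguerre n x = laguerre_coeff n 0 * x ^ 0 + (\<Sum>k<n. laguerre_coeff n (Suc k) * x ^ Suc k)"
    unfolding laguerre_eq_sum by (rule sum.atMost_shift)
  also have "(\<Sum>k<n. laguerre_coeff n (Suc k) * x ^ Suc k) = - (x * durfee_poly n x)"
    unfolding durfee_poly_def sum_distrib_left sum_negf[symmetric]
    by (intro sum.cong refl) (simp add: laguerre_coeff_def mult_ac del: fact_Suc)
  finally show ?thesis by (simp add: laguerre_coeff_def)
qed

lemma continuous_durfee_poly: "continuous_on S (durfee_poly n)"
  unfolding durfee_poly_def[abs_def] by (intro continuous_intros) auto

lemma continuous_bessel_quotient: "continuous_on S bessel_quotient"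
proof -
  have "(bessel_quotient has_real_derivative (\<Sum>k. diffs (\<lambda>k. - bessel_coeff (Suc k)) k * q ^ k)) (at q)" for q
    unfolding bessel_quotient_def[abs_def]
    by (rule termdiffs_strong_converges_everywhere) (rule summable_bessel_quotient)
  thus ?thesis by (meson DERIV_isCont continuous_at_imp_continuous_on)
qed

text \<open>The Laguerre approximation divided by \<open>x\<close>: its error is proportional to
  \<open>x\<close>, so the quotient is uniform, and \<open>x = 0\<close> is reached by continuity.
  \<open>exp 6\<close> combines \<open>exp 4\<close> with
  \<open>exp (x / 2) \<le> exp 2\<close>.\<close>

lemma durfee_poly_approximation:
  fixes n :: nat and x :: real
  defines "N \<equiv> real n + 1 / 2"
  assumes n: "n \<ge> 1" and p: "\<And>x. 1 - exp (x / 2) = x * p x" "continuous_on {0..4} p"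
    and x: "x \<in> {0..4}"
  shows "\<bar>durfee_poly n x - (N * bessel_quotient (N * x) + p x * bessel (N * x)
            + exp (x / 2) / 12 * (x * bessel' (N * x)))\<bar> \<le> exp 6 / 4 / N"
proof -
  have N: "N \<ge> 1" using n by (simp add: N_def)
  define err where "err x = durfee_poly n x - (N * bessel_quotient (N * x) + p x * bessel (N * x)
            + exp (x / 2) / 12 * (x * bessel' (N * x)))" for x
  have pos: "norm (err y) \<le> exp 6 / 4 / N" if y: "y \<in> {0<..4}" for y
  proof -
    define v where "v = exp (- y / 2) * laguerre n y - (bessel (N * y) - y\<^sup>2 / 12 * bessel' (N * y))"
    have v: "\<bar>v\<bar> \<le> exp 4 / 4 * y / N"
      unfolding v_def N_def using y by (intro laguerre_bessel_approximation n) auto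
    have L: "laguerre n y = exp (y / 2) * (v + (bessel (N * y) - y\<^sup>2 / 12 * bessel' (N * y)))"
      unfolding v_def by (simp add: mult.assoc[symmetric] exp_add[symmetric])
    have "y * err y = (1 - laguerre n y) - (N * y) * bessel_quotient (N * y) - (y * p y) * bessel (N * y)
        - exp (y / 2) * (y\<^sup>2 / 12 * bessel' (N * y))"
      unfolding durfee_poly_laguerre[symmetric] by (simp add: err_def power2_eq_square algebra_simps)
    also have "\<dots> = - (exp (y / 2) * v)"
      unfolding L bessel_quotient_eq p(1)[symmetric] by (simp add: algebra_simps)
    finally have "y * \<bar>err y\<bar> = exp (y / 2) * \<bar>v\<bar>"
      using y by (metis abs_exp_cancel abs_minus_cancel abs_mult abs_of_pos greaterThanAtMost_iff)
    also have "\<dots> \<le> exp 2 * (exp 4 / 4 * y / N)"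
      using y by (intro mult_mono v) auto
    also have "\<dots> = y * (exp 6 / 4 / N)"
      using exp_add[of 2 "4::real"] by simp
    finally have "\<bar>err y\<bar> \<le> exp 6 / 4 / N" by (rule mult_left_le_imp_le) (use y in simp)
    thus ?thesis by simp
  qed
  have cont: "continuous_on (closure {0<..4}) err"
    unfolding err_def[abs_def]
    by (auto intro!: continuous_intros continuous_durfee_poly p(2)
        continuous_on_compose2[OF continuous_bessel_quotient[of UNIV]])
  have "norm (err x) \<le> exp 6 / 4 / N"
    by (rule continuous_on_closure_norm_le[OF cont]) (use pos x in auto)
  thus ?thesis by (simp add: err_def)
qed

text \<open>Linear interpolation of \<open>p\<close> between \<open>p 0 = - 1 / 2\<close> and
  \<open>p 4 = (1 - exp 2) / 4\<close>, whence the constant \<open>(exp 2 - 3) / 16\<close>. The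
  remainder vanishes at both nodes and splits off \<open>x * (4 - x)\<close>.\<close>

lemma exp_quotient_decomposition:
  obtains p r where "\<And>x. 1 - exp (x / 2) = x * p x" "continuous_on {0..4} p" "real_entire r"
    "\<And>x. p x = (1 - exp 2) / 4 + (4 - x) * ((exp 2 - 3) / 16) + x * (4 - x) * r x"
proof -
  have "real_entire (\<lambda>x. 1 - exp (x / 2))"
    by (intro real_entire_diff real_entire_exp real_entire_const)
  then obtain p where p: "real_entire p" "\<And>x. 1 - exp (x / 2) = (1 - exp (0 / 2)) + (x - 0) * p x"
    using real_entire_quotient[of "\<lambda>x. 1 - exp (x / 2)" 0] by blast
  hence p': "\<And>x. 1 - exp (x / 2) = x * p x" by simp
  have p4: "p 4 = (1 - exp 2) / 4" using p'[of 4] by simp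
  \<comment> \<open>At 0 the relation \<open>1 - exp (x / 2) = x * p x\<close> says nothing about
    \<open>p\<close>, so it is differentiated.\<close>
  have p0: "p 0 = - 1 / 2"
  proof -
    obtain q where "\<And>x. (p has_real_derivative q x) (at x)" using real_entire_has_derivative[OF p(1)] by blast
    hence "((\<lambda>x. x * p x) has_real_derivative p 0) (at 0)" by (auto intro!: derivative_eq_intros)
    moreover have "((\<lambda>x. 1 - exp (x / 2)) has_real_derivative - 1 / 2) (at (0::real))"
      by (auto intro!: derivative_eq_intros)
    ultimately show ?thesis using p' by (simp add: DERIV_unique)
  qed
  define B where "B = (exp 2 - 3) / (16 :: real)"
  have cB: "real_entire (\<lambda>x. (4 - x) * B)"
    by (rule real_entire_polynomial_mult[OF real_entire_const, of "\<lambda>z. 4 - z"]) (auto intro!: holomorphic_intros)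
  have "real_entire (\<lambda>x. p x - (1 - exp 2) / 4 - (4 - x) * B)"
    by (intro real_entire_diff p(1) real_entire_const cB)
  then obtain h where h: "real_entire h"
    "\<And>x. p x - (1 - exp 2) / 4 - (4 - x) * B = (p 4 - (1 - exp 2) / 4 - (4 - 4) * B) + (x - 4) * h x"
    using real_entire_quotient[of "\<lambda>x. p x - (1 - exp 2) / 4 - (4 - x) * B" 4] by blast
  have "h 0 = 0" using h(2)[of 0] unfolding p0 p4 B_def by (simp add: field_simps)
  obtain g where g: "real_entire g" "\<And>x. h x = h 0 + (x - 0) * g x"
    using real_entire_quotient[OF h(1), of 0] by blast
  have r: "real_entire (\<lambda>x. 0 - g x)" by (intro real_entire_diff real_entire_const g)
  have "p x = (1 - exp 2) / 4 + (4 - x) * ((exp 2 - 3) / 16) + x * (4 - x) * (0 - g x)" for x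
    using h(2)[of x] g(2)[of x] \<open>h 0 = 0\<close> unfolding p4 B_def by (simp add: algebra_simps)
  thus ?thesis using that p' real_entire_continuous[OF p(1)] r by blast
qed

text \<open>The interpolated amplitude has exact means: a constant gives \<open>J0^2\<close>, and
  \<open>4 - x\<close> gives \<open>2 * (J0^2 + J1^2)\<close>. This energy does not oscillate to
  leading order, so the oscillation with \<open>exp 2\<close> comes from \<open>p 4\<close>
  alone.\<close>

lemma expected_durfee_bessel:
  obtains C where "\<And>n N. n \<ge> 1 \<Longrightarrow> N = real n + 1 / 2 \<Longrightarrow>
    \<bar>expected_durfee n - (2 * N * ((bessel N)\<^sup>2 + N * (bessel' N)\<^sup>2) + N * bessel N * bessel' N
       + (1 - exp 2) / 4 * (bessel N)\<^sup>2 + (exp 2 - 3) / 8 * ((bessel N)\<^sup>2 + N * (bessel' N)\<^sup>2))\<bar> \<le> C / N"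
proof -
  obtain p r where p: "\<And>x. 1 - exp (x / 2) = x * p x" "continuous_on {0..4} p" and r: "real_entire r"
    and pr: "\<And>x. p x = (1 - exp 2) / 4 + (4 - x) * ((exp 2 - 3) / 16) + x * (4 - x) * r x"
    using exp_quotient_decomposition by blast
  obtain C1 where C1: "\<And>\<theta>. \<theta> \<ge> 1 \<Longrightarrow> \<bar>arcsine_mean (\<lambda>x. x * (4 - x) * r x * bessel (\<theta> * x))\<bar> \<le> C1 / \<theta>"
    using arcsine_mean_entire_bessel[OF r] by blast
  obtain C2 where C2: "\<And>\<theta>. \<theta> \<ge> 1 \<Longrightarrow> \<bar>arcsine_mean (\<lambda>x. exp (x / 2) * (x * bessel' (\<theta> * x)))\<bar> \<le> C2 / \<theta>"
    using arcsine_mean_entire_bessel'[OF real_entire_exp] by blast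
  show thesis
  proof (rule that)
    fix n :: nat and N :: real assume n: "n \<ge> 1" and N_def: "N = real n + 1 / 2"
    have N: "N \<ge> 1" using n by (simp add: N_def)
    note cq = continuous_on_compose2[OF continuous_bessel_quotient[of UNIV]]
    define app where "app x = N * bessel_quotient (N * x) + p x * bessel (N * x)
        + exp (x / 2) / 12 * (x * bessel' (N * x))" for x
    have capp: "continuous_on {0..4} app"
      unfolding app_def by (auto intro!: continuous_intros p cq)
    have "\<bar>arcsine_mean (\<lambda>x. durfee_poly n x - app x)\<bar> \<le> exp 6 / 4 / N"
    proof (rule arcsine_mean_abs_le)
      show "continuous_on {0..4} (\<lambda>x. durfee_poly n x - app x)"
        by (intro continuous_intros continuous_durfee_poly capp)
      show "\<bar>durfee_poly n x - app x\<bar> \<le> exp 6 / 4 / N" if "x \<in> {0..4}" for x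
        using durfee_poly_approximation[OF n p that] by (simp add: app_def N_def)
    qed
    moreover have "arcsine_mean (\<lambda>x. durfee_poly n x - app x) = expected_durfee n - arcsine_mean app"
      unfolding expected_durfee_eq_mean[OF n] by (intro arcsine_mean_diff continuous_durfee_poly capp)
    ultimately have 1: "\<bar>expected_durfee n - arcsine_mean app\<bar> \<le> exp 6 / 4 / N" by simp
    define R1 where "R1 = arcsine_mean (\<lambda>x. x * (4 - x) * r x * bessel (N * x))"
    define R2 where "R2 = arcsine_mean (\<lambda>x. exp (x / 2) * (x * bessel' (N * x)))"
    have "arcsine_mean app = arcsine_mean (\<lambda>x. N * bessel_quotient (N * x) + p x * bessel (N * x))
        + arcsine_mean (\<lambda>x. 1 / 12 * (exp (x / 2) * (x * bessel' (N * x))))"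
    proof -
      have "app = (\<lambda>x. (N * bessel_quotient (N * x) + p x * bessel (N * x)) + 1 / 12 * (exp (x / 2) * (x * bessel' (N * x))))"
        by (auto simp: app_def)
      thus ?thesis by (simp only:) (rule arcsine_mean_add; auto intro!: continuous_intros p cq)
    qed
    also have "arcsine_mean (\<lambda>x. N * bessel_quotient (N * x) + p x * bessel (N * x))
        = N * arcsine_mean (\<lambda>x. bessel_quotient (N * x)) + arcsine_mean (\<lambda>x. p x * bessel (N * x))"
      unfolding arcsine_mean_cmult[symmetric] by (rule arcsine_mean_add; auto intro!: continuous_intros p cq)
    also have "arcsine_mean (\<lambda>x. p x * bessel (N * x)) = ((1 - exp 2) / 4 + 4 * ((exp 2 - 3) / 16)) * (bessel N)\<^sup>2
        - (exp 2 - 3) / 16 * (2 * (bessel N)\<^sup>2 - 2 * N * (bessel' N)\<^sup>2) + R1"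
    proof -
      define a where "a = (1 - exp 2) / 4 + 4 * ((exp 2 - 3) / (16 :: real))"
      define b where "b = (exp 2 - 3) / (16 :: real)"
      have cr: "continuous_on {0..4} r" by (rule real_entire_continuous[OF r])
      have "arcsine_mean (\<lambda>x. p x * bessel (N * x))
          = arcsine_mean (\<lambda>x. (a * bessel (N * x) - b * (x * bessel (N * x))) + x * (4 - x) * r x * bessel (N * x))"
        by (rule arcsine_mean_cong) (simp add: pr a_def b_def field_simps)
      also have "\<dots> = arcsine_mean (\<lambda>x. a * bessel (N * x) - b * (x * bessel (N * x))) + R1"
        unfolding R1_def by (intro arcsine_mean_add continuous_intros cr)
      also have "arcsine_mean (\<lambda>x. a * bessel (N * x) - b * (x * bessel (N * x)))
          = arcsine_mean (\<lambda>x. a * bessel (N * x)) - arcsine_mean (\<lambda>x. b * (x * bessel (N * x)))"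
        by (intro arcsine_mean_diff continuous_intros)
      finally show ?thesis
        unfolding arcsine_mean_cmult arcsine_mean_bessel arcsine_mean_x_bessel a_def b_def .
    qed
    also have "N * arcsine_mean (\<lambda>x. bessel_quotient (N * x))
        = 2 * N * ((bessel N)\<^sup>2 + N * (bessel' N)\<^sup>2) + N * bessel N * bessel' N"
      using N by (intro arcsine_mean_bessel_quotient) auto
    finally have 2: "arcsine_mean app = 2 * N * ((bessel N)\<^sup>2 + N * (bessel' N)\<^sup>2) + N * bessel N * bessel' N
       + (1 - exp 2) / 4 * (bessel N)\<^sup>2 + (exp 2 - 3) / 8 * ((bessel N)\<^sup>2 + N * (bessel' N)\<^sup>2) + R1 + R2 / 12"
      unfolding arcsine_mean_cmult R2_def by (simp add: field_simps)
    have R: "\<bar>R1\<bar> \<le> C1 / N" "\<bar>R2\<bar> \<le> C2 / N" unfolding R1_def R2_def by (intro C1 C2 N)+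
    have split: "\<bar>d - m\<bar> \<le> t + c + c' / 12"
      if "\<bar>d - (m + r + r' / 12)\<bar> \<le> t" "\<bar>r\<bar> \<le> c" "\<bar>r'\<bar> \<le> c'" for d m r r' t c c' :: real
      using that by linarith
    have "\<bar>expected_durfee n - (2 * N * ((bessel N)\<^sup>2 + N * (bessel' N)\<^sup>2) + N * bessel N * bessel' N
       + (1 - exp 2) / 4 * (bessel N)\<^sup>2 + (exp 2 - 3) / 8 * ((bessel N)\<^sup>2 + N * (bessel' N)\<^sup>2))\<bar>
       \<le> exp 6 / 4 / N + C1 / N + (C2 / N) / 12"
      by (rule split[OF 1[unfolded 2] R])
    also have "\<dots> = (exp 6 / 4 + C1 + C2 / 12) / N" by (simp add: add_divide_distrib)
    finally show "\<bar>expected_durfee n - (2 * N * ((bessel N)\<^sup>2 + N * (bessel' N)\<^sup>2) + N * bessel N * bessel' N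
       + (1 - exp 2) / 4 * (bessel N)\<^sup>2 + (exp 2 - 3) / 8 * ((bessel N)\<^sup>2 + N * (bessel' N)\<^sup>2))\<bar>
       \<le> (exp 6 / 4 + C1 + C2 / 12) / N" .
  qed
qed

lemma expected_durfee_shifted_asymptotics:
  obtains C where "\<And>n z. n \<ge> 1 \<Longrightarrow> z = 2 * sqrt (real n + 1 / 2) \<Longrightarrow>
    \<bar>expected_durfee n - (z / pi - 5 / (8 * pi * z) - exp 2 * sin (2 * z) / (4 * pi * z))\<bar> \<le> C / z\<^sup>2"
proof -
  obtain C0 where C0: "\<And>n N. n \<ge> 1 \<Longrightarrow> N = real n + 1 / 2 \<Longrightarrow>
    \<bar>expected_durfee n - (2 * N * ((bessel N)\<^sup>2 + N * (bessel' N)\<^sup>2) + N * bessel N * bessel' N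
       + (1 - exp 2) / 4 * (bessel N)\<^sup>2 + (exp 2 - 3) / 8 * ((bessel N)\<^sup>2 + N * (bessel' N)\<^sup>2))\<bar> \<le> C0 / N"
    using expected_durfee_bessel by blast
  obtain C1 where C1: "\<And>z. z \<ge> 1 \<Longrightarrow>
    \<bar>z\<^sup>2 / 2 * ((bessel_j0 z)\<^sup>2 + (bessel_j1 z)\<^sup>2) + z / 2 * bessel_j0 z * bessel_j1 z
      - (z / pi + 1 / (8 * pi * z) - (1 + sin (2 * z)) / (4 * pi * z))\<bar> \<le> C1 / z\<^sup>2"
    using bessel_j_energy_asymptotics by blast
  obtain C2 where C2: "\<And>z. z \<ge> 1 \<Longrightarrow> \<bar>z * (bessel_j0 z)\<^sup>2 - (1 + sin (2 * z)) / pi\<bar> \<le> C2 / z"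
    "\<And>z. z \<ge> 1 \<Longrightarrow> \<bar>z * (bessel_j1 z)\<^sup>2 - (1 - sin (2 * z)) / pi\<bar> \<le> C2 / z"
    using bessel_j_asymptotics by blast
  define a where "a = (1 - exp 2) / (4 :: real)"
  define b where "b = (exp 2 - 3) / (8 :: real)"
  define K where "K = 4 * C0 + C1 + \<bar>a\<bar> * C2 + \<bar>b\<bar> * (2 * C2)"
  show thesis
  proof (rule that)
    fix n :: nat and z :: real assume n: "n \<ge> 1" and z_def: "z = 2 * sqrt (real n + 1 / 2)"
    define N where "N = real n + 1 / 2"
    define s where "s = sqrt N"
    have s: "s \<ge> 1" "s\<^sup>2 = N" using n by (auto simp: s_def N_def)
    have "z = 2 * s" by (simp add: z_def s_def N_def)
    hence z: "z = 2 * s" "z \<ge> 1" "N = z\<^sup>2 / 4" using s by auto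
    have j0: "bessel N = bessel_j0 z" unfolding bessel_j0_def z(3) ..
    have j1: "N * (bessel' N)\<^sup>2 = (bessel_j1 z)\<^sup>2"
      unfolding bessel_j1_def z(3)[symmetric] using z(1) s(2) by (simp add: power_mult_distrib)
    have j01: "N * bessel N * bessel' N = z / 2 * bessel_j0 z * bessel_j1 z"
      unfolding bessel_j1_def z(3)[symmetric] j0[symmetric] using z(1) s(2) by (simp add: power2_eq_square)
    have e0: "\<bar>(bessel_j0 z)\<^sup>2 - (1 + sin (2 * z)) / pi / z\<bar> \<le> C2 / z\<^sup>2"
      and e1: "\<bar>(bessel_j1 z)\<^sup>2 - (1 - sin (2 * z)) / pi / z\<bar> \<le> C2 / z\<^sup>2"
    proof -
      have div: "\<bar>y - w / z\<bar> \<le> C2 / z\<^sup>2" if "\<bar>z * y - w\<bar> \<le> C2 / z" for y w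
      proof -
        have "y - w / z = (z * y - w) / z" using z(2) by (simp add: field_simps)
        hence "\<bar>y - w / z\<bar> = \<bar>z * y - w\<bar> / z" using z(2) by simp
        also have "\<dots> \<le> C2 / z / z" using that z(2) by (intro divide_right_mono) auto
        finally show ?thesis by (simp add: power2_eq_square)
      qed
      show "\<bar>(bessel_j0 z)\<^sup>2 - (1 + sin (2 * z)) / pi / z\<bar> \<le> C2 / z\<^sup>2" by (rule div[OF C2(1)[OF z(2)]])
      show "\<bar>(bessel_j1 z)\<^sup>2 - (1 - sin (2 * z)) / pi / z\<bar> \<le> C2 / z\<^sup>2" by (rule div[OF C2(2)[OF z(2)]])
    qed
    define F where "F = z\<^sup>2 / 2 * ((bessel_j0 z)\<^sup>2 + (bessel_j1 z)\<^sup>2) + z / 2 * bessel_j0 z * bessel_j1 z"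
    define F0 where "F0 = z / pi + 1 / (8 * pi * z) - (1 + sin (2 * z)) / (4 * pi * z)"
    have "C0 / N = 4 * C0 / z\<^sup>2" unfolding z(3) by simp
    hence t0: "\<bar>expected_durfee n - (F + a * (bessel_j0 z)\<^sup>2 + b * ((bessel_j0 z)\<^sup>2 + (bessel_j1 z)\<^sup>2))\<bar> \<le> 4 * C0 / z\<^sup>2"
      using C0[OF n N_def] unfolding j1 j01 unfolding j0 a_def[symmetric] b_def[symmetric] F_def
      unfolding z(3) by simp
    have t1: "\<bar>F - F0\<bar> \<le> C1 / z\<^sup>2" unfolding F_def F0_def by (rule C1[OF z(2)])
    have t2: "\<bar>a * (bessel_j0 z)\<^sup>2 - a * ((1 + sin (2 * z)) / pi / z)\<bar> \<le> \<bar>a\<bar> * (C2 / z\<^sup>2)"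
      unfolding right_diff_distrib[symmetric] abs_mult by (intro mult_left_mono e0) auto
    have t3: "\<bar>b * ((bessel_j0 z)\<^sup>2 + (bessel_j1 z)\<^sup>2) - b * (2 / pi / z)\<bar> \<le> \<bar>b\<bar> * (2 * C2 / z\<^sup>2)"
    proof -
      have "(1 + sin (2 * z)) / pi / z + (1 - sin (2 * z)) / pi / z = 2 / pi / z"
        by (simp add: add_divide_distrib[symmetric])
      hence "\<bar>((bessel_j0 z)\<^sup>2 + (bessel_j1 z)\<^sup>2) - 2 / pi / z\<bar> \<le> C2 / z\<^sup>2 + C2 / z\<^sup>2"
        using e0 e1 by linarith
      thus ?thesis unfolding right_diff_distrib[symmetric] abs_mult by (intro mult_left_mono) auto
    qed
    \<comment> \<open>In units of \<open>1 / (pi * z)\<close>: in the constant part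
      \<open>exp 2\<close> cancels and \<open>1/8 - 1/4 + 1/4 - 3/4 = - 5/8\<close> remains; in the
      oscillating part \<open>- 1/4 + 1/4\<close> cancels and \<open>- exp 2 / 4\<close>
      remains.\<close>
    have "F0 + a * ((1 + sin (2 * z)) / pi / z) + b * (2 / pi / z)
        = z / pi - 5 / (8 * pi * z) - exp 2 * sin (2 * z) / (4 * pi * z)"
      unfolding F0_def a_def b_def using z(2) by (simp add: field_simps)
    hence "\<bar>expected_durfee n - (z / pi - 5 / (8 * pi * z) - exp 2 * sin (2 * z) / (4 * pi * z))\<bar>
        \<le> 4 * C0 / z\<^sup>2 + C1 / z\<^sup>2 + \<bar>a\<bar> * (C2 / z\<^sup>2) + \<bar>b\<bar> * (2 * C2 / z\<^sup>2)"
      using t0 t1 t2 t3 by linarith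
    also have "\<dots> = K / z\<^sup>2" by (simp add: K_def add_divide_distrib)
    finally show "\<bar>expected_durfee n - (z / pi - 5 / (8 * pi * z) - exp 2 * sin (2 * z) / (4 * pi * z))\<bar> \<le> K / z\<^sup>2" .
  qed
qed

section \<open>From n + 1/2 back to n\<close>

lemma abs_sin_diff_le: "\<bar>sin x - sin y\<bar> \<le> \<bar>x - y\<bar>" for x y :: real
proof -
  have "\<bar>sin ((x - y) / 2) * cos ((x + y) / 2)\<bar> \<le> \<bar>(x - y) / 2\<bar> * 1"
    unfolding abs_mult by (intro mult_mono abs_sin_x_le_abs_x) auto
  thus ?thesis unfolding sin_diff_sin by (simp add: abs_mult)
qed

text \<open>From \<open>z^2 - y^2 = 2\<close> follows \<open>z - y \<le> 1 / y\<close>. Changing the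
  phase and changing the denominator together cost at most \<open>3 / y^2\<close>, and
  \<open>y^2 = 4 * m\<close>.\<close>

lemma sin_over_shift_bound:
  assumes m: "m \<ge> (1 :: real)"
  defines "z \<equiv> 2 * sqrt (m + 1 / 2)" and "y \<equiv> 2 * sqrt m"
  shows "\<bar>sin (2 * z) / z - sin (2 * y) / y\<bar> \<le> 1 / m"
proof -
  have y: "y > 0" "y * y = 4 * m" using m by (auto simp: y_def)
  have zz: "z * z = 4 * m + 2" using m by (simp add: z_def)
  have zy: "z \<ge> y" using m by (simp add: z_def y_def)
  have "(z - y) * (z + y) = 2" using y zz by (simp add: algebra_simps)
  moreover have "(z - y) * (2 * y) \<le> (z - y) * (z + y)"
    using zy by (intro mult_left_mono) auto
  ultimately have "(z - y) * y \<le> 1" by simp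
  hence d: "z - y \<le> 1 / y" using y by (simp add: pos_le_divide_eq)
  have "\<bar>sin (2 * z) - sin (2 * y)\<bar> \<le> \<bar>2 * z - 2 * y\<bar>" by (rule abs_sin_diff_le)
  also have "\<dots> \<le> 2 * (1 / y)" using d zy by linarith
  finally have S: "\<bar>sin (2 * z) - sin (2 * y)\<bar> \<le> 2 * (1 / y)" .
  have "sin (2 * z) / z - sin (2 * y) / y
      = (sin (2 * z) - sin (2 * y)) / y - sin (2 * z) * ((z - y) / (z * y))"
    using y zy by (simp add: field_simps)
  also have "\<bar>\<dots>\<bar> \<le> \<bar>(sin (2 * z) - sin (2 * y)) / y\<bar> + \<bar>sin (2 * z) * ((z - y) / (z * y))\<bar>"
    by (rule abs_triangle_ineq4)
  also have "\<dots> \<le> 2 * (1 / y) / y + 1 * ((1 / y) / y)"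
  proof (rule add_mono)
    have "\<bar>(sin (2 * z) - sin (2 * y)) / y\<bar> = \<bar>sin (2 * z) - sin (2 * y)\<bar> / y" using y by simp
    also have "\<dots> \<le> 2 * (1 / y) / y" using S y by (intro divide_right_mono) auto
    finally show "\<bar>(sin (2 * z) - sin (2 * y)) / y\<bar> \<le> 2 * (1 / y) / y" .
    have "1\<^sup>2 \<le> z * z" using zz m by simp
    hence "1 \<le> z" using y zy by (intro power2_le_imp_le[of 1 z]) (auto simp: power2_eq_square)
    hence "1 * y \<le> z * y" using y by (intro mult_right_mono) auto
    hence "(z - y) / (z * y) \<le> (1 / y) / y" using d y zy by (intro frac_le) auto
    moreover have "0 \<le> (z - y) / (z * y)" using zy y by auto
    ultimately show "\<bar>sin (2 * z) * ((z - y) / (z * y))\<bar> \<le> 1 * ((1 / y) / y)"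
      unfolding abs_mult by (intro mult_mono) auto
  qed
  also have "\<dots> = 3 / (y * y)" by simp
  also have "\<dots> \<le> 1 / m" unfolding y(2) using m by (simp add: field_simps)
  finally show ?thesis .
qed

theorem theorem4p1:
  "(\<lambda>n::nat. expected_durfee n
       - (2 / pi * sqrt (real n)
          + (3 / (16 * pi) - (exp 1)\<^sup>2 / (8 * pi) * sin (4 * sqrt (real n))) * (1 / sqrt (real n))))
     \<in> O(\<lambda>n. 1 / real n)"
proof -
  define z where "z n = 2 * sqrt (real n + 1 / 2)" for n :: nat
  define y where "y n = 2 * sqrt (real n)" for n :: nat
  define f1 where "f1 n = expected_durfee n - (z n / pi - 5 / (8 * pi * z n) - exp 2 * sin (2 * z n) / (4 * pi * z n))" for n
  \<comment> \<open>Here the constant changes: \<open>2 * sqrt (n + 1/2)\<close> exceeds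
    \<open>2 * sqrt n\<close> by about \<open>1 / (2 * sqrt n)\<close>, which turns
    \<open>- 5 / 16\<close> into \<open>3 / 16\<close>.\<close>
  define f2 where "f2 n = (z n / pi - 5 / (8 * pi * z n)) - (2 / pi * sqrt (real n) + 3 / (16 * pi) * (1 / sqrt (real n)))" for n
  define f3 where "f3 n = sin (2 * z n) / z n - sin (2 * y n) / y n" for n
  obtain C where C: "\<And>n z. n \<ge> 1 \<Longrightarrow> z = 2 * sqrt (real n + 1 / 2) \<Longrightarrow>
    \<bar>expected_durfee n - (z / pi - 5 / (8 * pi * z) - exp 2 * sin (2 * z) / (4 * pi * z))\<bar> \<le> C / z\<^sup>2"
    using expected_durfee_shifted_asymptotics by blast
  have "f1 \<in> O(\<lambda>n. 1 / (z n)\<^sup>2)"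
  proof (rule bigoI[of _ C])
    show "\<forall>\<^sub>F n in at_top. norm (f1 n) \<le> C * norm (1 / (z n)\<^sup>2)"
      using eventually_ge_at_top[of 1]
    proof eventually_elim
      case (elim n)
      show ?case using C[OF elim z_def[of n]] by (simp add: f1_def)
    qed
  qed
  also have "(\<lambda>n. 1 / (z n)\<^sup>2) \<in> O(\<lambda>n. 1 / real n)" unfolding z_def by real_asymp
  finally have 1: "f1 \<in> O(\<lambda>n. 1 / real n)" .
  have "(\<lambda>n. 2 * sqrt (real n + 1 / 2) - 5 / 16 * (1 / sqrt (real n + 1 / 2)) - 2 * sqrt (real n)
      - 3 / 16 * (1 / sqrt (real n))) \<in> O(\<lambda>n. 1 / real n)"
    by real_asymp
  moreover have f2: "f2 = (\<lambda>n. 1 / pi * (2 * sqrt (real n + 1 / 2) - 5 / 16 * (1 / sqrt (real n + 1 / 2))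
      - 2 * sqrt (real n) - 3 / 16 * (1 / sqrt (real n))))"
    by (rule ext) (simp add: f2_def z_def right_diff_distrib)
  ultimately have 2: "f2 \<in> O(\<lambda>n. 1 / real n)"
    unfolding f2 by (subst landau_o.big.cmult_in_iff) auto
  have 3: "f3 \<in> O(\<lambda>n. 1 / real n)"
  proof (rule bigoI[of _ 1])
    show "\<forall>\<^sub>F n in at_top. norm (f3 n) \<le> 1 * norm (1 / real n)"
      using eventually_ge_at_top[of 1]
    proof eventually_elim
      case (elim n)
      have "1 \<le> real n" using elim by simp
      from sin_over_shift_bound[OF this] show ?case by (simp add: f3_def z_def y_def)
    qed
  qed
  have "(\<lambda>n. exp 2 / (4 * pi) * f3 n) \<in> O(\<lambda>n. 1 / real n)"
    using 3 by (subst landau_o.big.cmult_in_iff) auto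
  hence "(\<lambda>n. f1 n + f2 n - exp 2 / (4 * pi) * f3 n) \<in> O(\<lambda>n. 1 / real n)"
    by (intro sum_in_bigo 1 2)
  moreover have "f1 n + f2 n - exp 2 / (4 * pi) * f3 n
    = expected_durfee n
       - (2 / pi * sqrt (real n)
          + (3 / (16 * pi) - (exp 1)\<^sup>2 / (8 * pi) * sin (4 * sqrt (real n))) * (1 / sqrt (real n)))" for n
  proof -
    have e: "(exp 1)\<^sup>2 = exp (2 :: real)" using exp_double[of "1::real"] by simp
    show ?thesis unfolding e f1_def f2_def f3_def y_def
      by (simp add: right_diff_distrib left_diff_distrib diff_divide_distrib)
  qed
  ultimately show ?thesis by simp
qed

end
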